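(* Let $\mathcal G$ be a compact metric graph with edge set $\mathcal E$, $p>2$, $W\in L^\infty(\mathcal G)$, and let $\rho\in L^\infty(\mathcal G)$ be such that $\inf_{\mathcal G}\rho>0$. Let $\Lambda\in(0,+\infty)$ and let $\mathcal U\subseteq[-\Lambda,\Lambda]\times H^1(\mathcal G)$ be a set of solutions $(\lambda,u)$ of $$\begin{cases}-u''+W(x)u+\lambda u=\rho(x)|u|^{p-2}u&\text{on every edge } e\in\mathcal E,\\ u\text{ is continuous on }\mathcal G,\\ \sum_{e\succ v}\frac{du_e}{dx}(v)=0&\text{at every vertex }v.\end{cases}$$ Then all solutions in $\mathcal U$ have a finite Morse index, and $$\sup_{(\lambda,u)\in\mathcal U}\|u\|_{L^\infty(\mathcal G)}<+\infty\iff\sup_{(\lambda,u)\in\mathcal U}\ \sup_{e\in\mathcal E}\|u\|_{C^1(e)}<+\infty\iff\sup_{(\lambda,u)\in\mathcal U}\mathrm m(u)<+\infty,$$ where $\mathrm m(u)$ is the Morse index of $u$.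
   Context: Metric graphs: $\mathcal G=(\mathcal E,\mathcal V)$ with edges $\mathcal E$ and vertices $\mathcal V$. A compact metric graph is a connected metric graph with finitely many edges, all of finite positive length; each edge $e$ is identified with $[0,\ell_e]$. $u_e$ is the restriction of $u$ to $e$. $H^1(\mathcal G)$ is the space of continuous $u:\mathcal G\to\mathbb R$ with $u_e\in H^1(0,\ell_e)$ for every edge. The notation $e\succ v$ means that $e$ is incident to $v$, and $\frac{du_e}{dx}(v)$ is the derivative along $e$ at $v$ directed away from $v$. Solutions are weak solutions: $\int_{\mathcal G}(u'\varphi'+(W+\lambda)u\varphi)\,dx=\int_{\mathcal G}\rho|u|^{p-2}u\varphi\,dx$ for all $\varphi\in H^1(\mathcal G)$. Infima of functions defined a.e. are essential infima. The Morse index $\mathrm m(u)$ of a solution $(\lambda,u)$ is the maximal dimension (or $+\infty$ if there is no maximal integer) of a subspace $X\subset H^1(\mathcal G)$ such that $\int_{\mathcal G}(|\varphi'|^2+(W+\lambda)\varphi^2-(p-1)\rho|u|^{p-2}\varphi^2)\,dx<0$ for all $\varphi\in X\setminus\{0\}$. *)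

theory Defs
  imports
    "HOL-Probability.Essential_Supremum"
    "HOL-Library.Function_Algebras"
    "HOL-Library.Extended_Nat"
    "Graph_Theory.Digraph_Component"
begin

section \<open>Compact metric graphs\<close>

text \<open>
  The combinatorial graph may have loops and parallel edges. The orientation of an arc only fixes
  the identification of the edge \<open>e\<close> with \<open>{0..len e}\<close>: the tail sits at \<open>0\<close>, the head at \<open>len e\<close>.
  Connectedness is that of the underlying undirected graph. The name is qualified because
  \<^const>\<open>Topological_Spaces.connected\<close> is also in scope.
\<close>

locale compact_metric_graph = wf_digraph G
  for G :: "('v, 'e) pre_digraph" +
  fixes len :: "'e \<Rightarrow> real"
  assumes finite_edges: "finite (arcs G)"
    and connected: "Digraph_Component.connected G"
    and len_pos: "e \<in> arcs G \<Longrightarrow> 0 < len e"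

datatype ('v, 'e) point = Vertex 'v | Interior 'e real

definition points :: "('v, 'e) pre_digraph \<Rightarrow> ('e \<Rightarrow> real) \<Rightarrow> ('v, 'e) point set" where
  "points G len = Vertex ` verts G \<union> {Interior e x | e x. e \<in> arcs G \<and> 0 < x \<and> x < len e}"

definition edge_point ::
  "('v, 'e) pre_digraph \<Rightarrow> ('e \<Rightarrow> real) \<Rightarrow> 'e \<Rightarrow> real \<Rightarrow> ('v, 'e) point" where
  "edge_point G len e x =
     (if x = 0 then Vertex (tail G e) else if x = len e then Vertex (head G e) else Interior e x)"

text \<open>The restriction \<open>u\<^sub>e\<close>, as a function on \<open>{0..len e}\<close>.\<close>

definition on_edge ::
  "('v, 'e) pre_digraph \<Rightarrow> ('e \<Rightarrow> real) \<Rightarrow> (('v, 'e) point \<Rightarrow> real) \<Rightarrow> 'e \<Rightarrow> real \<Rightarrow> real" where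
  "on_edge G len u e = (\<lambda>x. u (edge_point G len e x))"

text \<open>
  The quotient topology of the disjoint union of the intervals \<open>{0..len e}\<close>; for finitely many
  edges it is the topology of the path metric.
\<close>

definition graph_open ::
  "('v, 'e) pre_digraph \<Rightarrow> ('e \<Rightarrow> real) \<Rightarrow> ('v, 'e) point set \<Rightarrow> bool" where
  "graph_open G len U \<longleftrightarrow> U \<subseteq> points G len \<and>
     (\<forall>e\<in>arcs G. openin (top_of_set {0..len e}) {x \<in> {0..len e}. edge_point G len e x \<in> U})"

definition graph_topology ::
  "('v, 'e) pre_digraph \<Rightarrow> ('e \<Rightarrow> real) \<Rightarrow> ('v, 'e) point topology" where
  "graph_topology G len = topology (graph_open G len)"

lemma istopology_graph_open: "istopology (graph_open G len)"
  unfolding istopology_def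
proof (intro conjI allI impI)
  fix S T assume S: "graph_open G len S" and T: "graph_open G len T"
  have "{x \<in> {0..len e}. edge_point G len e x \<in> S \<inter> T} =
      {x \<in> {0..len e}. edge_point G len e x \<in> S} \<inter> {x \<in> {0..len e}. edge_point G len e x \<in> T}"
    for e by auto
  then show "graph_open G len (S \<inter> T)"
    using S T unfolding graph_open_def by (auto simp del: Int_iff intro!: openin_Int)
next
  fix K assume K: "\<forall>U\<in>K. graph_open G len U"
  have "{x \<in> {0..len e}. edge_point G len e x \<in> \<Union>K} =
      \<Union> ((\<lambda>U. {x \<in> {0..len e}. edge_point G len e x \<in> U}) ` K)" for e by auto
  moreover have "openin (top_of_set {0..len e})
      (\<Union> ((\<lambda>U. {x \<in> {0..len e}. edge_point G len e x \<in> U}) ` K))" if "e \<in> arcs G" for e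
    using K that unfolding graph_open_def by (intro openin_Union) auto
  ultimately show "graph_open G len (\<Union>K)"
    using K unfolding graph_open_def by (simp only:) blast
qed

lemma openin_graph_topology: "openin (graph_topology G len) = graph_open G len"
  unfolding graph_topology_def by (rule topology_inverse'[OF istopology_graph_open])

context compact_metric_graph
begin

lemma edge_point_in_points:
  "e \<in> arcs G \<Longrightarrow> x \<in> {0..len e} \<Longrightarrow> edge_point G len e x \<in> points G len"
  by (auto simp: edge_point_def points_def)

lemma vertex_incident:
  assumes "arcs G \<noteq> {}" "v \<in> verts G"
  shows "\<exists>e\<in>arcs G. v = tail G e \<or> v = head G e"
proof (rule ccontr)
  assume no: "\<not> ?thesis"
  obtain e where e: "e \<in> arcs G" using assms by auto
  let ?H = "with_proj (mk_symmetric G)"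
  have "v \<rightarrow>\<^sup>*\<^bsub>?H\<^esub> tail G e"
    using connected assms e unfolding Digraph_Component.connected_def strongly_connected_def
    by (auto simp: mk_symmetric_def)
  then have "(v, tail G e) \<in> rtrancl_on (verts ?H) (arcs_ends ?H)"
    by (simp add: reachable_def)
  then show False
    using no e
    by (cases rule: converse_rtrancl_on_cases)
       (auto simp: arcs_ends_def mk_symmetric_def arc_to_ends_def)
qed

lemma topspace_graph_topology: "topspace (graph_topology G len) = points G len"
proof (rule antisym)
  show "topspace (graph_topology G len) \<subseteq> points G len"
    unfolding topspace_def openin_graph_topology graph_open_def by auto
  have "{x \<in> {0..len e}. edge_point G len e x \<in> points G len} = {0..len e}" if "e \<in> arcs G" for e
    using edge_point_in_points[OF that] by auto
  then have "graph_open G len (points G len)"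
    unfolding graph_open_def by (metis openin_subtopology_self subset_refl)
  then show "points G len \<subseteq> topspace (graph_topology G len)"
    unfolding topspace_def openin_graph_topology by auto
qed

lemma continuous_map_graph_iff:
  "continuous_map (graph_topology G len) euclideanreal u \<longleftrightarrow>
     (\<forall>e\<in>arcs G. continuous_on {0..len e} (on_edge G len u e))"
proof -
  have "{x \<in> {0..len e}. edge_point G len e x \<in> {p \<in> points G len. u p \<in> V}} =
      {0..len e} \<inter> on_edge G len u e -` V" if "e \<in> arcs G" for e V
    using edge_point_in_points[OF that] by (auto simp: on_edge_def)
  then have "graph_open G len {p \<in> points G len. u p \<in> V} \<longleftrightarrow>
      (\<forall>e\<in>arcs G. openin (top_of_set {0..len e}) ({0..len e} \<inter> on_edge G len u e -` V))" for V
    unfolding graph_open_def by auto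
  then show ?thesis
    unfolding continuous_map_def topspace_graph_topology openin_graph_topology
    by (auto simp: continuous_on_open_gen[where T=UNIV] continuous_openin_preimage_eq
        open_openin[symmetric])
qed

end


section \<open>Function spaces\<close>

definition L2_interval :: "real \<Rightarrow> (real \<Rightarrow> real) set" where
  "L2_interval l = {f. f \<in> borel_measurable (lebesgue_on {0..l}) \<and>
     integrable (lebesgue_on {0..l}) (\<lambda>x. (f x)\<^sup>2)}"

text \<open>Test functions in \<open>C\<^sup>1\<^sub>c(0, l)\<close>, extended by zero.\<close>

definition test_functions :: "real \<Rightarrow> (real \<Rightarrow> real) set" where
  "test_functions l =
     {\<phi>. \<phi> C1_differentiable_on UNIV \<and> closure {x. \<phi> x \<noteq> 0} \<subseteq> {0<..<l}}"

definition has_weak_deriv :: "real \<Rightarrow> (real \<Rightarrow> real) \<Rightarrow> (real \<Rightarrow> real) \<Rightarrow> bool" where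
  "has_weak_deriv l f g \<longleftrightarrow> (\<forall>\<phi>\<in>test_functions l.
     (LINT x|lebesgue_on {0..l}. f x * deriv \<phi> x) = - (LINT x|lebesgue_on {0..l}. g x * \<phi> x))"

definition H1_interval :: "real \<Rightarrow> (real \<Rightarrow> real) set" where
  "H1_interval l = {f \<in> L2_interval l. \<exists>g\<in>L2_interval l. has_weak_deriv l f g}"

text \<open>A representative; weak derivatives are unique up to null sets.\<close>

definition weak_deriv :: "real \<Rightarrow> (real \<Rightarrow> real) \<Rightarrow> real \<Rightarrow> real" where
  "weak_deriv l f = (SOME g. g \<in> L2_interval l \<and> has_weak_deriv l f g)"

definition edge_deriv ::
  "('v, 'e) pre_digraph \<Rightarrow> ('e \<Rightarrow> real) \<Rightarrow> (('v, 'e) point \<Rightarrow> real) \<Rightarrow> 'e \<Rightarrow> real \<Rightarrow> real" where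
  "edge_deriv G len u e = weak_deriv (len e) (on_edge G len u e)"

text \<open>
  Functions vanish outside the graph, so that equality of functions on the graph is equality in
  HOL and \<open>H1 G len\<close> is a linear subspace.
\<close>

definition H1 :: "('v, 'e) pre_digraph \<Rightarrow> ('e \<Rightarrow> real) \<Rightarrow> (('v, 'e) point \<Rightarrow> real) set" where
  "H1 G len = {u. continuous_map (graph_topology G len) euclideanreal u \<and>
     (\<forall>e\<in>arcs G. on_edge G len u e \<in> H1_interval (len e)) \<and>
     (\<forall>a. a \<notin> points G len \<longrightarrow> u a = 0)}"

definition Linf_norm ::
  "('v, 'e) pre_digraph \<Rightarrow> ('e \<Rightarrow> real) \<Rightarrow> (('v, 'e) point \<Rightarrow> real) \<Rightarrow> ennreal" where
  "Linf_norm G len f =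
     (SUP e\<in>arcs G. esssup (lebesgue_on {0..len e}) (\<lambda>x. ennreal \<bar>on_edge G len f e x\<bar>))"

definition Linf :: "('v, 'e) pre_digraph \<Rightarrow> ('e \<Rightarrow> real) \<Rightarrow> (('v, 'e) point \<Rightarrow> real) set" where
  "Linf G len =
     {f. (\<forall>e\<in>arcs G. on_edge G len f e \<in> borel_measurable (lebesgue_on {0..len e})) \<and>
         Linf_norm G len f < \<infinity>}"

definition ess_inf ::
  "('v, 'e) pre_digraph \<Rightarrow> ('e \<Rightarrow> real) \<Rightarrow> (('v, 'e) point \<Rightarrow> real) \<Rightarrow> ereal" where
  "ess_inf G len f =
     (INF e\<in>arcs G. - esssup (lebesgue_on {0..len e}) (\<lambda>x. - ereal (on_edge G len f e x)))"

text \<open>The \<open>C\<^sup>1([0, l])\<close> norm, with one-sided derivatives at the endpoints; \<open>\<infinity>\<close> if \<open>f\<close> is not \<open>C\<^sup>1\<close>.\<close>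

definition C1_norm :: "real \<Rightarrow> (real \<Rightarrow> real) \<Rightarrow> ennreal" where
  "C1_norm l f =
     (if \<exists>f'. continuous_on {0..l} f' \<and>
             (\<forall>x\<in>{0..l}. (f has_vector_derivative f' x) (at x within {0..l}))
      then (SUP x\<in>{0..l}. ennreal \<bar>f x\<bar>) +
           (SUP x\<in>{0..l}. ennreal \<bar>vector_derivative f (at x within {0..l})\<bar>)
      else \<infinity>)"


section \<open>Solutions and Morse index\<close>

definition graph_integral ::
  "('v, 'e) pre_digraph \<Rightarrow> ('e \<Rightarrow> real) \<Rightarrow> ('e \<Rightarrow> real \<Rightarrow> real) \<Rightarrow> real" where
  "graph_integral G len F = (\<Sum>e\<in>arcs G. LINT x|lebesgue_on {0..len e}. F e x)"

text \<open>
  Weak solutions; the Kirchhoff condition is the natural boundary condition of this formulation.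
\<close>

definition is_solution ::
  "('v, 'e) pre_digraph \<Rightarrow> ('e \<Rightarrow> real) \<Rightarrow> (('v, 'e) point \<Rightarrow> real) \<Rightarrow> (('v, 'e) point \<Rightarrow> real) \<Rightarrow>
     real \<Rightarrow> real \<Rightarrow> (('v, 'e) point \<Rightarrow> real) \<Rightarrow> bool" where
  "is_solution G len W \<rho> p lam u \<longleftrightarrow> u \<in> H1 G len \<and>
     (\<forall>\<phi>\<in>H1 G len.
        graph_integral G len (\<lambda>e x.
          edge_deriv G len u e x * edge_deriv G len \<phi> e x +
          (on_edge G len W e x + lam) * on_edge G len u e x * on_edge G len \<phi> e x) =
        graph_integral G len (\<lambda>e x.
          on_edge G len \<rho> e x * \<bar>on_edge G len u e x\<bar> powr (p - 2) *
          on_edge G len u e x * on_edge G len \<phi> e x))"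

definition second_variation ::
  "('v, 'e) pre_digraph \<Rightarrow> ('e \<Rightarrow> real) \<Rightarrow> (('v, 'e) point \<Rightarrow> real) \<Rightarrow> (('v, 'e) point \<Rightarrow> real) \<Rightarrow>
     real \<Rightarrow> real \<Rightarrow> (('v, 'e) point \<Rightarrow> real) \<Rightarrow> (('v, 'e) point \<Rightarrow> real) \<Rightarrow> real" where
  "second_variation G len W \<rho> p lam u \<phi> =
     graph_integral G len (\<lambda>e x.
       (edge_deriv G len \<phi> e x)\<^sup>2 +
       (on_edge G len W e x + lam) * (on_edge G len \<phi> e x)\<^sup>2 -
       (p - 1) * on_edge G len \<rho> e x * \<bar>on_edge G len u e x\<bar> powr (p - 2) *
       (on_edge G len \<phi> e x)\<^sup>2)"

definition fun_scale :: "real \<Rightarrow> ('a \<Rightarrow> real) \<Rightarrow> 'a \<Rightarrow> real" where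
  "fun_scale c u = (\<lambda>a. c * u a)"

interpretation fun_space: vector_space fun_scale
  by unfold_locales (auto simp: fun_scale_def fun_eq_iff algebra_simps)

text \<open>\<^const>\<open>vector_space.dim\<close> is \<open>0\<close> on infinite-dimensional spaces, hence the case distinction.\<close>

definition edim :: "('a \<Rightarrow> real) set \<Rightarrow> enat" where
  "edim X = (if \<exists>B. finite B \<and> fun_space.span B = X then enat (fun_space.dim X) else \<infinity>)"

text \<open>
  In \<^typ>\<open>enat\<close> the supremum is the maximal dimension if there is one, and \<open>\<infinity>\<close> otherwise.
\<close>

definition morse_index ::
  "('v, 'e) pre_digraph \<Rightarrow> ('e \<Rightarrow> real) \<Rightarrow> (('v, 'e) point \<Rightarrow> real) \<Rightarrow> (('v, 'e) point \<Rightarrow> real) \<Rightarrow>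
     real \<Rightarrow> real \<Rightarrow> (('v, 'e) point \<Rightarrow> real) \<Rightarrow> enat" where
  "morse_index G len W \<rho> p lam u =
     Sup {edim X | X. fun_space.subspace X \<and> X \<subseteq> H1 G len \<and>
       (\<forall>\<phi>\<in>X - {0}. second_variation G len W \<rho> p lam u \<phi> < 0)}"

end

theory Submission
  imports Defs
begin

text \<open>
  Let \<open>u\<close> be a solution with \<open>|u| \<le> A\<close>. If \<open>\<phi>\<close> vanishes on a fine enough finite set of points,
  whose size depends only on \<open>A\<close>, then \<open>\<integral> \<phi>\<^sup>2\<close> is a small multiple of \<open>\<integral> |\<phi>'|\<^sup>2\<close> and the second
  variation at \<open>\<phi>\<close> is nonnegative; so the Morse index is at most the number of points. The
  \<open>C\<^sup>1\<close> bound follows from the equation, which gives \<open>u'\<close> a Lipschitz constant depending on \<open>A\<close>.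

  Conversely, let \<open>m\<close> be the maximum of \<open>|u|\<close> on an edge. Rescaling lengths by \<open>m powr ((p - 2) / 2)\<close> around
  the maximum point turns the equation into \<open>v'' = - \<rho> |v| powr (p - 2) v\<close> up to a small linear term. On
  the longer side of the maximum point \<open>v\<close> starts at height \<open>1\<close> with nonpositive slope (also when that point is
  a vertex, so Kirchhoff's condition plays no role), and concavity forces it to cross \<open>0\<close> and to
  turn round at a definite depth within a definite time. Repeating this, \<open>u\<close> has many zeros on the
  edge when \<open>m\<close> is large. The restrictions of \<open>u\<close> to the intervals between consecutive zeros
  span a space on which the second variation is negative definite.
\<close>

section \<open>Weak derivatives on an interval\<close>

text \<open>The coefficients \<open>W\<close> and \<open>\<rho>\<close> are merely bounded and
  measurable. Zooming in at a maximum point gives no pointwise limit of the rescaled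
  \<open>\<rho>\<close>, so a limit equation is hard to come by; what survives rescaling are the
  bounds r \<le> \<rho> \<le> R. The oscillation is therefore proved quantitatively, with times and
  thresholds computed from the constants alone, and the same numbers serve every solution at once.
  For the same reason u'' exists only almost everywhere, and the equation enters as inequalities
  between the values of u' at two points. Large solutions are studied on a single edge. Test
  functions vanishing at both ends extend by zero to the graph, so a function that is negative for
  the second variation of the edge is negative for that of the graph, and the nodal intervals of one
  edge already bound the Morse index from below. A further obstacle is that the derivative of an
  \<open>H1\<close> function is an arbitrarily chosen representative. It has to be tied to a
  continuous classical derivative before slopes at single points make sense.\<close>

lemma L2_interval_mult_integrable:
  assumes "f \<in> L2_interval l" "g \<in> L2_interval l"
  shows "integrable (lebesgue_on {0..l}) (\<lambda>x. f x * g x)"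
proof (rule Bochner_Integration.integrable_bound)
  show "integrable (lebesgue_on {0..l}) (\<lambda>x. (f x)\<^sup>2 + (g x)\<^sup>2)"
    using assms by (auto simp: L2_interval_def)
  show "(\<lambda>x. f x * g x) \<in> borel_measurable (lebesgue_on {0..l})"
    using assms by (auto simp: L2_interval_def)
  have "\<bar>f x * g x\<bar> \<le> (f x)\<^sup>2 + (g x)\<^sup>2" for x
  proof -
    have "2 * \<bar>f x\<bar> * \<bar>g x\<bar> \<le> (f x)\<^sup>2 + (g x)\<^sup>2" using sum_squares_bound[of "\<bar>f x\<bar>" "\<bar>g x\<bar>"] by simp
    moreover have "0 \<le> \<bar>f x\<bar> * \<bar>g x\<bar>" by simp
    ultimately show ?thesis unfolding abs_mult by linarith
  qed
  then show "AE x in lebesgue_on {0..l}. norm (f x * g x) \<le> norm ((f x)\<^sup>2 + (g x)\<^sup>2)"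
    by auto
qed

lemma finite_measure_interval: "finite_measure (lebesgue_on {a..b::real})"
  by (rule finite_measure_lebesgue_on) auto

lemma bounded_L2_interval:
  assumes "f \<in> borel_measurable (lebesgue_on {0..l})" "AE x in lebesgue_on {0..l}. \<bar>f x\<bar> \<le> B"
  shows "f \<in> L2_interval l"
proof -
  interpret finite_measure "lebesgue_on {0..l}" by (rule finite_measure_interval)
  have "AE x in lebesgue_on {0..l}. norm ((f x)\<^sup>2) \<le> B\<^sup>2"
    using assms(2)
  proof eventually_elim
    case (elim x)
    show ?case using power_mono[OF elim, of 2] by simp
  qed
  then show ?thesis
    using assms(1) by (auto simp: L2_interval_def intro!: integrable_const_bound[where B="B\<^sup>2"])
qed

lemma continuous_L2_interval:
  assumes "continuous_on {0..l} f"
  shows "f \<in> L2_interval l"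
proof -
  have "bounded (f ` {0..l})"
    using assms by (intro compact_imp_bounded compact_continuous_image) auto
  then obtain B where "\<forall>x\<in>{0..l}. \<bar>f x\<bar> \<le> B" unfolding bounded_iff by auto
  then show ?thesis
    using assms
    by (intro bounded_L2_interval[where B=B] continuous_imp_measurable_on_sets_lebesgue) (auto intro!: AE_I2)
qed

lemma L2_interval_integrable:
  assumes "f \<in> L2_interval l"
  shows "integrable (lebesgue_on {0..l}) f"
  using L2_interval_mult_integrable[OF assms continuous_L2_interval[of l "\<lambda>_. 1"]] by simp

lemma L2_interval_bounded_mult:
  assumes "f \<in> L2_interval l" "c \<in> borel_measurable (lebesgue_on {0..l})"
    "AE x in lebesgue_on {0..l}. \<bar>c x\<bar> \<le> B"
  shows "(\<lambda>x. c x * f x) \<in> L2_interval l"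
proof -
  have "AE x in lebesgue_on {0..l}. norm ((c x * f x)\<^sup>2) \<le> norm (B\<^sup>2 * (f x)\<^sup>2)"
    using assms(3)
  proof eventually_elim
    case (elim x)
    show ?case using mult_right_mono[OF power_mono[OF elim, of 2], of "(f x)\<^sup>2"]
      by (simp add: power_mult_distrib)
  qed
  moreover have "integrable (lebesgue_on {0..l}) (\<lambda>x. B\<^sup>2 * (f x)\<^sup>2)"
    using assms by (auto simp: L2_interval_def)
  moreover have "(\<lambda>x. c x * f x) \<in> borel_measurable (lebesgue_on {0..l})"
    using assms by (auto simp: L2_interval_def)
  moreover have "(\<lambda>x. (c x * f x)\<^sup>2) \<in> borel_measurable (lebesgue_on {0..l})"
    using assms by (auto simp: L2_interval_def)
  ultimately show ?thesis
    using Bochner_Integration.integrable_bound[of "lebesgue_on {0..l}" "\<lambda>x. B\<^sup>2 * (f x)\<^sup>2" "\<lambda>x. (c x * f x)\<^sup>2"]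
    unfolding L2_interval_def by blast
qed

lemma L2_interval_diff:
  assumes "f \<in> L2_interval l" "g \<in> L2_interval l"
  shows "(\<lambda>x. f x - g x) \<in> L2_interval l"
proof -
  have "integrable (lebesgue_on {0..l}) (\<lambda>x. (f x)\<^sup>2 - 2 * (f x * g x) + (g x)\<^sup>2)"
    using assms L2_interval_mult_integrable[OF assms]
    by (auto simp: L2_interval_def)
  then show ?thesis
    using assms by (auto simp: L2_interval_def power2_diff algebra_simps)
qed

lemma test_functionD:
  assumes "\<phi> \<in> test_functions l"
  shows "\<And>x. (\<phi> has_real_derivative deriv \<phi> x) (at x)" "continuous_on UNIV (deriv \<phi>)"
    "continuous_on UNIV \<phi>" "\<And>x. x \<notin> {0<..<l} \<Longrightarrow> \<phi> x = 0"
proof -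
  obtain D where D: "\<And>x. (\<phi> has_real_derivative D x) (at x)" "continuous_on UNIV D"
    using assms unfolding test_functions_def C1_differentiable_on_def
    by (auto simp: has_real_derivative_iff_has_vector_derivative)
  have eq: "deriv \<phi> = D" using D(1) by (auto intro: DERIV_imp_deriv)
  show "\<And>x. (\<phi> has_real_derivative deriv \<phi> x) (at x)" "continuous_on UNIV (deriv \<phi>)"
    using D eq by auto
  show "continuous_on UNIV \<phi>"
    using D(1) by (rule DERIV_continuous_on)
  fix x assume x: "x \<notin> {0<..<l}"
  have "{x. \<phi> x \<noteq> 0} \<subseteq> {0<..<l}"
    using assms closure_subset[of "{x. \<phi> x \<noteq> 0}"] unfolding test_functions_def
    by (auto dest: subset_trans)
  with x show "\<phi> x = 0" by blast
qed

text \<open>Integration by parts across the points of \<open>S\<close>: continuity of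
  \<open>f\<close> excludes jump terms there, and \<open>\<phi>\<close> kills the terms at the ends.
  This is how hand-made piecewise functions become members of \<open>H1\<close>.\<close>

lemma has_weak_deriv_piecewise:
  assumes l: "0 < l" and cont: "continuous_on {0..l} f" and S: "finite S"
    and der: "\<And>x. x \<in> {0<..<l} - S \<Longrightarrow> (f has_real_derivative g x) (at x)"
    and g: "g \<in> L2_interval l"
  shows "has_weak_deriv l f g"
  unfolding has_weak_deriv_def
proof
  fix \<phi> assume "\<phi> \<in> test_functions l"
  note \<phi> = test_functionD[OF this]
  have c: "continuous_on {0..l} \<phi>" "continuous_on {0..l} (deriv \<phi>)"
    using \<phi>(2,3) by (auto intro: continuous_on_subset)
  have i1: "integrable (lebesgue_on {0..l}) (\<lambda>x. g x * \<phi> x)"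
    by (intro L2_interval_mult_integrable g continuous_L2_interval c)
  have i2: "integrable (lebesgue_on {0..l}) (\<lambda>x. f x * deriv \<phi> x)"
    by (intro L2_interval_mult_integrable continuous_L2_interval c cont)
  have "((\<lambda>x. g x * \<phi> x + f x * deriv \<phi> x) has_integral (f l * \<phi> l - f 0 * \<phi> 0)) {0..l}"
  proof (rule fundamental_theorem_of_calculus_interior_strong[OF S])
    show "0 \<le> l" using l by simp
    show "continuous_on {0..l} (\<lambda>x. f x * \<phi> x)" by (intro continuous_intros c cont)
    fix x assume "x \<in> {0<..<l} - S"
    from DERIV_mult[OF der[OF this] \<phi>(1)[of x]]
    show "((\<lambda>x. f x * \<phi> x) has_vector_derivative g x * \<phi> x + f x * deriv \<phi> x) (at x)"
      by (simp add: has_real_derivative_iff_has_vector_derivative[symmetric] algebra_simps)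
  qed
  then have "integral {0..l} (\<lambda>x. g x * \<phi> x + f x * deriv \<phi> x) = 0"
    using \<phi>(4)[of 0] \<phi>(4)[of l] by (simp add: integral_unique)
  moreover have "(LINT x|lebesgue_on {0..l}. g x * \<phi> x + f x * deriv \<phi> x) =
      integral {0..l} (\<lambda>x. g x * \<phi> x + f x * deriv \<phi> x)"
    using i1 i2 by (intro lebesgue_integral_eq_integral) auto
  ultimately show "(LINT x|lebesgue_on {0..l}. f x * deriv \<phi> x) = - (LINT x|lebesgue_on {0..l}. g x * \<phi> x)"
    using i1 i2 by simp
qed

section \<open>A C1 approximation of the unit step\<close>

definition smooth_step :: "real \<Rightarrow> real" where
  "smooth_step t = 2 * (max 0 t)\<^sup>2 - 4 * (max 0 (t - 1/2))\<^sup>2 + 2 * (max 0 (t - 1))\<^sup>2"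

text \<open>The tent over [0, 1] with peak 2 and mass 1, the derivative of
  \<open>smooth_step\<close>. A quadratic spline is smooth enough because
  \<open>test_functions\<close> asks for C1 only.\<close>

definition hat :: "real \<Rightarrow> real" where
  "hat t = 4 * max 0 t - 8 * max 0 (t - 1/2) + 4 * max 0 (t - 1)"

lemma has_real_derivative_max_square:
  "((\<lambda>x::real. (max 0 x)\<^sup>2) has_real_derivative 2 * max 0 x) (at x)"
proof (cases x "0::real" rule: linorder_cases)
  case less
  have "((\<lambda>x::real. 0) has_real_derivative 2 * max 0 x) (at x)" using less by auto
  then show ?thesis
    by (rule has_field_derivative_transform_within_open[of _ _ _ "{..<0}"]) (use less in auto)
next
  case greater
  have "((\<lambda>x::real. x\<^sup>2) has_real_derivative 2 * max 0 x) (at x)"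
    using greater by (auto intro!: derivative_eq_intros)
  then show ?thesis
    by (rule has_field_derivative_transform_within_open[of _ _ _ "{0<..}"]) (use greater in auto)
next
  case equal
  have "((\<lambda>h::real. (max 0 h)\<^sup>2 / h) \<longlongrightarrow> 0) (at 0)"
  proof (rule Lim_null_comparison)
    have "norm ((max 0 h)\<^sup>2 / h) \<le> \<bar>h\<bar>" for h :: real
      by (cases "h > 0") (auto simp: power2_eq_square)
    then show "\<forall>\<^sub>F h in at 0. norm ((max 0 h)\<^sup>2 / h) \<le> \<bar>h::real\<bar>" by auto
    show "((\<lambda>h::real. \<bar>h\<bar>) \<longlongrightarrow> 0) (at 0)" by (intro tendsto_eq_intros) auto
  qed
  then show ?thesis using equal by (simp add: DERIV_def)
qed

lemma smooth_step_deriv: "(smooth_step has_real_derivative hat t) (at t)"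
proof -
  have d: "((\<lambda>x. (max 0 (x - c))\<^sup>2) has_real_derivative 2 * max 0 (t - c)) (at t)" for c
    using DERIV_shift[of "\<lambda>x. (max 0 x)\<^sup>2" "2 * max 0 (t - c)" t "-c"] has_real_derivative_max_square[of "t - c"]
    by simp
  have d0: "((\<lambda>x. (max 0 x)\<^sup>2) has_real_derivative 2 * max 0 t) (at t)"
    by (rule has_real_derivative_max_square)
  show ?thesis unfolding smooth_step_def[abs_def] hat_def
    by (rule derivative_eq_intros refl d d0)+ simp
qed

lemma smooth_step_values: "t \<le> 0 \<Longrightarrow> smooth_step t = 0" "1 \<le> t \<Longrightarrow> smooth_step t = 1"
  by (auto simp: smooth_step_def max_def power2_eq_square algebra_simps)

lemma hat_nonneg: "0 \<le> hat t"
  by (auto simp: hat_def max_def)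

lemma hat_eq_0: "t \<notin> {0<..<1} \<Longrightarrow> hat t = 0"
  by (auto simp: hat_def max_def)

lemma continuous_hat: "continuous_on UNIV hat"
  unfolding hat_def[abs_def] by (intro continuous_intros)

lemma smooth_step_mono: "s \<le> t \<Longrightarrow> smooth_step s \<le> smooth_step t"
  by (rule DERIV_nonneg_imp_nondecreasing) (use smooth_step_deriv hat_nonneg in \<open>auto\<close>)

lemma smooth_step_bounds: "0 \<le> smooth_step t" "smooth_step t \<le> 1"
proof -
  show "0 \<le> smooth_step t"
    using smooth_step_mono[of 0 t] smooth_step_values(1)[of 0] smooth_step_values(1)[of t] by linarith
  show "smooth_step t \<le> 1"
    using smooth_step_mono[of t 1] smooth_step_values(2)[of 1] smooth_step_values(2)[of t] by linarith
qed

section \<open>Fundamental theorem of calculus for weak derivatives\<close>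

context
  fixes l :: real and f g :: "real \<Rightarrow> real"
  assumes cont: "continuous_on {0..l} f" and g: "g \<in> L2_interval l" and fg: "has_weak_deriv l f g"
begin

text \<open>The kernels have mass 1 and live on [a, a + 1/n], so they are a one-sided approximate
  identity at \<open>a\<close>. They occur as derivatives of the test functions used below.\<close>

lemma approximate_value:
  assumes a: "0 < a" "a < l"
  shows "(\<lambda>n. LINT x|lebesgue_on {0..l}. f x * (real n * hat (real n * (x - a)))) \<longlonglongrightarrow> f a"
proof (rule LIMSEQ_I)
  fix r :: real assume r: "0 < r"
  have "isCont f a"
    using cont a by (auto simp: continuous_on_interior)
  then obtain \<delta> where \<delta>: "\<delta> > 0" "\<And>x. \<bar>x - a\<bar> < \<delta> \<Longrightarrow> \<bar>f x - f a\<bar> < r / 2"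
    using r unfolding continuous_at_eps_delta by (metis dist_real_def half_gt_zero)
  \<comment> \<open>The first condition shrinks the kernel into the
    \<open>\<delta>\<close>-neighbourhood of \<open>a\<close>; the second keeps its support left of
    \<open>l\<close>, so that no mass is cut off.\<close>
  obtain N where N: "real N > 1 / \<delta>" "real N > 1 / (l - a)"
    using reals_Archimedean2[of "max (1 / \<delta>) (1 / (l - a))"] by auto
  show "\<exists>no. \<forall>n\<ge>no. norm ((LINT x|lebesgue_on {0..l}. f x * (real n * hat (real n * (x - a)))) - f a) < r"
  proof (intro exI[of _ N] allI impI)
    fix n assume "n \<ge> N"
    then have n: "real n > 1 / \<delta>" "real n > 1 / (l - a)" using N by auto
    then have n0: "real n > 0" using \<delta>(1) by (meson less_trans zero_less_divide_1_iff)
    define D where "D x = real n * hat (real n * (x - a))" for x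
    have D0: "0 \<le> D x" for x using n0 hat_nonneg by (simp add: D_def)
    have Dsupp: "D x = 0" if "\<not> \<bar>x - a\<bar> < \<delta>" for x
    proof -
      have "real n * (x - a) \<notin> {0<..<1}"
      proof
        assume "real n * (x - a) \<in> {0<..<1}"
        then have "x - a > 0" "x - a < 1 / real n"
          using n0 by (auto simp: zero_less_mult_iff field_simps)
        moreover have "1 / real n < \<delta>" using n n0 \<delta> by (simp add: field_simps)
        ultimately show False using that by linarith
      qed
      then show ?thesis by (simp add: D_def hat_eq_0)
    qed
    have contD: "continuous_on {0..l} D" unfolding D_def
      by (intro continuous_intros continuous_on_compose2[OF continuous_hat]) auto
    have "(D has_integral smooth_step (real n * (l - a)) - smooth_step (real n * (0 - a))) {0..l}"
    proof (rule fundamental_theorem_of_calculus)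
      fix x
      have "((\<lambda>x. smooth_step (real n * (x - a))) has_real_derivative hat (real n * (x - a)) * real n) (at x within {0..l})"
        by (rule DERIV_chain2[OF smooth_step_deriv]) (auto intro!: derivative_eq_intros)
      then show "((\<lambda>x. smooth_step (real n * (x - a))) has_vector_derivative D x) (at x within {0..l})"
        by (simp add: D_def has_real_derivative_iff_has_vector_derivative mult.commute)
    qed (use a in auto)
    moreover have "smooth_step (real n * (l - a)) = 1"
      using n a by (intro smooth_step_values) (simp add: field_simps)
    moreover have "smooth_step (real n * (0 - a)) = 0"
      using n0 a by (intro smooth_step_values) simp
    ultimately have "integral {0..l} D = 1" by (simp add: integral_unique)
    moreover have iD: "integrable (lebesgue_on {0..l}) D"
      by (intro L2_interval_integrable continuous_L2_interval contD)
    ultimately have ID: "(LINT x|lebesgue_on {0..l}. D x) = 1"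
      by (simp add: lebesgue_integral_eq_integral)
    have ifD: "integrable (lebesgue_on {0..l}) (\<lambda>x. f x * D x)"
      by (intro L2_interval_integrable continuous_L2_interval continuous_intros contD cont)
    have "(LINT x|lebesgue_on {0..l}. f x * D x) - f a = (LINT x|lebesgue_on {0..l}. (f x - f a) * D x)"
      using iD ifD ID by (simp add: left_diff_distrib)
    also have "norm \<dots> \<le> (LINT x|lebesgue_on {0..l}. norm ((f x - f a) * D x))"
      by (rule integral_norm_bound)
    also have "\<dots> \<le> (LINT x|lebesgue_on {0..l}. r / 2 * D x)"
    proof (rule integral_mono)
      show "integrable (lebesgue_on {0..l}) (\<lambda>x. norm ((f x - f a) * D x))"
        by (intro integrable_norm L2_interval_integrable continuous_L2_interval continuous_intros contD cont)
      show "integrable (lebesgue_on {0..l}) (\<lambda>x. r / 2 * D x)" using iD by simp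
      fix x
      show "norm ((f x - f a) * D x) \<le> r / 2 * D x"
      proof (cases "\<bar>x - a\<bar> < \<delta>")
        case True
        then show ?thesis using mult_right_mono[OF less_imp_le[OF \<delta>(2)[OF True]] D0[of x]] D0[of x]
          by (simp add: abs_mult)
      next
        case False
        then show ?thesis using Dsupp[OF False] by simp
      qed
    qed
    also have "\<dots> = r / 2" using ID by simp
    finally show "norm ((LINT x|lebesgue_on {0..l}. f x * (real n * hat (real n * (x - a)))) - f a) < r"
      using r unfolding D_def by linarith
  qed
qed

text \<open>Tested against a smoothed indicator that rises just after \<open>a\<close> and falls
  just after \<open>b\<close>, the derivative side is a difference of two approximate identities and
  tends to f a - f b, while the other side tends to the integral of \<open>g\<close> by dominated
  convergence. For large n the support, inside [a, b + 1/n], stays away from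
  \<open>l\<close>.\<close>

lemma weak_deriv_FTC_interior:
  assumes ab: "0 < a" "a \<le> b" "b < l"
  shows "(g has_integral f b - f a) {a..b}"
proof -
  define \<phi> where "\<phi> n x = smooth_step (real n * (x - a)) - smooth_step (real n * (x - b))" for n x
  define \<psi> where "\<psi> n x = real n * hat (real n * (x - a)) - real n * hat (real n * (x - b))" for n x
  have der: "(\<phi> n has_real_derivative \<psi> n x) (at x)" for n x
  proof -
    have "((\<lambda>x. smooth_step (real n * (x - c))) has_real_derivative hat (real n * (x - c)) * real n) (at x)" for c
      by (rule DERIV_chain2[OF smooth_step_deriv]) (auto intro!: derivative_eq_intros)
    then show ?thesis unfolding \<phi>_def[abs_def] \<psi>_def
      by (auto intro!: derivative_eq_intros)
  qed
  then have d\<phi>: "deriv (\<phi> n) = \<psi> n" for n by (auto intro: DERIV_imp_deriv)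
  have c\<psi>: "continuous_on S (\<psi> n)" for n S unfolding \<psi>_def
    by (intro continuous_intros continuous_on_compose2[OF continuous_hat]) auto
  have c\<phi>: "continuous_on S (\<phi> n)" for n S
    using der by (meson DERIV_continuous_on has_field_derivative_at_within)
  have bd: "\<bar>\<phi> n x\<bar> \<le> 1" for n x
    unfolding \<phi>_def using smooth_step_bounds[of "real n * (x - a)"] smooth_step_bounds[of "real n * (x - b)"]
    by linarith
  obtain N where N: "real N > 1 / (l - b)"
    using reals_Archimedean2 by blast
  have test: "\<phi> n \<in> test_functions l" if "n \<ge> N" for n
  proof -
    have n: "real n > 1 / (l - b)" using N that by linarith
    then have n0: "real n > 0" using ab by (meson diff_gt_0_iff_gt less_trans zero_less_divide_1_iff)
    have "{x. \<phi> n x \<noteq> 0} \<subseteq> {a..b + 1 / real n}"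
    proof (rule subsetI, rule ccontr)
      fix x assume x: "x \<in> {x. \<phi> n x \<noteq> 0}" and "x \<notin> {a..b + 1 / real n}"
      then consider "x < a" | "x > b + 1 / real n" by fastforce
      then show False
      proof cases
        case 1
        then have "real n * (x - a) \<le> 0" "real n * (x - b) \<le> 0"
          using n0 ab by (auto simp: mult_le_0_iff)
        then show False using x by (simp add: \<phi>_def smooth_step_values)
      next
        case 2
        then have "1 \<le> real n * (x - b)" using n0 by (simp add: field_simps)
        moreover have "real n * (x - b) \<le> real n * (x - a)" using n0 ab by simp
        ultimately show False using x by (simp add: \<phi>_def smooth_step_values)
      qed
    qed
    then have "closure {x. \<phi> n x \<noteq> 0} \<subseteq> {a..b + 1 / real n}" by (rule closure_minimal) simp
    moreover have "1 / real n < l - b" using n n0 ab by (simp add: field_simps)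
    ultimately have "closure {x. \<phi> n x \<noteq> 0} \<subseteq> {0<..<l}" using ab by force
    moreover have "\<phi> n C1_differentiable_on UNIV"
      unfolding C1_differentiable_on_def using der c\<psi>
      by (intro exI[of _ "\<psi> n"]) (simp add: has_real_derivative_iff_has_vector_derivative[symmetric])
    ultimately show ?thesis by (simp add: test_functions_def)
  qed
  have "(\<lambda>n. LINT x|lebesgue_on {0..l}. f x * \<psi> n x) \<longlonglongrightarrow> f a - f b"
  proof -
    have "integrable (lebesgue_on {0..l}) (\<lambda>x. f x * (real n * hat (real n * (x - c))))" for n c
      by (intro L2_interval_integrable continuous_L2_interval continuous_intros cont
           continuous_on_compose2[OF continuous_hat]) auto
    then have "(LINT x|lebesgue_on {0..l}. f x * \<psi> n x) =
        (LINT x|lebesgue_on {0..l}. f x * (real n * hat (real n * (x - a)))) -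
        (LINT x|lebesgue_on {0..l}. f x * (real n * hat (real n * (x - b))))" for n
      by (simp add: \<psi>_def right_diff_distrib)
    then show ?thesis using approximate_value ab by (auto intro!: tendsto_diff)
  qed
  moreover have "\<forall>\<^sub>F n in sequentially. (LINT x|lebesgue_on {0..l}. f x * \<psi> n x) = - (LINT x|lebesgue_on {0..l}. g x * \<phi> n x)"
    using fg test unfolding has_weak_deriv_def eventually_sequentially by (metis d\<phi>)
  ultimately have "(\<lambda>n. - (LINT x|lebesgue_on {0..l}. g x * \<phi> n x)) \<longlonglongrightarrow> f a - f b"
    by (rule Lim_transform_eventually)
  then have 1: "(\<lambda>n. (LINT x|lebesgue_on {0..l}. g x * \<phi> n x)) \<longlonglongrightarrow> f b - f a"
    by (subst (asm) tendsto_minus_cancel_left[symmetric]) simp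
  have gm: "g \<in> borel_measurable (lebesgue_on {0..l})" using g by (simp add: L2_interval_def)
  have im: "(\<lambda>x. g x * indicator {a<..b} x) \<in> borel_measurable (lebesgue_on {0..l})"
    using ab by (intro borel_measurable_times gm borel_measurable_indicator) (auto simp: sets_restrict_space_iff)
  have m\<phi>: "\<phi> n \<in> borel_measurable (lebesgue_on {0..l})" for n
    by (intro continuous_imp_measurable_on_sets_lebesgue c\<phi>) simp
  have 2: "(\<lambda>n. (LINT x|lebesgue_on {0..l}. g x * \<phi> n x)) \<longlonglongrightarrow>
      (LINT x|lebesgue_on {0..l}. g x * indicator {a<..b} x)"
  proof (rule integral_dominated_convergence[where w="\<lambda>x. \<bar>g x\<bar>"])
    show "(\<lambda>x. g x * indicator {a<..b} x) \<in> borel_measurable (lebesgue_on {0..l})"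
      by (rule im)
    show "(\<lambda>x. g x * \<phi> n x) \<in> borel_measurable (lebesgue_on {0..l})" for n
      by (intro borel_measurable_times gm m\<phi>)
    show "integrable (lebesgue_on {0..l}) (\<lambda>x. \<bar>g x\<bar>)"
      using L2_interval_integrable[OF g] by simp
    show "AE x in lebesgue_on {0..l}. norm (g x * \<phi> n x) \<le> \<bar>g x\<bar>" for n
      using bd by (intro AE_I2) (simp add: abs_mult mult_left_le)
    have lim: "(\<lambda>n. smooth_step (real n * (x - c))) \<longlonglongrightarrow> (if c < x then 1 else 0)" for x c
    proof (cases "c < x")
      case True
      obtain M where M: "real M > 1 / (x - c)" using reals_Archimedean2 by blast
      have "smooth_step (real n * (x - c)) = 1" if "n \<ge> M" for n
      proof -
        have "real n > 1 / (x - c)" using M that by linarith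
        then show ?thesis using True by (intro smooth_step_values) (simp add: field_simps)
      qed
      then have "\<forall>\<^sub>F n in sequentially. smooth_step (real n * (x - c)) = 1"
        by (auto simp: eventually_sequentially)
      then show ?thesis using True by (simp add: tendsto_eventually)
    next
      case False
      then have "smooth_step (real n * (x - c)) = 0" for n
        by (intro smooth_step_values) (simp add: mult_le_0_iff)
      then show ?thesis using False by simp
    qed
    show "AE x in lebesgue_on {0..l}. (\<lambda>n. g x * \<phi> n x) \<longlonglongrightarrow> g x * indicator {a<..b} x"
    proof (rule AE_I2)
      fix x
      have "(\<lambda>n. \<phi> n x) \<longlonglongrightarrow> (if a < x then 1 else 0) - (if b < x then 1 else 0)"
        unfolding \<phi>_def by (intro tendsto_diff lim)
      also have "(if a < x then 1 else 0) - (if b < x then 1 else 0) = (indicator {a<..b} x :: real)"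
        using ab by (auto simp: indicator_def)
      finally show "(\<lambda>n. g x * \<phi> n x) \<longlonglongrightarrow> g x * indicator {a<..b} x"
        by (intro tendsto_mult_left)
    qed
  qed
  have "integrable (lebesgue_on {0..l}) (\<lambda>x. g x * indicator {a<..b} x)"
  proof (rule Bochner_Integration.integrable_bound[OF L2_interval_integrable[OF g]])
    show "(\<lambda>x. g x * indicator {a<..b} x) \<in> borel_measurable (lebesgue_on {0..l})"
      by (rule im)
  qed (auto simp: indicator_def)
  then have "((\<lambda>x. g x * indicator {a<..b} x) has_integral f b - f a) {0..l}"
    using has_integral_integral_lebesgue_on[of "{0..l}" "\<lambda>x. g x * indicator {a<..b} x"] LIMSEQ_unique[OF 1 2]
    by simp
  then have "((\<lambda>x. if x \<in> {a..b} then g x else 0) has_integral f b - f a) {0..l}"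
    by (rule has_integral_spike_finite[of "{a}", rotated 2]) (auto simp: indicator_def)
  then show ?thesis
    using ab has_integral_restrict[of "{a..b}" "{0..l}" g] by auto
qed

text \<open>Compactly supported test functions do not reach the ends of the interval. Since
  \<open>f\<close> minus a primitive of \<open>g\<close> is constant in the interior and continuous
  on the closure, the identity extends to the ends.\<close>

lemma weak_deriv_FTC:
  assumes ab: "0 \<le> a" "a \<le> b" "b \<le> l"
  shows "(g has_integral f b - f a) {a..b}"
proof (cases "0 < l")
  case False
  then have "a = b" using ab by linarith
  then show ?thesis using has_integral_refl(1)[of g a] by simp
next
  case l: True
  have int: "g integrable_on {0..l}"
    using integrable_on_lebesgue_on[OF L2_interval_integrable[OF g]] by simp
  define F where "F x = integral {0..x} g" for x
  have sub: "integral {x..y} g = F y - F x" if "0 \<le> x" "x \<le> y" "y \<le> l" for x y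
  proof -
    have "g integrable_on {0..y}" using int that by (auto intro: integrable_on_subinterval)
    then show ?thesis using Henstock_Kurzweil_Integration.integral_combine[of 0 x y g] that
      by (simp add: F_def)
  qed
  have "continuous_on (closure {0<..<l}) (\<lambda>x. f x - F x)"
    using l cont indefinite_integral_continuous_1[OF int]
    by (auto simp: F_def intro!: continuous_intros)
  moreover have "f x - F x = f (l/2) - F (l/2)" if x: "x \<in> {0<..<l}" for x
  proof (cases "x \<le> l/2")
    case True
    then show ?thesis
      using weak_deriv_FTC_interior[of x "l/2"] sub[of x "l/2"] x l by (auto dest!: integral_unique)
  next
    case False
    then show ?thesis
      using weak_deriv_FTC_interior[of "l/2" x] sub[of "l/2" x] x l by (auto dest!: integral_unique)
  qed
  ultimately have "f x - F x = f (l/2) - F (l/2)" if "x \<in> closure {0<..<l}" for x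
    using that by (rule continuous_constant_on_closure)
  from this[of a] this[of b] have "f b - f a = integral {a..b} g"
    using ab l sub[of a b] by auto
  moreover have "g integrable_on {a..b}" using int ab by (auto intro: integrable_on_subinterval)
  ultimately show ?thesis by (simp add: has_integral_integral)
qed

end

text \<open>Lebesgue differentiation: for almost every point the averages over shrinking intervals
  to its right converge to the value, and all these averages vanish. The zero extension
  \<open>h\<close> removes the restriction to subintervals of {0..l}.\<close>

lemma interval_integrals_0_AE:
  fixes g :: "real \<Rightarrow> real"
  assumes int: "g integrable_on {0..l}" and 0: "\<And>a b. 0 \<le> a \<Longrightarrow> a \<le> b \<Longrightarrow> b \<le> l \<Longrightarrow> integral {a..b} g = 0"
  shows "AE x in lebesgue_on {0..l}. g x = 0"
proof -
  define h where "h x = (if x \<in> {0..l} then g x else 0)" for x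
  have h: "(h has_integral 0) (cbox a b)" for a b
  proof -
    have "integral ({0..l} \<inter> {a..b}) g = 0"
    proof (cases "max 0 a \<le> min l b")
      case True
      then show ?thesis using 0[of "max 0 a" "min l b"] by (simp add: Int_atLeastAtMost)
    qed (simp add: Int_atLeastAtMost)
    moreover have "g integrable_on ({0..l} \<inter> {a..b})"
      using int by (auto intro: integrable_on_subinterval simp: Int_atLeastAtMost)
    ultimately have "(g has_integral 0) ({0..l} \<inter> {a..b})"
      by (metis has_integral_integral)
    then have "((\<lambda>x. if x \<in> {0..l} \<inter> {a..b} then g x else 0) has_integral 0) UNIV"
      by (rule has_integral_restrict_UNIV[THEN iffD2])
    also have "(\<lambda>x. if x \<in> {0..l} \<inter> {a..b} then g x else 0) = (\<lambda>x. if x \<in> {a..b} then h x else 0)"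
      by (auto simp: h_def fun_eq_iff)
    finally show ?thesis unfolding cbox_interval by (rule has_integral_restrict_UNIV[THEN iffD1])
  qed
  then have "h integrable_on cbox a b" for a b by blast
  from integrable_ccontinuous_explicit[OF this] obtain N where N: "negligible N"
    "\<And>x e. x \<notin> N \<Longrightarrow> 0 < e \<Longrightarrow> \<exists>d>0. \<forall>t. 0 < t \<and> t < d \<longrightarrow>
        norm (integral (cbox x (x + t *\<^sub>R One)) h /\<^sub>R t ^ DIM(real) - h x) < e"
    by blast
  have "h x = 0" if x: "x \<notin> N" for x
  proof (rule ccontr)
    assume "h x \<noteq> 0"
    then obtain d where d: "d > 0" "\<forall>t. 0 < t \<and> t < d \<longrightarrow>
        norm (integral (cbox x (x + t *\<^sub>R One)) h /\<^sub>R t ^ DIM(real) - h x) < norm (h x)"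
      using N(2)[OF x, of "norm (h x)"] by auto
    from d(2)[rule_format, of "d/2"] d(1) integral_unique[OF h[of x "x + (d/2) *\<^sub>R One"]] show False
      by simp
  qed
  moreover have "N \<in> null_sets lebesgue" using N(1) by (simp add: negligible_iff_null_sets)
  ultimately have "AE x in lebesgue. h x = 0"
    by (intro AE_I'[of N]) auto
  then show ?thesis
    by (subst AE_restrict_space_iff) (auto simp: h_def)
qed

text \<open>Since \<open>weak_deriv\<close> is picked by \<open>SOME\<close>, a concretely computed
  derivative can be compared with it only in this almost-everywhere sense.\<close>

lemma weak_deriv_unique:
  assumes "continuous_on {0..l} f" "g1 \<in> L2_interval l" "has_weak_deriv l f g1"
    "g2 \<in> L2_interval l" "has_weak_deriv l f g2"
  shows "AE x in lebesgue_on {0..l}. g1 x = g2 x"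
proof -
  have 0: "((\<lambda>x. g1 x - g2 x) has_integral 0) {a..b}" if "0 \<le> a" "a \<le> b" "b \<le> l" for a b
    using has_integral_diff[OF weak_deriv_FTC[of l f g1 a b] weak_deriv_FTC[of l f g2 a b]] assms that
    by simp
  have "(\<lambda>x. g1 x - g2 x) integrable_on {0..l}"
    using integrable_on_lebesgue_on[OF L2_interval_integrable[OF L2_interval_diff[OF assms(2,4)]]] by simp
  from interval_integrals_0_AE[OF this] have "AE x in lebesgue_on {0..l}. g1 x - g2 x = 0"
    using 0 by (auto intro: integral_unique)
  then show ?thesis by eventually_elim simp
qed

section \<open>Regularity of solutions on an edge\<close>

locale edge_solution =
  fixes l p r R E :: real and f g w \<rho> :: "real \<Rightarrow> real"
  assumes l: "0 < l" and p: "2 < p" and r: "0 < r"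
    and cont: "continuous_on {0..l} f"
    and g: "g \<in> L2_interval l" and fg: "has_weak_deriv l f g"
    and w_meas: "w \<in> borel_measurable (lebesgue_on {0..l})" and w_bound: "\<And>x. \<bar>w x\<bar> \<le> E"
    and \<rho>_meas: "\<rho> \<in> borel_measurable (lebesgue_on {0..l})"
    and \<rho>_lower: "\<And>x. r \<le> \<rho> x" and \<rho>_upper: "\<And>x. \<rho> x \<le> R"
    and weak_eq: "\<And>a a' S. \<lbrakk>finite S; continuous_on {0..l} a; a 0 = 0; a l = 0;
        \<And>x. x \<in> {0<..<l} - S \<Longrightarrow> (a has_real_derivative a' x) (at x); a' \<in> L2_interval l\<rbrakk> \<Longrightarrow>
        (LINT x|lebesgue_on {0..l}. g x * a' x + w x * f x * a x) =
        (LINT x|lebesgue_on {0..l}. \<rho> x * \<bar>f x\<bar> powr (p - 2) * f x * a x)"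
begin

text \<open>The right side of the equation in the form - f'' = h.\<close>

definition h :: "real \<Rightarrow> real" where
  "h x = \<rho> x * \<bar>f x\<bar> powr (p - 2) * f x - w x * f x"

lemma R_pos: "0 < R"
  using r \<rho>_lower[of 0] \<rho>_upper[of 0] by linarith

lemma powr_cont: "continuous_on {0..l} (\<lambda>x. \<bar>f x\<bar> powr (p - 2))"
  using p by (intro continuous_on_powr' continuous_intros cont) auto

lemma w_f_L2: "continuous_on {0..l} a \<Longrightarrow> (\<lambda>x. w x * f x * a x) \<in> L2_interval l"
  using L2_interval_bounded_mult[of "\<lambda>x. f x * a x" l w E] w_meas w_bound
    continuous_L2_interval[of l "\<lambda>x. f x * a x"] cont
  by (auto simp: mult.assoc intro!: continuous_intros)

lemma \<rho>_f_L2: "continuous_on {0..l} a \<Longrightarrow> (\<lambda>x. \<rho> x * \<bar>f x\<bar> powr (p - 2) * a x) \<in> L2_interval l"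
proof -
  have "\<bar>\<rho> x\<bar> \<le> R" for x using r \<rho>_lower[of x] \<rho>_upper[of x] by linarith
  then have "(\<lambda>x. \<rho> x * (\<bar>f x\<bar> powr (p - 2) * a x)) \<in> L2_interval l" if "continuous_on {0..l} a"
    using that by (intro L2_interval_bounded_mult[where B=R] \<rho>_meas continuous_L2_interval
        continuous_intros powr_cont AE_I2)
  then show "continuous_on {0..l} a \<Longrightarrow> (\<lambda>x. \<rho> x * \<bar>f x\<bar> powr (p - 2) * a x) \<in> L2_interval l"
    by (simp only: mult.assoc)
qed

lemma h_L2: "h \<in> L2_interval l"
  using L2_interval_diff[OF \<rho>_f_L2[OF cont] w_f_L2[of "\<lambda>_. 1"]]
  by (simp add: h_def[abs_def])

lemma h_bound:
  assumes "\<bar>f x\<bar> \<le> A"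
  shows "\<bar>h x\<bar> \<le> R * A powr (p - 1) + E * A"
proof -
  have A: "0 \<le> A" using assms by linarith
  have "\<bar>f x\<bar> powr (p - 2) * \<bar>f x\<bar> = \<bar>f x\<bar> powr (p - 1)"
    using powr_add[of "\<bar>f x\<bar>" "p - 2" 1] by simp
  then have "\<bar>\<rho> x * \<bar>f x\<bar> powr (p - 2) * f x\<bar> = \<bar>\<rho> x\<bar> * \<bar>f x\<bar> powr (p - 1)"
    by (simp add: abs_mult mult.assoc)
  also have "\<dots> \<le> R * A powr (p - 1)"
    using assms p r \<rho>_lower[of x] \<rho>_upper[of x] by (intro mult_mono powr_mono2) auto
  finally have "\<bar>\<rho> x * \<bar>f x\<bar> powr (p - 2) * f x\<bar> \<le> R * A powr (p - 1)" .
  moreover have "\<bar>w x * f x\<bar> \<le> E * A"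
    unfolding abs_mult using w_bound[of x] assms by (intro mult_mono) auto
  ultimately show ?thesis unfolding h_def by linarith
qed

lemma f_bounded: "\<exists>A. \<forall>x\<in>{0..l}. \<bar>f x\<bar> \<le> A"
proof -
  have "bounded (f ` {0..l})"
    using cont by (intro compact_imp_bounded compact_continuous_image) auto
  then show ?thesis unfolding bounded_iff by auto
qed

lemma h_integrable_on: "0 \<le> s \<Longrightarrow> t \<le> l \<Longrightarrow> h integrable_on {s..t}"
  using integrable_on_lebesgue_on[OF L2_interval_integrable[OF h_L2]]
  by (auto intro: integrable_on_subinterval)

section \<open>Classical differentiability up to the ends of the edge\<close>

lemma weak_eq_h:
  assumes "finite S" "continuous_on {0..l} a" "a 0 = 0" "a l = 0"
    "\<And>x. x \<in> {0<..<l} - S \<Longrightarrow> (a has_real_derivative a' x) (at x)" "a' \<in> L2_interval l"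
  shows "(LINT x|lebesgue_on {0..l}. g x * a' x) = (LINT x|lebesgue_on {0..l}. h x * a x)"
proof -
  have i: "integrable (lebesgue_on {0..l}) (\<lambda>x. g x * a' x)"
    "integrable (lebesgue_on {0..l}) (\<lambda>x. w x * f x * a x)"
    "integrable (lebesgue_on {0..l}) (\<lambda>x. \<rho> x * \<bar>f x\<bar> powr (p - 2) * f x * a x)"
    using L2_interval_mult_integrable[OF g assms(6)] L2_interval_integrable[OF w_f_L2[OF assms(2)]]
      L2_interval_integrable[OF \<rho>_f_L2[OF continuous_on_mult[OF cont assms(2)]]]
    by (simp_all add: mult.assoc)
  have "(LINT x|lebesgue_on {0..l}. h x * a x) =
      (LINT x|lebesgue_on {0..l}. \<rho> x * \<bar>f x\<bar> powr (p - 2) * f x * a x) -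
      (LINT x|lebesgue_on {0..l}. w x * f x * a x)"
    using i by (simp add: h_def left_diff_distrib)
  then show ?thesis using weak_eq[OF assms] i by simp
qed

text \<open>
  Testing the equation with \<open>x \<mapsto> min x t - t x / l\<close> expresses \<open>f t\<close> through \<open>K t\<close>, which can be
  differentiated although \<open>h\<close> is only bounded; \<open>D\<close> is the resulting formula for \<open>f'\<close>.
\<close>

definition K :: "real \<Rightarrow> real" where
  "K t = (LINT x|lebesgue_on {0..l}. h x * min x t)"

definition D :: "real \<Rightarrow> real" where
  "D t = (f l - f 0) / l + integral {t..l} h - (LINT x|lebesgue_on {0..l}. h x * x) / l"

lemma h_mult_integrable:
  "continuous_on {0..l} a \<Longrightarrow> integrable (lebesgue_on {0..l}) (\<lambda>x. h x * a x)"
  by (intro L2_interval_mult_integrable h_L2 continuous_L2_interval)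

lemma LINT_indicator:
  assumes "q \<in> L2_interval l" "0 \<le> s" "t \<le> l"
  shows "integrable (lebesgue_on {0..l}) (\<lambda>x. q x * indicator {s..t} x)"
    "(LINT x|lebesgue_on {0..l}. q x * indicator {s..t} x) = integral {s..t} q"
proof -
  have "(\<lambda>x. q x * indicator {s..t} x) \<in> borel_measurable (lebesgue_on {0..l})"
    using assms by (intro borel_measurable_times borel_measurable_indicator)
      (auto simp: sets_restrict_space_iff L2_interval_def)
  then show int: "integrable (lebesgue_on {0..l}) (\<lambda>x. q x * indicator {s..t} x)"
    by (rule Bochner_Integration.integrable_bound[OF L2_interval_integrable[OF assms(1)]])
      (auto simp: indicator_def)
  have "(LINT x|lebesgue_on {0..l}. q x * indicator {s..t} x) =
      integral {0..l} (\<lambda>x. q x * indicator {s..t} x)"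
    using int by (intro lebesgue_integral_eq_integral) auto
  also have "\<dots> = integral {0..l} (\<lambda>x. if x \<in> {s..t} then q x else 0)"
    by (intro Henstock_Kurzweil_Integration.integral_cong) (auto simp: indicator_def)
  also have "\<dots> = integral {s..t} q"
    using assms Henstock_Kurzweil_Integration.integral_restrict_Int[of "{0..l}" "{s..t}" q, unfolded Int_atLeastAtMost] by (simp add: Int_atLeastAtMost)
  finally show "(LINT x|lebesgue_on {0..l}. q x * indicator {s..t} x) = integral {s..t} q" .
qed

text \<open>The test function is the Green function of - d^2/dx^2 with zero boundary values. Its
  slope takes only two values, so the side containing \<open>g\<close> is evaluated by the
  fundamental theorem of calculus.\<close>

lemma representation:
  assumes t: "t \<in> {0..l}"
  shows "f t = f 0 + t / l * (f l - f 0) + K t - t / l * (LINT x|lebesgue_on {0..l}. h x * x)"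
proof -
  define a where "a x = min x t - t / l * x" for x
  define a' where "a' x = indicator {0..t} x - t / l" for x :: real
  have "(LINT x|lebesgue_on {0..l}. g x * a' x) = (LINT x|lebesgue_on {0..l}. h x * a x)"
  proof (rule weak_eq_h[of "{t}"])
    show "continuous_on {0..l} a" unfolding a_def by (intro continuous_intros)
    show "a 0 = 0" "a l = 0" using t l by (auto simp: a_def)
    have "a' \<in> borel_measurable (lebesgue_on {0..l})"
      unfolding a'_def using t by (intro borel_measurable_diff borel_measurable_indicator)
        (auto simp: sets_restrict_space_iff)
    moreover have "\<bar>a' x\<bar> \<le> 1" for x
      using t l by (auto simp: a'_def indicator_def)
    ultimately show "a' \<in> L2_interval l" by (intro bounded_L2_interval[where B=1]) auto
    fix x assume x: "x \<in> {0<..<l} - {t}"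
    show "(a has_real_derivative a' x) (at x)"
    proof (cases "x < t")
      case True
      have "((\<lambda>x. x - t / l * x) has_real_derivative a' x) (at x)"
        using True x by (auto intro!: derivative_eq_intros simp: a'_def)
      then show ?thesis
        by (rule has_field_derivative_transform_within_open[of _ _ _ "{..<t}"])
          (use True in \<open>auto simp: a_def\<close>)
    next
      case False
      have "((\<lambda>x. t - t / l * x) has_real_derivative a' x) (at x)"
        using False x by (auto intro!: derivative_eq_intros simp: a'_def)
      then show ?thesis
        by (rule has_field_derivative_transform_within_open[of _ _ _ "{t<..}"])
          (use False x in \<open>auto simp: a_def\<close>)
    qed
  qed simp
  moreover have "(LINT x|lebesgue_on {0..l}. g x * a' x) = (f t - f 0) - t / l * (f l - f 0)"
  proof -
    have "(LINT x|lebesgue_on {0..l}. g x * indicator {0..t} x) = f t - f 0"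
      using LINT_indicator(2)[OF g, of 0 t] weak_deriv_FTC[OF cont g fg, of 0 t] t
      by (auto dest: integral_unique)
    moreover have "(LINT x|lebesgue_on {0..l}. g x) = f l - f 0"
      using lebesgue_integral_eq_integral[OF L2_interval_integrable[OF g]]
        weak_deriv_FTC[OF cont g fg, of 0 l] l
      by (auto dest: integral_unique)
    moreover have "integrable (lebesgue_on {0..l}) (\<lambda>x. g x * indicator {0..t} x)"
      using t by (intro LINT_indicator g) auto
    moreover have "integrable (lebesgue_on {0..l}) g"
      by (rule L2_interval_integrable[OF g])
    ultimately show ?thesis
      using l by (simp add: a'_def right_diff_distrib) (simp add: field_simps)
  qed
  moreover have "(LINT x|lebesgue_on {0..l}. h x * a x) =
      K t - t / l * (LINT x|lebesgue_on {0..l}. h x * x)"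
  proof -
    have "integrable (lebesgue_on {0..l}) (\<lambda>x. h x * min x t)"
      "integrable (lebesgue_on {0..l}) (\<lambda>x. h x * x)"
      by (intro h_mult_integrable continuous_intros)+
    moreover have "(\<lambda>x. h x * a x) = (\<lambda>x. h x * min x t - t / l * (h x * x))"
      by (auto simp: a_def algebra_simps)
    ultimately show ?thesis by (simp add: K_def)
  qed
  ultimately show ?thesis by (simp add: algebra_simps diff_divide_distrib)
qed

text \<open>Moving the kink of the kernel from s to t changes it by t - s on {s..l}, up to an error
  of size at most |t - s| supported between s and t. As \<open>h\<close> is bounded, the remainder
  is quadratic in t - s, with no continuity of \<open>h\<close> involved.\<close>

lemma K_has_derivative:
  assumes s: "s \<in> {0..l}"
  shows "(K has_real_derivative integral {s..l} h) (at s within {0..l})"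
proof -
  obtain A where A: "\<And>x. x \<in> {0..l} \<Longrightarrow> \<bar>f x\<bar> \<le> A" using f_bounded by blast
  define B where "B = R * A powr (p - 1) + E * A"
  have hB: "\<bar>h x\<bar> \<le> B" if "x \<in> {0..l}" for x using h_bound[OF A[OF that]] by (simp add: B_def)
  have B0: "0 \<le> B" using hB[of 0] l by fastforce
  have est: "\<bar>K t - K s - (t - s) * integral {s..l} h\<bar> \<le> B * (t - s)\<^sup>2" if t: "t \<in> {0..l}" for t
  proof -
    define I where "I = {min s t..max s t}"
    have I: "I \<subseteq> {0..l}" "0 \<le> min s t" "max s t \<le> l" using s t by (auto simp: I_def)
    have i1: "integrable (lebesgue_on {0..l}) (\<lambda>x. h x * min x t)"
      "integrable (lebesgue_on {0..l}) (\<lambda>x. h x * min x s)"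
      by (intro h_mult_integrable continuous_intros)+
    have i2: "integrable (lebesgue_on {0..l}) (\<lambda>x. h x * indicator {s..l} x)"
      using s by (intro LINT_indicator h_L2) auto
    have one: "(\<lambda>x. 1) \<in> L2_interval l" by (intro continuous_L2_interval continuous_intros)
    have mm: "min s t \<le> max s t" "max s t - min s t = \<bar>t - s\<bar>" by linarith+
    have i3: "integrable (lebesgue_on {0..l}) (\<lambda>x. indicator I x :: real)"
      "(LINT x|lebesgue_on {0..l}. indicator I x :: real) = \<bar>t - s\<bar>"
      using LINT_indicator[OF one I(2,3)] mm by (simp_all add: I_def)
    define q where "q x = h x * min x t - h x * min x s - (t - s) * (h x * indicator {s..l} x)" for x
    have iq: "integrable (lebesgue_on {0..l}) q"
      unfolding q_def using i1 i2 by (intro Bochner_Integration.integrable_diff integrable_mult_right)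
    have "K t - K s - (t - s) * integral {s..l} h = (LINT x|lebesgue_on {0..l}. q x)"
      unfolding q_def K_def using i1 i2 LINT_indicator(2)[OF h_L2, of s l] s by simp
    then have "\<bar>K t - K s - (t - s) * integral {s..l} h\<bar> \<le> (LINT x|lebesgue_on {0..l}. \<bar>q x\<bar>)"
      using integral_abs_bound[of "lebesgue_on {0..l}" q] by simp
    also have "\<dots> \<le> (LINT x|lebesgue_on {0..l}. B * \<bar>t - s\<bar> * indicator I x)"
    proof (rule integral_mono)
      show "integrable (lebesgue_on {0..l}) (\<lambda>x. \<bar>q x\<bar>)"
        using iq by (rule integrable_abs)
      show "integrable (lebesgue_on {0..l}) (\<lambda>x. B * \<bar>t - s\<bar> * indicator I x)"
        using i3(1) by (intro integrable_mult_right)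
      fix x assume "x \<in> space (lebesgue_on {0..l})"
      then have x: "x \<in> {0..l}" by simp
      have "\<bar>min x t - min x s - (t - s) * indicator {s..l} x\<bar> \<le> \<bar>t - s\<bar> * indicator I x"
        using x s t by (auto simp: I_def indicator_def min_def max_def split: if_splits)
      then have "\<bar>h x\<bar> * \<bar>min x t - min x s - (t - s) * indicator {s..l} x\<bar> \<le> B * (\<bar>t - s\<bar> * indicator I x)"
        using hB[OF x] B0 by (intro mult_mono) auto
      moreover have "q x = h x * (min x t - min x s - (t - s) * indicator {s..l} x)"
        by (simp add: q_def algebra_simps)
      ultimately show "\<bar>q x\<bar> \<le> B * \<bar>t - s\<bar> * indicator I x"
        by (simp add: abs_mult mult.assoc)
    qed
    also have "\<dots> = B * \<bar>t - s\<bar> * \<bar>t - s\<bar>" using i3 by simp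
    also have "\<dots> = B * (t - s)\<^sup>2" by (simp add: power2_eq_square abs_mult_self_eq mult.assoc)
    finally show ?thesis .
  qed
  have "((\<lambda>t. (K t - K s) / (t - s) - integral {s..l} h) \<longlongrightarrow> 0) (at s within {0..l})"
  proof (rule Lim_null_comparison)
    show "\<forall>\<^sub>F t in at s within {0..l}. norm ((K t - K s) / (t - s) - integral {s..l} h) \<le> B * \<bar>t - s\<bar>"
      unfolding eventually_at_filter
    proof (intro always_eventually allI impI)
      fix t assume "t \<noteq> s" "t \<in> {0..l}"
      then have "(K t - K s) / (t - s) - integral {s..l} h = (K t - K s - (t - s) * integral {s..l} h) / (t - s)"
        by (simp add: field_simps)
      then have "norm ((K t - K s) / (t - s) - integral {s..l} h) = \<bar>K t - K s - (t - s) * integral {s..l} h\<bar> / \<bar>t - s\<bar>"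
        by (simp add: abs_divide)
      also have "\<dots> \<le> B * (t - s)\<^sup>2 / \<bar>t - s\<bar>"
        using est[OF \<open>t \<in> {0..l}\<close>] by (intro divide_right_mono) auto
      also have "\<dots> = B * \<bar>t - s\<bar>"
        using \<open>t \<noteq> s\<close> by (simp add: field_simps power2_eq_square abs_if)
      finally show "norm ((K t - K s) / (t - s) - integral {s..l} h) \<le> B * \<bar>t - s\<bar>" .
    qed
    have "((\<lambda>t. B * \<bar>t - s\<bar>) \<longlongrightarrow> B * \<bar>s - s\<bar>) (at s within {0..l})"
      by (intro tendsto_intros)
    then show "((\<lambda>t. B * \<bar>t - s\<bar>) \<longlongrightarrow> 0) (at s within {0..l})" by simp
  qed
  then show ?thesis
    unfolding has_field_derivative_iff by (simp add: LIM_zero_iff)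
qed

lemma f_has_derivative:
  assumes t: "t \<in> {0..l}"
  shows "(f has_real_derivative D t) (at t within {0..l})"
proof -
  have "((\<lambda>t. f 0 + t / l * (f l - f 0) + K t - t / l * (LINT x|lebesgue_on {0..l}. h x * x))
      has_real_derivative D t) (at t within {0..l})"
    using l K_has_derivative[OF t] by (auto intro!: derivative_eq_intros simp: D_def)
  then show ?thesis
    by (rule has_field_derivative_transform_within[OF _ zero_less_one t]) (rule representation[symmetric])
qed

text \<open>The integrated form of f'' = - h; it replaces the second derivative in the slope
  estimates.\<close>

lemma D_diff:
  assumes "0 \<le> s" "s \<le> t" "t \<le> l"
  shows "D t - D s = - integral {s..t} h"
  using Henstock_Kurzweil_Integration.integral_combine[OF assms(2,3), of h] h_integrable_on[of s l] assms
  by (simp add: D_def)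

lemma D_continuous: "continuous_on {0..l} D"
proof -
  have "continuous_on {0..l} (\<lambda>t. D 0 - integral {0..t} h)"
    using l h_integrable_on by (intro continuous_intros indefinite_integral_continuous_1) auto
  moreover have "D t = D 0 - integral {0..t} h" if "t \<in> {0..l}" for t
    using D_diff[of 0 t] that by auto
  ultimately show ?thesis by (metis (no_types, lifting) continuous_on_cong)
qed

lemma D_L2: "D \<in> L2_interval l"
  by (rule continuous_L2_interval[OF D_continuous])

lemma f_has_derivative_interior:
  assumes "t \<in> {0<..<l}"
  shows "(f has_real_derivative D t) (at t)"
  using f_has_derivative[of t] assms by (auto simp: at_within_Icc_at)

text \<open>Exchanges the chosen representative for the continuous derivative under
  integrals.\<close>

lemma g_eq_D: "AE x in lebesgue_on {0..l}. g x = D x"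
proof (rule weak_deriv_unique[OF cont g fg D_L2])
  show "has_weak_deriv l f D"
    by (rule has_weak_deriv_piecewise[OF l cont, of "{}"]) (auto intro: f_has_derivative_interior D_L2)
qed

text \<open>By the mean value theorem the slope is at most 2 A / l at some point, and along the edge
  it varies by at most l times the bound on \<open>h\<close>.\<close>

lemma D_bound:
  assumes A: "\<And>x. x \<in> {0..l} \<Longrightarrow> \<bar>f x\<bar> \<le> A" and t: "t \<in> {0..l}"
  shows "\<bar>D t\<bar> \<le> 2 * A / l + l * (R * A powr (p - 1) + E * A)"
proof -
  define B where "B = R * A powr (p - 1) + E * A"
  have hB: "\<bar>h x\<bar> \<le> B" if "x \<in> {0..l}" for x using h_bound[OF A[OF that]] by (simp add: B_def)
  have B0: "0 \<le> B" using hB[of 0] l by fastforce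
  obtain z where z: "z \<in> {0<..<l}" "f l - f 0 = l * D z"
    using mvt_simple[OF l, of f "\<lambda>x. (*) (D x)"] f_has_derivative
    by (auto simp: has_field_derivative_def mult.commute)
  have "\<bar>D z\<bar> \<le> 2 * A / l"
  proof -
    have "l * \<bar>D z\<bar> = \<bar>f l - f 0\<bar>" using z l by (simp add: abs_mult)
    also have "\<dots> \<le> 2 * A" using A[of l] A[of 0] l by auto
    finally show ?thesis using l by (simp add: field_simps)
  qed
  moreover have est: "\<bar>D y - D x\<bar> \<le> l * B" if "0 \<le> x" "x \<le> y" "y \<le> l" for x y
  proof -
    have "norm (integral {x..y} h) \<le> integral {x..y} (\<lambda>_. B)"
      using that by (intro integral_norm_bound_integral h_integrable_on) (auto intro!: hB)
    also have "\<dots> = (y - x) * B" using that by simp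
    also have "\<dots> \<le> l * B" using that B0 by (intro mult_right_mono) auto
    finally show ?thesis using D_diff[OF that] by simp
  qed
  then have "\<bar>D t - D z\<bar> \<le> l * B"
    using est[of t z] est[of z t] t z by (cases "t \<le> z") (auto simp: abs_minus_commute)
  ultimately show ?thesis unfolding B_def by linarith
qed

end

section \<open>Oscillation of the rescaled equation\<close>

text \<open>
  Consequences of \<open>v'' = - \<rho> |v| powr (p - 2) v + \<omega> v\<close> with \<open>r \<le> \<rho> \<le> R\<close>, \<open>|\<omega>| \<le> \<epsilon>\<close>, \<open>|v| \<le> 1\<close> and
  \<open>d = v'\<close>, in difference form because \<open>v''\<close> exists only almost everywhere.
\<close>

definition decelerating :: "real \<Rightarrow> real \<Rightarrow> real \<Rightarrow> real \<Rightarrow> real \<Rightarrow> (real \<Rightarrow> real) \<Rightarrow> (real \<Rightarrow> real) \<Rightarrow> bool" where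
  "decelerating p r R \<epsilon> L v d \<longleftrightarrow> (\<forall>s t. 0 \<le> s \<longrightarrow> s \<le> t \<longrightarrow> t \<le> L \<longrightarrow>
     (\<forall>\<alpha>\<ge>0. (\<forall>x\<in>{s..t}. \<alpha> \<le> v x) \<longrightarrow> \<epsilon> \<le> r * \<alpha> powr (p - 2) \<longrightarrow>
        d t - d s \<le> - (\<alpha> * (r * \<alpha> powr (p - 2) - \<epsilon>)) * (t - s)) \<and>
     (\<forall>\<beta>\<ge>0. (\<forall>x\<in>{s..t}. - \<beta> \<le> v x) \<longrightarrow>
        d t - d s \<le> (R * \<beta> powr (p - 1) + \<epsilon>) * (t - s)))"

text \<open>Both signs are included so that after a turn the same argument can be restarted with -
  v.\<close>

definition oscillating :: "real \<Rightarrow> real \<Rightarrow> real \<Rightarrow> real \<Rightarrow> real \<Rightarrow> (real \<Rightarrow> real) \<Rightarrow> (real \<Rightarrow> real) \<Rightarrow> bool" where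
  "oscillating p r R \<epsilon> L v d \<longleftrightarrow>
     (\<forall>t\<in>{0..L}. (v has_real_derivative d t) (at t within {0..L}) \<and> \<bar>v t\<bar> \<le> 1) \<and>
     decelerating p r R \<epsilon> L v d \<and> decelerating p r R \<epsilon> L (\<lambda>t. - v t) (\<lambda>t. - d t)"

lemma oscillating_minus:
  "oscillating p r R \<epsilon> L v d \<Longrightarrow> oscillating p r R \<epsilon> L (\<lambda>t. - v t) (\<lambda>t. - d t)"
  unfolding oscillating_def by (auto intro: DERIV_minus)

text \<open>A larger \<epsilon> weakens both clauses. The smallness conditions of several turns can
  thus be merged by taking a minimum.\<close>

lemma decelerating_mono:
  assumes "decelerating p r R \<epsilon> L v d" "\<epsilon> \<le> \<epsilon>'"
  shows "decelerating p r R \<epsilon>' L v d"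
  unfolding decelerating_def
proof (intro allI impI conjI)
  fix s t assume st: "0 \<le> s" "s \<le> t" "t \<le> L"
  {
    fix \<alpha> :: real assume \<alpha>: "0 \<le> \<alpha>" "\<forall>x\<in>{s..t}. \<alpha> \<le> v x" "\<epsilon>' \<le> r * \<alpha> powr (p - 2)"
    then have "d t - d s \<le> - (\<alpha> * (r * \<alpha> powr (p - 2) - \<epsilon>)) * (t - s)"
      using assms st unfolding decelerating_def by fastforce
    also have "\<dots> \<le> - (\<alpha> * (r * \<alpha> powr (p - 2) - \<epsilon>')) * (t - s)"
      using \<alpha> st assms by (intro mult_right_mono) (auto intro!: mult_left_mono)
    finally show "d t - d s \<le> - (\<alpha> * (r * \<alpha> powr (p - 2) - \<epsilon>')) * (t - s)" .
  }
  {
    fix \<beta> :: real assume \<beta>: "0 \<le> \<beta>" "\<forall>x\<in>{s..t}. - \<beta> \<le> v x"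
    then have "d t - d s \<le> (R * \<beta> powr (p - 1) + \<epsilon>) * (t - s)"
      using assms st unfolding decelerating_def by blast
    also have "\<dots> \<le> (R * \<beta> powr (p - 1) + \<epsilon>') * (t - s)"
      using st assms by (intro mult_right_mono) auto
    finally show "d t - d s \<le> (R * \<beta> powr (p - 1) + \<epsilon>') * (t - s)" .
  }
qed

lemma oscillating_mono:
  "oscillating p r R \<epsilon> L v d \<Longrightarrow> \<epsilon> \<le> \<epsilon>' \<Longrightarrow> oscillating p r R \<epsilon>' L v d"
  unfolding oscillating_def using decelerating_mono by blast

text \<open>Beyond the intermediate value theorem this records that \<open>v\<close> stays above
  \<open>b\<close> until the hit, which is where the concavity estimates are valid.\<close>

lemma first_hit:
  fixes v :: "real \<Rightarrow> real"
  assumes st: "s \<le> t" and cont: "continuous_on {s..t} v" and v: "b \<le> v s" "v t \<le> b"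
  obtains u where "u \<in> {s..t}" "v u = b" "\<And>x. x \<in> {s..u} \<Longrightarrow> b \<le> v x"
proof -
  define A where "A = {x \<in> {s..t}. v x \<le> b}"
  have "closed A" unfolding A_def
    by (intro continuous_on_closed_Collect_le cont continuous_on_const) simp
  moreover have "t \<in> A" using v st by (simp add: A_def)
  moreover have bdd: "bdd_below A" unfolding A_def by (auto intro!: bdd_belowI[of _ s])
  ultimately have In: "Inf A \<in> A" by (intro closed_contains_Inf) auto
  have low: "b < v x" if "x \<in> {s..t}" "x < Inf A" for x
  proof (rule ccontr)
    assume "\<not> b < v x"
    then have "x \<in> A" using that by (simp add: A_def)
    then show False using cInf_lower[OF _ bdd, of x] that by linarith
  qed
  have A: "s \<le> Inf A" "Inf A \<le> t" "v (Inf A) \<le> b" using In by (auto simp: A_def)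
  then have "continuous_on {s..Inf A} v" by (intro continuous_on_subset[OF cont]) auto
  from IVT2'[OF A(3) v(1) A(1) this] obtain u where u: "s \<le> u" "u \<le> Inf A" "v u = b" by blast
  with low[of u] In have "u = Inf A" by (force simp: A_def)
  with u low In have "b \<le> v x" if "x \<in> {s..u}" for x
    using that by (cases "x = u") (auto simp: A_def less_imp_le)
  then show ?thesis using that[of u] u In by (auto simp: A_def)
qed

section \<open>Slope estimates\<close>

context
  fixes p r R \<epsilon> L :: real and v d :: "real \<Rightarrow> real"
  assumes osc: "oscillating p r R \<epsilon> L v d"
begin

lemma osc_deriv: "t \<in> {0..L} \<Longrightarrow> (v has_real_derivative d t) (at t within {0..L})"
  and osc_bound: "t \<in> {0..L} \<Longrightarrow> \<bar>v t\<bar> \<le> 1"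
  using osc by (auto simp: oscillating_def)

lemma osc_cont: "0 \<le> s \<Longrightarrow> t \<le> L \<Longrightarrow> continuous_on {s..t} v"
  by (rule continuous_on_subset[OF DERIV_continuous_on[OF osc_deriv]]) auto

lemma osc_mvt:
  assumes "0 \<le> s" "s < t" "t \<le> L"
  obtains z where "z \<in> {s<..<t}" "v t - v s = d z * (t - s)"
proof -
  have "(v has_derivative (*) (d x)) (at x within {s..t})" if "s \<le> x" "x \<le> t" for x
    using osc_deriv[of x] assms that unfolding has_field_derivative_def
    by (auto intro: has_derivative_subset)
  from mvt_simple[OF assms(2), of v "\<lambda>x. (*) (d x)", OF this] that show ?thesis by auto
qed

lemma osc_drop:
  assumes "0 \<le> s" "s < t" "t \<le> L" and d: "\<And>x. x \<in> {s<..<t} \<Longrightarrow> d x \<le> - m"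
  shows "v t \<le> v s - m * (t - s)"
proof -
  obtain z where z: "z \<in> {s<..<t}" "v t - v s = d z * (t - s)"
    using osc_mvt[OF assms(1-3)] .
  have "d z * (t - s) \<le> - m * (t - s)" using d[OF z(1)] assms by (intro mult_right_mono) auto
  then show ?thesis using z by simp
qed

text \<open>The slope bound makes v + m (x - c)^2 / 2 nonincreasing. Centre and sign of
  \<open>m\<close> stay free: \<open>c\<close> is the left end when the slope falls from a
  nonpositive start, and the right end, with negative \<open>m\<close>, when the slope is still
  negative there after rising.\<close>

lemma osc_drop_quadratic:
  assumes "0 \<le> s" "s < t" "t \<le> L" and d: "\<And>x. x \<in> {s<..<t} \<Longrightarrow> d x \<le> - m * (x - c)"
  shows "v t + m * (t - c)\<^sup>2 / 2 \<le> v s + m * (s - c)\<^sup>2 / 2"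
proof -
  have "((\<lambda>x. v x + m * (x - c)\<^sup>2 / 2) has_derivative (*) (d x + m * (x - c))) (at x within {s..t})"
    if "s \<le> x" "x \<le> t" for x
  proof -
    have "(v has_real_derivative d x) (at x within {s..t})"
      using osc_deriv[of x] assms that by (auto intro: DERIV_subset)
    then have "((\<lambda>x. v x + m * (x - c)\<^sup>2 / 2) has_real_derivative (d x + m * (x - c))) (at x within {s..t})"
      by (auto intro!: derivative_eq_intros)
    then show ?thesis by (simp add: has_field_derivative_def)
  qed
  then have "\<exists>z\<in>{s<..<t}. (v t + m * (t - c)\<^sup>2 / 2) - (v s + m * (s - c)\<^sup>2 / 2) = (d z + m * (z - c)) * (t - s)"
    by (intro mvt_simple[OF assms(2)])
  then obtain z where z: "z \<in> {s<..<t}"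
    "(v t + m * (t - c)\<^sup>2 / 2) - (v s + m * (s - c)\<^sup>2 / 2) = (d z + m * (z - c)) * (t - s)" ..
  have "(d z + m * (z - c)) * (t - s) \<le> 0"
    using d[OF z(1)] assms by (intro mult_nonpos_nonneg) auto
  then show ?thesis using z by linarith
qed

text \<open>The linear term is allowed to use up half of the nonlinear one, which leaves a definite
  rate of deceleration.\<close>

lemma osc_positive:
  assumes "0 \<le> s" "s \<le> t" "t \<le> L" "0 \<le> \<alpha>" "\<And>x. x \<in> {s..t} \<Longrightarrow> \<alpha> \<le> v x" "\<epsilon> \<le> r * \<alpha> powr (p - 2) / 2" "0 \<le> r"
  shows "d t \<le> d s - \<alpha> * (r * \<alpha> powr (p - 2) / 2) * (t - s)"
proof -
  have "d t - d s \<le> - (\<alpha> * (r * \<alpha> powr (p - 2) - \<epsilon>)) * (t - s)"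
  proof -
    have "0 \<le> r * \<alpha> powr (p - 2)" using assms by simp
    then have "\<epsilon> \<le> r * \<alpha> powr (p - 2)" using assms(6) by linarith
    moreover have "decelerating p r R \<epsilon> L v d" using osc by (simp add: oscillating_def)
    ultimately show ?thesis using assms(1-5) unfolding decelerating_def by simp
  qed
  also have "\<dots> \<le> - (\<alpha> * (r * \<alpha> powr (p - 2) / 2)) * (t - s)"
  proof -
    have "r * \<alpha> powr (p - 2) / 2 \<le> r * \<alpha> powr (p - 2) - \<epsilon>" using assms(6) by linarith
    from mult_left_mono[OF this assms(4)] show ?thesis using assms(2) by (intro mult_right_mono) auto
  qed
  finally show ?thesis by simp
qed

lemma osc_lower:
  assumes "0 \<le> s" "s \<le> t" "t \<le> L" "0 \<le> \<beta>" "\<And>x. x \<in> {s..t} \<Longrightarrow> - \<beta> \<le> v x"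
  shows "d t \<le> d s + (R * \<beta> powr (p - 1) + \<epsilon>) * (t - s)"
proof -
  have "d t - d s \<le> (R * \<beta> powr (p - 1) + \<epsilon>) * (t - s)"
  proof -
    have "decelerating p r R \<epsilon> L v d" using osc by (simp add: oscillating_def)
    then show ?thesis using assms(1-5) unfolding decelerating_def by simp
  qed
  then show ?thesis by simp
qed

end

text \<open>
  While \<open>v \<ge> a / 2\<close> it is uniformly concave, so within time \<open>T\<^sub>1\<close> it reaches \<open>a / 2\<close> with slope at most
  \<open>- \<delta>\<close>. On \<open>[- c, a / 2]\<close> the slope changes slowly, so \<open>- c\<close> is reached within \<open>T\<^sub>2\<close>. Below \<open>- c\<close> the
  function is uniformly convex, so being bounded by \<open>1\<close> it has to turn within \<open>T\<^sub>3\<close>.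
\<close>

lemma one_turn:
  fixes p r R a :: real
  assumes p: "2 < p" and r: "0 < r" and R: "0 < R" and a: "0 < a" "a \<le> 1"
  shows "\<exists>\<epsilon>>0. \<exists>c>0. \<exists>T>0. c \<le> 1 \<and> (\<forall>L v d t\<^sub>0. oscillating p r R \<epsilon> L v d \<longrightarrow>
      0 \<le> t\<^sub>0 \<longrightarrow> t\<^sub>0 + T \<le> L \<longrightarrow> a \<le> v t\<^sub>0 \<longrightarrow> d t\<^sub>0 \<le> 0 \<longrightarrow> (\<exists>t\<in>{t\<^sub>0<..t\<^sub>0 + T}. v t \<le> - c \<and> 0 \<le> d t))"
proof -
  \<comment> \<open>The rate of deceleration that \<open>osc_positive\<close> guarantees while
    \<open>v\<close> is at least a / 2.\<close>
  define \<kappa> where "\<kappa> = a / 2 * (r * (a / 2) powr (p - 2) / 2)"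
  have \<kappa>: "0 < \<kappa>" using a r by (simp add: \<kappa>_def)
  \<comment> \<open>Chosen so that the quadratic drop \<kappa> T^2 / 2 equals 2, the full width of
    the range [-1, 1]; \<open>T\<^sub>3\<close> is chosen in the same way from
    \<open>\<kappa>'\<close>.\<close>
  define T\<^sub>1 where "T\<^sub>1 = 2 / sqrt \<kappa>"
  have T1: "0 < T\<^sub>1" "\<kappa> * T\<^sub>1\<^sup>2 = 4" using \<kappa> by (auto simp: T\<^sub>1_def power_divide)
  \<comment> \<open>The average speed of a descent by a / 2 in time
    \<open>T\<^sub>1\<close>.\<close>
  define \<delta> where "\<delta> = a / (2 * T\<^sub>1)"
  have \<delta>: "0 < \<delta>" using a T1 by (simp add: \<delta>_def)
  \<comment> \<open>At speed \<delta> / 2 this is the time for a drop by \<open>a\<close>, from a /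
    2 to - a / 2. The rate \<open>\<sigma>\<close> below lets the slope rise by at most \<delta> / 2
    in that time.\<close>
  define T\<^sub>2 where "T\<^sub>2 = 2 * a / \<delta>"
  have T2: "0 < T\<^sub>2" using a \<delta> by (simp add: T\<^sub>2_def)
  define \<sigma> where "\<sigma> = \<delta> / (2 * T\<^sub>2)"
  have \<sigma>: "0 < \<sigma>" using T2 \<delta> by (simp add: \<sigma>_def)
  \<comment> \<open>The first bound puts - a / 2 at or below - c; the second, with c \<le> 1, gives
    R c^(p-1) \<le> \<sigma> / 2. The other half of \<sigma> is left to \<epsilon>.\<close>
  define c where "c = min (a / 2) (\<sigma> / (2 * R))"
  have c: "0 < c" "c \<le> a / 2" "c \<le> \<sigma> / (2 * R)" using a \<sigma> R by (auto simp: c_def)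
  define \<kappa>' where "\<kappa>' = c * (r * c powr (p - 2) / 2)"
  have \<kappa>': "0 < \<kappa>'" using c r by (simp add: \<kappa>'_def)
  define T\<^sub>3 where "T\<^sub>3 = 2 / sqrt \<kappa>'"
  have T3: "0 < T\<^sub>3" "\<kappa>' * T\<^sub>3\<^sup>2 = 4" using \<kappa>' by (auto simp: T\<^sub>3_def power_divide)
  define \<epsilon> where "\<epsilon> = min (r * (a / 2) powr (p - 2) / 2) (min (\<sigma> / 2) (r * c powr (p - 2) / 2))"
  have \<epsilon>: "0 < \<epsilon>" "\<epsilon> \<le> r * (a / 2) powr (p - 2) / 2" "\<epsilon> \<le> \<sigma> / 2" "\<epsilon> \<le> r * c powr (p - 2) / 2"
    using a \<sigma> c r by (auto simp: \<epsilon>_def)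
  have slope: "R * c powr (p - 1) + \<epsilon> \<le> \<sigma>"
  proof -
    have "c powr (p - 1) \<le> c powr 1" using p c a by (intro powr_mono') auto
    then have "R * c powr (p - 1) \<le> R * c" using R c by simp
    also have "\<dots> \<le> \<sigma> / 2" using c R by (simp add: field_simps)
    finally show ?thesis using \<epsilon> by linarith
  qed
  define T where "T = T\<^sub>1 + T\<^sub>2 + T\<^sub>3"
  have "\<exists>t\<in>{t\<^sub>0<..t\<^sub>0 + T}. v t \<le> - c \<and> 0 \<le> d t"
    if osc: "oscillating p r R \<epsilon> L v d" and t0: "0 \<le> t\<^sub>0" "t\<^sub>0 + T \<le> L" "a \<le> v t\<^sub>0" "d t\<^sub>0 \<le> 0" for L v d t\<^sub>0
  proof (rule ccontr)
    \<comment> \<open>The negation says that the slope is negative wherever \<open>v\<close> is at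
      most - c; it is exploited in the last phase, below - c.\<close>
    assume "\<not> ?thesis"
    then have neg: "d t < 0" if "t \<in> {t\<^sub>0<..t\<^sub>0 + T}" "v t \<le> - c" for t
      using that by force
    have bound: "\<bar>v t\<bar> \<le> 1" if "0 \<le> t" "t \<le> L" for t using osc_bound[OF osc, of t] that by auto
    have "\<exists>t\<in>{t\<^sub>0..t\<^sub>0 + T\<^sub>1}. v t \<le> a / 2"
    proof (rule ccontr)
      assume "\<not> ?thesis"
      then have ge: "a / 2 \<le> v t" if "t \<in> {t\<^sub>0..t\<^sub>0 + T\<^sub>1}" for t using that by force
      have "d x \<le> - \<kappa> * (x - t\<^sub>0)" if "x \<in> {t\<^sub>0<..<t\<^sub>0 + T\<^sub>1}" for x
        using osc_positive[OF osc, of t\<^sub>0 x "a / 2"] that ge t0 T1 T2 T3 \<epsilon> a r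
        by (auto simp: \<kappa>_def T_def)
      from osc_drop_quadratic[OF osc, of t\<^sub>0 "t\<^sub>0 + T\<^sub>1" \<kappa> t\<^sub>0, OF _ _ _ this] t0 T1 T2 T3
      have "v (t\<^sub>0 + T\<^sub>1) \<le> v t\<^sub>0 - 2" by (simp add: T_def)
      then show False using bound[of "t\<^sub>0 + T\<^sub>1"] bound[of "t\<^sub>0"] ge[of "t\<^sub>0 + T\<^sub>1"] t0 T1 T2 T3 a
        by (auto simp: T_def)
    qed
    then obtain t where t: "t\<^sub>0 \<le> t" "t \<le> t\<^sub>0 + T\<^sub>1" "v t \<le> a / 2" by auto
    have tL: "t \<le> L" using t t0 T1 T2 T3 by (simp add: T_def)
    obtain t\<^sub>1 where t1: "t\<^sub>1 \<in> {t\<^sub>0..t}" "v t\<^sub>1 = a / 2" "\<And>x. x \<in> {t\<^sub>0..t\<^sub>1} \<Longrightarrow> a / 2 \<le> v x"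
      using first_hit[OF t(1) osc_cont[OF osc t0(1) tL], of "a / 2"] t t0 a by auto
    have t1': "t\<^sub>0 < t\<^sub>1" "t\<^sub>1 \<le> t\<^sub>0 + T\<^sub>1" "t\<^sub>1 \<le> L"
      using t1 t t0 a tL by (auto simp: order_less_le)
    have dt1: "d t\<^sub>1 \<le> - \<delta>"
    proof -
      \<comment> \<open>Above a / 2 the slope decreases, so at \<open>t\<^sub>1\<close> it is at
        most the mean slope attained at \<open>z\<close>.\<close>
      obtain z where z: "z \<in> {t\<^sub>0<..<t\<^sub>1}" "v t\<^sub>1 - v t\<^sub>0 = d z * (t\<^sub>1 - t\<^sub>0)"
        using osc_mvt[OF osc t0(1) t1'(1,3)] .
      have "d t\<^sub>1 \<le> d z - a / 2 * (r * (a / 2) powr (p - 2) / 2) * (t\<^sub>1 - z)"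
        using z t0 t1 t1' \<epsilon> a r by (intro osc_positive[OF osc]) auto
      moreover have "0 \<le> a / 2 * (r * (a / 2) powr (p - 2) / 2) * (t\<^sub>1 - z)"
        using z a r by (intro mult_nonneg_nonneg) auto
      ultimately have dz: "d t\<^sub>1 \<le> d z" by linarith
      have "d z * (t\<^sub>1 - t\<^sub>0) \<le> - (a / 2)" using z(2) t0(3) t1(2) by linarith
      moreover have "d t\<^sub>1 * (t\<^sub>1 - t\<^sub>0) \<le> d z * (t\<^sub>1 - t\<^sub>0)" using dz t1' by (intro mult_right_mono) auto
      ultimately have le: "d t\<^sub>1 * (t\<^sub>1 - t\<^sub>0) \<le> - (a / 2)" by linarith
      then have "d t\<^sub>1 * (t\<^sub>1 - t\<^sub>0) < 0" using a by linarith
      then have "d t\<^sub>1 < 0" using t1' by (simp add: mult_less_0_iff)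
      then have "d t\<^sub>1 * T\<^sub>1 \<le> d t\<^sub>1 * (t\<^sub>1 - t\<^sub>0)" using t1' by (intro mult_left_mono_neg) auto
      with le have "d t\<^sub>1 * T\<^sub>1 \<le> - (a / 2)" by linarith
      then show ?thesis using T1 by (simp add: \<delta>_def field_simps)
    qed
    have bL: "t\<^sub>1 + T\<^sub>2 \<le> L" using t1' t0 T3 by (simp add: T_def)
    have "\<exists>t\<in>{t\<^sub>1..t\<^sub>1 + T\<^sub>2}. v t \<le> - c"
    proof (rule ccontr)
      assume "\<not> ?thesis"
      then have ge: "- c < v t" if "t \<in> {t\<^sub>1..t\<^sub>1 + T\<^sub>2}" for t using that by force
      have "d x \<le> - (\<delta> / 2)" if x: "x \<in> {t\<^sub>1<..<t\<^sub>1 + T\<^sub>2}" for x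
      proof -
        have "d x \<le> d t\<^sub>1 + (R * c powr (p - 1) + \<epsilon>) * (x - t\<^sub>1)"
          using x ge t0 t1' bL c by (intro osc_lower[OF osc]) (auto intro!: less_imp_le)
        also have "(R * c powr (p - 1) + \<epsilon>) * (x - t\<^sub>1) \<le> \<sigma> * T\<^sub>2"
          using slope x \<sigma> by (intro mult_mono) auto
        also have "\<sigma> * T\<^sub>2 = \<delta> / 2" using T2 by (simp add: \<sigma>_def)
        finally show ?thesis using dt1 by linarith
      qed
      then have "v (t\<^sub>1 + T\<^sub>2) \<le> v t\<^sub>1 - \<delta> / 2 * (t\<^sub>1 + T\<^sub>2 - t\<^sub>1)"
        using t0 t1' bL T2 by (intro osc_drop[OF osc]) auto
      also have "\<dots> = - (a / 2)" using t1 \<delta> by (simp add: T\<^sub>2_def)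
      finally show False using ge[of "t\<^sub>1 + T\<^sub>2"] T2 c by auto
    qed
    then obtain s where s: "t\<^sub>1 \<le> s" "s \<le> t\<^sub>1 + T\<^sub>2" "v s \<le> - c" by auto
    obtain t\<^sub>2 where t2: "t\<^sub>2 \<in> {t\<^sub>1..s}" "v t\<^sub>2 = - c"
    proof -
      have "continuous_on {t\<^sub>1..s} v" using s t1' t0 bL by (intro osc_cont[OF osc]) auto
      moreover have "- c \<le> v t\<^sub>1" using t1(2) a c by linarith
      ultimately show ?thesis using first_hit[of t\<^sub>1 s v "- c"] s(1,3) that by blast
    qed
    define e where "e = t\<^sub>2 + T\<^sub>3"
    have e: "e \<le> t\<^sub>0 + T" "e \<le> L" "t\<^sub>0 < t\<^sub>2" "t\<^sub>2 < e" "0 \<le> t\<^sub>2"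
      using t2 s t1' t0 T3 by (auto simp: e_def T_def)
    \<comment> \<open>If \<open>v\<close> came back above - c at \<open>x\<close>, its minimum over
      {t2..x} would lie strictly before \<open>x\<close> and at height at most - c, where the slope
      is negative; moving right would go below the minimum.\<close>
    have below: "v x \<le> - c" if x: "x \<in> {t\<^sub>2..e}" for x
    proof (rule ccontr)
      assume nx: "\<not> v x \<le> - c"
      have "continuous_on {t\<^sub>2..x} v" using osc_cont[OF osc, of t\<^sub>2 x] x e by auto
      then obtain m where m: "m \<in> {t\<^sub>2..x}" "\<And>y. y \<in> {t\<^sub>2..x} \<Longrightarrow> v m \<le> v y"
        using continuous_attains_inf[of "{t\<^sub>2..x}" v] x by auto
      have vm: "v m \<le> - c" using m(2)[of t\<^sub>2] t2 x by auto
      then have "m < x" using m nx by (auto simp: order_less_le)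
      have "d m < 0" using neg[of m] vm m x e by auto
      moreover have "(v has_real_derivative d m) (at m within {0..L})"
        using osc_deriv[OF osc, of m] m x e by auto
      ultimately obtain \<eta> where \<eta>: "\<eta> > 0" "\<And>h. 0 < h \<Longrightarrow> m + h \<in> {0..L} \<Longrightarrow> h < \<eta> \<Longrightarrow> v (m + h) < v m"
        using has_real_derivative_neg_dec_right by blast
      define h where "h = min (\<eta> / 2) (x - m)"
      have "0 < h" "h < \<eta>" "h \<le> x - m" using \<eta>(1) \<open>m < x\<close> by (auto simp: h_def)
      then show False using \<eta>(2)[of h] m(2)[of "m + h"] m(1) x e by auto
    qed
    have de: "d e < 0" using neg[of e] below[of e] e by auto
    \<comment> \<open>Convexity below - c is read backwards from \<open>e\<close>: the slope is
      still negative there and was smaller before, by a definite rate.\<close>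
    have dx: "d x \<le> - \<kappa>' * (e - x)" if x: "x \<in> {t\<^sub>2<..<e}" for x
    proof -
      have "- d e \<le> - d x - c * (r * c powr (p - 2) / 2) * (e - x)"
        using x below e c \<epsilon> r by (intro osc_positive[OF oscillating_minus[OF osc]]) (auto simp: le_minus_iff)
      then show ?thesis using de by (simp add: \<kappa>'_def)
    qed
    have "d x \<le> - (- \<kappa>') * (x - e)" if "x \<in> {t\<^sub>2<..<e}" for x
      using dx[OF that] by (simp add: algebra_simps)
    from osc_drop_quadratic[OF osc e(5,4,2) this]
    have "v e \<le> v t\<^sub>2 - \<kappa>' * T\<^sub>3\<^sup>2 / 2" by (simp add: e_def power2_eq_square)
    then show False using T3 t2 c bound[of e] e by simp
  qed
  moreover have "0 < T" "c \<le> 1" using T1 T2 T3 c a by (auto simp: T_def)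
  ultimately show ?thesis using \<epsilon> c by blast
qed

text \<open>After a turn, - v starts at height at least \<open>c\<close> with nonpositive slope,
  which is the initial situation with \<open>c\<close> in place of \<open>a\<close>; hence the
  induction generalises over \<open>a\<close>. Times add up and \<epsilon> is a minimum over
  finitely many turns.\<close>

lemma alternations:
  fixes p r R a :: real
  assumes p: "2 < p" and r: "0 < r" and R: "0 < R" and a: "0 < a" "a \<le> 1"
  shows "\<exists>\<epsilon>>0. \<exists>T\<ge>0. \<forall>L v d t\<^sub>0. oscillating p r R \<epsilon> L v d \<longrightarrow>
      0 \<le> t\<^sub>0 \<longrightarrow> t\<^sub>0 + T \<le> L \<longrightarrow> a \<le> v t\<^sub>0 \<longrightarrow> d t\<^sub>0 \<le> 0 \<longrightarrow>
      (\<exists>\<tau>. \<tau> 0 = t\<^sub>0 \<and> (\<forall>i<k. \<tau> i < \<tau> (Suc i)) \<and>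
         (\<forall>i\<le>k. \<tau> i \<in> {t\<^sub>0..t\<^sub>0 + T} \<and> 0 < (-1) ^ i * v (\<tau> i)))"
  using a
proof (induction k arbitrary: a)
  case 0
  then show ?case
    by (intro exI[of _ 1] conjI exI[of _ 0]) (auto intro!: exI[of _ "\<lambda>_. _"])
next
  case (Suc k)
  obtain \<epsilon> c T where 1: "0 < \<epsilon>" "0 < c" "0 < T" "c \<le> 1"
    "\<And>L v d t\<^sub>0. oscillating p r R \<epsilon> L v d \<Longrightarrow> 0 \<le> t\<^sub>0 \<Longrightarrow> t\<^sub>0 + T \<le> L \<Longrightarrow> a \<le> v t\<^sub>0 \<Longrightarrow> d t\<^sub>0 \<le> 0 \<Longrightarrow>
        \<exists>t\<in>{t\<^sub>0<..t\<^sub>0 + T}. v t \<le> - c \<and> 0 \<le> d t"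
    using one_turn[OF p r R Suc.prems] by blast
  obtain \<epsilon>' T' where 2: "0 < \<epsilon>'" "0 \<le> T'"
    "\<And>L v d t\<^sub>0. oscillating p r R \<epsilon>' L v d \<Longrightarrow> 0 \<le> t\<^sub>0 \<Longrightarrow> t\<^sub>0 + T' \<le> L \<Longrightarrow> c \<le> v t\<^sub>0 \<Longrightarrow> d t\<^sub>0 \<le> 0 \<Longrightarrow>
        \<exists>\<tau>. \<tau> 0 = t\<^sub>0 \<and> (\<forall>i<k. \<tau> i < \<tau> (Suc i)) \<and>
         (\<forall>i\<le>k. \<tau> i \<in> {t\<^sub>0..t\<^sub>0 + T'} \<and> 0 < (-1) ^ i * v (\<tau> i))"
    using Suc.IH[OF 1(2,4)] by blast
  have "\<exists>\<tau>. \<tau> 0 = t\<^sub>0 \<and> (\<forall>i<Suc k. \<tau> i < \<tau> (Suc i)) \<and>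
         (\<forall>i\<le>Suc k. \<tau> i \<in> {t\<^sub>0..t\<^sub>0 + (T + T')} \<and> 0 < (-1) ^ i * v (\<tau> i))"
    if osc: "oscillating p r R (min \<epsilon> \<epsilon>') L v d" and t0: "0 \<le> t\<^sub>0" "t\<^sub>0 + (T + T') \<le> L" "a \<le> v t\<^sub>0" "d t\<^sub>0 \<le> 0"
    for L v d t\<^sub>0
  proof -
    obtain t where t: "t\<^sub>0 < t" "t \<le> t\<^sub>0 + T" "v t \<le> - c" "0 \<le> d t"
      using 1(5)[OF oscillating_mono[OF osc] t0(1) _ t0(3,4)] t0 2 by auto
    obtain \<tau> where \<tau>: "\<tau> 0 = t" "\<forall>i<k. \<tau> i < \<tau> (Suc i)"
      "\<forall>i\<le>k. \<tau> i \<in> {t..t + T'} \<and> 0 < (-1) ^ i * (- v (\<tau> i))"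
      using 2(3)[OF oscillating_mono[OF oscillating_minus[OF osc]], of t] t t0 by auto
    \<comment> \<open>Prepending \<open>t\<^sub>0\<close> shifts the index by one, which absorbs the
      minus sign of - v.\<close>
    define \<tau>' where "\<tau>' i = (case i of 0 \<Rightarrow> t\<^sub>0 | Suc j \<Rightarrow> \<tau> j)" for i
    have "\<tau>' i < \<tau>' (Suc i)" if "i < Suc k" for i
      using that \<tau> t by (cases i) (auto simp: \<tau>'_def)
    moreover have "\<tau>' i \<in> {t\<^sub>0..t\<^sub>0 + (T + T')} \<and> 0 < (-1) ^ i * v (\<tau>' i)" if "i \<le> Suc k" for i
    proof (cases i)
      case 0
      then show ?thesis using t0 1 2 Suc.prems by (simp add: \<tau>'_def)
    next
      case (Suc j)
      then have "\<tau> j \<in> {t..t + T'} \<and> 0 < (-1) ^ j * (- v (\<tau> j))" using \<tau>(3) that by simp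
      then show ?thesis using Suc t by (auto simp: \<tau>'_def)
    qed
    ultimately show ?thesis by (intro exI[of _ \<tau>']) (simp add: \<tau>'_def)
  qed
  then show ?case using 1 2 by (intro exI[of _ "min \<epsilon> \<epsilon>'"] conjI exI[of _ "T + T'"]) auto
qed

section \<open>Zeros of large solutions\<close>

context edge_solution
begin

text \<open>In s h = (s f) (\<rho> |f|^(p-2) - w) both factors have nonnegative lower bounds. The
  sign \<open>s\<close> treats \<open>f\<close> and - f together.\<close>

lemma h_positive:
  assumes s: "s = 1 \<or> s = -1" and \<alpha>: "0 \<le> \<alpha>" "\<alpha> \<le> s * f x" "E \<le> r * \<alpha> powr (p - 2)"
  shows "\<alpha> * (r * \<alpha> powr (p - 2) - E) \<le> s * h x"
proof -
  have f: "\<bar>f x\<bar> = s * f x" using s \<alpha> by auto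
  have "r * \<alpha> powr (p - 2) \<le> \<rho> x * \<bar>f x\<bar> powr (p - 2)"
    using r \<rho>_lower[of x] \<alpha> f p by (intro mult_mono powr_mono2) auto
  moreover have "w x \<le> E" using w_bound[of x] by linarith
  ultimately have "r * \<alpha> powr (p - 2) - E \<le> \<rho> x * \<bar>f x\<bar> powr (p - 2) - w x" by linarith
  then have "\<alpha> * (r * \<alpha> powr (p - 2) - E) \<le> (s * f x) * (\<rho> x * \<bar>f x\<bar> powr (p - 2) - w x)"
    using \<alpha> by (intro mult_mono) auto
  also have "\<dots> = s * h x" by (simp add: h_def algebra_simps)
  finally show ?thesis .
qed

text \<open>The nonlinear term has the sign of s f, so it can pull down only where s f is negative,
  and there |f| is at most \<beta>; the linear term is controlled by the maximum.\<close>

lemma h_lower: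
  assumes s: "s = 1 \<or> s = -1" and \<beta>: "0 \<le> \<beta>" "- \<beta> \<le> s * f x" and m: "\<bar>f x\<bar> \<le> m"
  shows "- (R * \<beta> powr (p - 1) + E * m) \<le> s * h x"
proof -
  have "\<bar>w x * f x\<bar> \<le> E * m"
    unfolding abs_mult using w_bound[of x] m by (intro mult_mono) auto
  then have wf: "- (E * m) \<le> - s * (w x * f x)" using s by auto
  have pos: "0 \<le> \<rho> x * \<bar>f x\<bar> powr (p - 2)" using r \<rho>_lower[of x] by simp
  have "- (R * \<beta> powr (p - 1)) \<le> \<rho> x * \<bar>f x\<bar> powr (p - 2) * (s * f x)"
  proof (cases "0 \<le> s * f x")
    case True
    then have "0 \<le> \<rho> x * \<bar>f x\<bar> powr (p - 2) * (s * f x)" using pos by (rule mult_nonneg_nonneg[rotated])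
    moreover have "0 \<le> R * \<beta> powr (p - 1)" using R_pos by simp
    ultimately show ?thesis by linarith
  next
    case False
    then have f: "s * f x = - \<bar>f x\<bar>" "\<bar>f x\<bar> \<le> \<beta>" using s \<beta> by auto
    have "\<bar>f x\<bar> powr (p - 2) * \<bar>f x\<bar> = \<bar>f x\<bar> powr (p - 1)"
      using powr_add[of "\<bar>f x\<bar>" "p - 2" 1] by simp
    then have "\<rho> x * \<bar>f x\<bar> powr (p - 2) * (s * f x) = - (\<rho> x * \<bar>f x\<bar> powr (p - 1))"
      using f by simp
    moreover have "\<rho> x * \<bar>f x\<bar> powr (p - 1) \<le> R * \<beta> powr (p - 1)"
      using f \<beta> p R_pos \<rho>_upper[of x] by (intro mult_mono powr_mono2) auto
    ultimately show ?thesis by linarith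
  qed
  moreover have "s * h x = \<rho> x * \<bar>f x\<bar> powr (p - 2) * (s * f x) + - s * (w x * f x)"
    by (simp add: h_def algebra_simps)
  ultimately show ?thesis using wf by linarith
qed

lemma D_diff_le:
  assumes "0 \<le> x" "x \<le> y" "y \<le> l" and c: "\<And>z. z \<in> {x..y} \<Longrightarrow> c \<le> s * h z"
  shows "s * (D y - D x) \<le> - c * (y - x)"
proof -
  have "integral {x..y} (\<lambda>_. c) \<le> integral {x..y} (\<lambda>z. s * h z)"
    using assms by (intro integral_le integrable_on_mult_right h_integrable_on) auto
  then have "c * (y - x) \<le> s * integral {x..y} h" using assms by (simp add: mult.commute)
  then show ?thesis using D_diff[OF assms(1-3)] by simp
qed

section \<open>Rescaling around a maximum point\<close>

context
  fixes x\<^sub>0 m s \<sigma> \<mu> T :: real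
  assumes m: "0 < m" "\<And>x. x \<in> {0..l} \<Longrightarrow> \<bar>f x\<bar> \<le> m"
    and s: "s = 1 \<or> s = -1" and \<sigma>: "\<sigma> = 1 \<or> \<sigma> = -1"
    and \<mu>: "\<mu> = m powr ((p - 2) / 2)"
    and X: "\<And>y. y \<in> {0..T} \<Longrightarrow> x\<^sub>0 + \<sigma> * y / \<mu> \<in> {0..l}"
begin

text \<open>For v(y) = s f(x0 + \<sigma> y / \<mu>) / m the nonlinear term acquires the factor
  m^(p-2) / \<mu>^2 and the linear one 1 / \<mu>^2. This \<mu> makes the first factor 1 and the
  second small for large \<open>m\<close>.\<close>

lemma mu_pos: "0 < \<mu>" and mu_square: "\<mu> * \<mu> = m powr (p - 2)"
  using m by (auto simp: \<mu> powr_add[symmetric])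

text \<open>For \<sigma> = -1 the reflection exchanges the two points and also the sign of the
  slope, so the estimate keeps its form in both directions.\<close>

lemma rescaled_diff_le:
  assumes st: "0 \<le> y" "y \<le> z" "z \<le> T"
    and c: "\<And>t. t \<in> {y..z} \<Longrightarrow> c \<le> s' * h (x\<^sub>0 + \<sigma> * t / \<mu>)"
  shows "s' * \<sigma> * D (x\<^sub>0 + \<sigma> * z / \<mu>) - s' * \<sigma> * D (x\<^sub>0 + \<sigma> * y / \<mu>) \<le> - c * (z - y) / \<mu>"
proof -
  have X1: "x\<^sub>0 + \<sigma> * y / \<mu> \<in> {0..l}" "x\<^sub>0 + \<sigma> * z / \<mu> \<in> {0..l}" using X[of y] X[of z] st by auto
  have le: "y / \<mu> \<le> z / \<mu>" using st mu_pos by (simp add: divide_right_mono)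
  show ?thesis using \<sigma>
  proof
    assume 1: "\<sigma> = 1"
    have "s' * (D (x\<^sub>0 + z / \<mu>) - D (x\<^sub>0 + y / \<mu>)) \<le> - c * ((x\<^sub>0 + z / \<mu>) - (x\<^sub>0 + y / \<mu>))"
    proof (rule D_diff_le)
      fix t assume "t \<in> {x\<^sub>0 + y / \<mu>..x\<^sub>0 + z / \<mu>}"
      then have "\<mu> * (t - x\<^sub>0) \<in> {y..z}" using mu_pos by (auto simp: field_simps)
      from c[OF this] show "c \<le> s' * h t" using mu_pos 1 by simp
    qed (use X1 le 1 in auto)
    then show ?thesis using 1 by (simp add: algebra_simps diff_divide_distrib)
  next
    assume 1: "\<sigma> = -1"
    have "s' * (D (x\<^sub>0 - y / \<mu>) - D (x\<^sub>0 - z / \<mu>)) \<le> - c * ((x\<^sub>0 - y / \<mu>) - (x\<^sub>0 - z / \<mu>))"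
    proof (rule D_diff_le)
      fix t assume "t \<in> {x\<^sub>0 - z / \<mu>..x\<^sub>0 - y / \<mu>}"
      then have "\<mu> * (x\<^sub>0 - t) \<in> {y..z}" using mu_pos by (auto simp: field_simps)
      from c[OF this] show "c \<le> s' * h t" using mu_pos 1 by simp
    qed (use X1 le 1 in auto)
    then show ?thesis using 1 by (simp add: algebra_simps diff_divide_distrib)
  qed
qed

lemma rescaled_decelerating:
  assumes s': "s' = 1 \<or> s' = -1"
  shows "decelerating p r R (E / m powr (p - 2)) T (\<lambda>y. s' * f (x\<^sub>0 + \<sigma> * y / \<mu>) / m)
    (\<lambda>y. s' * \<sigma> * D (x\<^sub>0 + \<sigma> * y / \<mu>) / (m * \<mu>))"
  unfolding decelerating_def
proof (intro allI impI conjI)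
  fix y z assume st: "0 \<le> y" "y \<le> z" "z \<le> T"
  define M where "M = m powr (p - 2)"
  have M: "0 < M" "\<mu> * \<mu> = M" using m mu_square by (auto simp: M_def)
  let ?d = "\<lambda>y. s' * \<sigma> * D (x\<^sub>0 + \<sigma> * y / \<mu>)"
  \<comment> \<open>A lower bound \<open>c\<close> for s' h turns into the rate c / (m M) for the
    slope of the rescaled function.\<close>
  have div: "?d z / (m * \<mu>) - ?d y / (m * \<mu>) \<le> - (c / (m * M)) * (z - y)"
    if "?d z - ?d y \<le> - c * (z - y) / \<mu>" for c
  proof -
    have "?d z / (m * \<mu>) - ?d y / (m * \<mu>) \<le> - c * (z - y) / \<mu> / (m * \<mu>)"
      unfolding diff_divide_distrib[symmetric] using that m mu_pos by (intro divide_right_mono) auto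
    also have "\<dots> = - c * (z - y) / (m * (\<mu> * \<mu>))" by simp
    finally show ?thesis using M by simp
  qed
  {
    fix \<alpha> :: real
    assume \<alpha>: "0 \<le> \<alpha>" "\<forall>x\<in>{y..z}. \<alpha> \<le> s' * f (x\<^sub>0 + \<sigma> * x / \<mu>) / m"
      "E / m powr (p - 2) \<le> r * \<alpha> powr (p - 2)"
    have pw: "(m * \<alpha>) powr (p - 2) = M * \<alpha> powr (p - 2)"
      using m \<alpha> by (simp add: powr_mult M_def)
    have "m * \<alpha> * (r * (m * \<alpha>) powr (p - 2) - E) \<le> s' * h (x\<^sub>0 + \<sigma> * t / \<mu>)" if t: "t \<in> {y..z}" for t
    proof (rule h_positive[OF s'])
      show "0 \<le> m * \<alpha>" using m \<alpha> by simp
      show "m * \<alpha> \<le> s' * f (x\<^sub>0 + \<sigma> * t / \<mu>)" using \<alpha>(2)[rule_format, OF t] m by (simp add: field_simps)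
      show "E \<le> r * (m * \<alpha>) powr (p - 2)"
        unfolding pw using \<alpha>(3) M by (simp add: M_def[symmetric] field_simps)
    qed
    from div[OF rescaled_diff_le[OF st this]]
    have "?d z / (m * \<mu>) - ?d y / (m * \<mu>) \<le> - (m * \<alpha> * (r * (M * \<alpha> powr (p - 2)) - E) / (m * M)) * (z - y)"
      unfolding pw .
    also have "m * \<alpha> * (r * (M * \<alpha> powr (p - 2)) - E) / (m * M) = \<alpha> * (r * \<alpha> powr (p - 2) - E / M)"
      using m M by (simp add: field_simps)
    finally show "?d z / (m * \<mu>) - ?d y / (m * \<mu>) \<le>
        - (\<alpha> * (r * \<alpha> powr (p - 2) - E / m powr (p - 2))) * (z - y)" by (simp add: M_def)
  }
  {
    fix \<beta> :: real
    assume \<beta>: "0 \<le> \<beta>" "\<forall>x\<in>{y..z}. - \<beta> \<le> s' * f (x\<^sub>0 + \<sigma> * x / \<mu>) / m"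
    have "m powr (p - 1) = M * m"
      using m powr_add[of m "p - 2" 1] by (simp add: M_def)
    then have pw: "(m * \<beta>) powr (p - 1) = M * m * \<beta> powr (p - 1)"
      using m \<beta> by (simp add: powr_mult)
    have "- (R * (m * \<beta>) powr (p - 1) + E * m) \<le> s' * h (x\<^sub>0 + \<sigma> * t / \<mu>)" if t: "t \<in> {y..z}" for t
    proof (rule h_lower[OF s'])
      show "0 \<le> m * \<beta>" using m \<beta> by simp
      show "- (m * \<beta>) \<le> s' * f (x\<^sub>0 + \<sigma> * t / \<mu>)" using \<beta>(2)[rule_format, OF t] m by (simp add: field_simps)
      show "\<bar>f (x\<^sub>0 + \<sigma> * t / \<mu>)\<bar> \<le> m" using t st by (intro m X) auto
    qed
    from div[OF rescaled_diff_le[OF st this]]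
    have "?d z / (m * \<mu>) - ?d y / (m * \<mu>) \<le> - (- (R * (M * m * \<beta> powr (p - 1)) + E * m) / (m * M)) * (z - y)"
      unfolding pw .
    also have "- (- (R * (M * m * \<beta> powr (p - 1)) + E * m) / (m * M)) = R * \<beta> powr (p - 1) + E / M"
      using m M by (simp add: field_simps)
    finally show "?d z / (m * \<mu>) - ?d y / (m * \<mu>) \<le> (R * \<beta> powr (p - 1) + E / m powr (p - 2)) * (z - y)"
      by (simp add: M_def)
  }
qed

lemma rescaled_oscillating:
  "oscillating p r R (E / m powr (p - 2)) T (\<lambda>y. s * f (x\<^sub>0 + \<sigma> * y / \<mu>) / m)
    (\<lambda>y. s * \<sigma> * D (x\<^sub>0 + \<sigma> * y / \<mu>) / (m * \<mu>))"
  unfolding oscillating_def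
proof (intro conjI ballI)
  fix t assume t: "t \<in> {0..T}"
  have 1: "((\<lambda>y. x\<^sub>0 + \<sigma> * y / \<mu>) has_real_derivative \<sigma> / \<mu>) (at t within {0..T})"
    using mu_pos by (auto intro!: derivative_eq_intros)
  have 2: "(f has_real_derivative D (x\<^sub>0 + \<sigma> * t / \<mu>)) (at (x\<^sub>0 + \<sigma> * t / \<mu>) within (\<lambda>y. x\<^sub>0 + \<sigma> * y / \<mu>) ` {0..T})"
    using f_has_derivative[OF X[OF t]] by (rule DERIV_subset) (use X in blast)
  have "((\<lambda>y. f (x\<^sub>0 + \<sigma> * y / \<mu>)) has_real_derivative D (x\<^sub>0 + \<sigma> * t / \<mu>) * (\<sigma> / \<mu>)) (at t within {0..T})"
    using DERIV_image_chain[OF 2 1] unfolding comp_def .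
  then have "((\<lambda>y. s / m * f (x\<^sub>0 + \<sigma> * y / \<mu>)) has_real_derivative s / m * (D (x\<^sub>0 + \<sigma> * t / \<mu>) * (\<sigma> / \<mu>))) (at t within {0..T})"
    by (rule DERIV_cmult)
  then show "((\<lambda>y. s * f (x\<^sub>0 + \<sigma> * y / \<mu>) / m) has_real_derivative s * \<sigma> * D (x\<^sub>0 + \<sigma> * t / \<mu>) / (m * \<mu>)) (at t within {0..T})"
    by (simp add: ac_simps)
  have "\<bar>s * f (x\<^sub>0 + \<sigma> * t / \<mu>)\<bar> \<le> m" using m(2)[OF X[OF t]] s by (auto simp: abs_mult)
  then show "\<bar>s * f (x\<^sub>0 + \<sigma> * t / \<mu>) / m\<bar> \<le> 1" using m by (simp add: abs_divide)
next
  show "decelerating p r R (E / m powr (p - 2)) T (\<lambda>y. s * f (x\<^sub>0 + \<sigma> * y / \<mu>) / m)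
    (\<lambda>y. s * \<sigma> * D (x\<^sub>0 + \<sigma> * y / \<mu>) / (m * \<mu>))"
    by (rule rescaled_decelerating[OF s])
  have "- s = 1 \<or> - s = - 1" using s by auto
  from rescaled_decelerating[OF this]
  show "decelerating p r R (E / m powr (p - 2)) T (\<lambda>t. - (s * f (x\<^sub>0 + \<sigma> * t / \<mu>) / m))
    (\<lambda>t. - (s * \<sigma> * D (x\<^sub>0 + \<sigma> * t / \<mu>) / (m * \<mu>)))"
    by simp
qed

end

text \<open>At an endpoint the derivative need not vanish, but in a direction \<sigma> that stays
  inside the edge a positive slope would exceed the maximum.\<close>

lemma derivative_at_max:
  assumes x0: "x\<^sub>0 \<in> {0..l}" and max: "\<And>x. x \<in> {0..l} \<Longrightarrow> s * f x \<le> s * f x\<^sub>0"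
    and \<sigma>: "\<sigma> = 1 \<and> x\<^sub>0 < l \<or> \<sigma> = -1 \<and> 0 < x\<^sub>0"
  shows "s * \<sigma> * D x\<^sub>0 \<le> 0"
proof (rule ccontr)
  assume neg: "\<not> ?thesis"
  have der: "((\<lambda>x. s * f x) has_real_derivative s * D x\<^sub>0) (at x\<^sub>0 within {0..l})"
    by (intro DERIV_cmult f_has_derivative x0)
  show False using \<sigma>
  proof (elim disjE conjE)
    assume 1: "\<sigma> = 1" "x\<^sub>0 < l"
    then obtain \<eta> where \<eta>: "\<eta> > 0" "\<And>h. 0 < h \<Longrightarrow> x\<^sub>0 + h \<in> {0..l} \<Longrightarrow> h < \<eta> \<Longrightarrow> s * f x\<^sub>0 < s * f (x\<^sub>0 + h)"
      using has_real_derivative_pos_inc_right[OF der] neg by auto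
    define t where "t = min (\<eta> / 2) (l - x\<^sub>0)"
    have "0 < t" "t < \<eta>" "x\<^sub>0 + t \<in> {0..l}" using \<eta>(1) 1 x0 by (auto simp: t_def min_def)
    then show False using \<eta>(2)[of t] max[of "x\<^sub>0 + t"] by linarith
  next
    assume 1: "\<sigma> = -1" "0 < x\<^sub>0"
    then obtain \<eta> where \<eta>: "\<eta> > 0" "\<And>h. 0 < h \<Longrightarrow> x\<^sub>0 - h \<in> {0..l} \<Longrightarrow> h < \<eta> \<Longrightarrow> s * f x\<^sub>0 < s * f (x\<^sub>0 - h)"
      using has_real_derivative_neg_dec_left[OF der] neg by auto
    define t where "t = min (\<eta> / 2) x\<^sub>0"
    have "0 < t" "t < \<eta>" "x\<^sub>0 - t \<in> {0..l}" using \<eta>(1) 1 x0 by (auto simp: t_def min_def)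
    then show False using \<eta>(2)[of t] max[of "x\<^sub>0 - t"] by linarith
  qed
qed

section \<open>Intervals between zeros\<close>

definition nodal_intervals :: "nat \<Rightarrow> (nat \<Rightarrow> real) \<Rightarrow> (nat \<Rightarrow> real) \<Rightarrow> bool" where
  "nodal_intervals k \<alpha> \<beta> \<longleftrightarrow>
     (\<forall>i<k. 0 \<le> \<alpha> i \<and> \<alpha> i \<le> \<beta> i \<and> \<beta> i \<le> l \<and> f (\<alpha> i) = 0 \<and> f (\<beta> i) = 0 \<and> (\<exists>x\<in>{\<alpha> i<..<\<beta> i}. f x \<noteq> 0)) \<and>
     (\<forall>i<k. \<forall>j<k. i \<noteq> j \<longrightarrow> {\<alpha> i<..<\<beta> i} \<inter> {\<alpha> j<..<\<beta> j} = {})"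

text \<open>The k + 2 alternation points yield k + 1 zeros, which bound k intervals. The interval
  with index i contains the alternation point \<open>\<tau> (Suc i)\<close>, where \<open>f\<close>
  is not zero.\<close>

lemma nodal_intervals_of_alternation:
  assumes \<sigma>: "\<sigma> = 1 \<or> \<sigma> = -1" and \<mu>: "0 < \<mu>" and m: "0 < m" and s: "s = 1 \<or> s = -1"
    and X: "\<And>y. y \<in> {0..T} \<Longrightarrow> x\<^sub>0 + \<sigma> * y / \<mu> \<in> {0..l}"
    and \<tau>: "\<And>i. i < Suc k \<Longrightarrow> \<tau> i < \<tau> (Suc i)" "\<And>i. i \<le> Suc k \<Longrightarrow> \<tau> i \<in> {0..T}"
      "\<And>i. i \<le> Suc k \<Longrightarrow> 0 < (-1) ^ i * (s * f (x\<^sub>0 + \<sigma> * \<tau> i / \<mu>) / m)"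
  shows "\<exists>\<alpha> \<beta>. nodal_intervals k \<alpha> \<beta>"
proof -
  define Y where "Y y = x\<^sub>0 + \<sigma> * y / \<mu>" for y
  have Yl: "Y y \<in> {0..l}" if "y \<in> {0..T}" for y using X[OF that] by (simp add: Y_def)
  have contY: "continuous_on {0..T} (\<lambda>y. f (Y y))"
    unfolding Y_def by (rule continuous_on_compose2[OF cont]) (use X \<mu> in \<open>auto intro!: continuous_intros\<close>)
  have fY: "f (Y (\<tau> i)) * f (Y (\<tau> (Suc i))) < 0" if "i < Suc k" for i
  proof -
    have "0 < ((-1) ^ i * (s * f (Y (\<tau> i)) / m)) * ((-1) ^ Suc i * (s * f (Y (\<tau> (Suc i))) / m))"
      unfolding Y_def by (rule mult_pos_pos; rule \<tau>(3)) (use that in auto)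
    also have "\<dots> = - ((-1) ^ i * (-1) ^ i) * (s * s) * (f (Y (\<tau> i)) * f (Y (\<tau> (Suc i)))) / (m * m)"
      by simp
    also have "(-1) ^ i * (-1) ^ i = (1::real)" by (simp flip: power_mult_distrib)
    also have "s * s = 1" using s by auto
    finally show ?thesis using m by (simp add: divide_less_0_iff)
  qed
  have "\<exists>z. z \<in> {\<tau> i<..<\<tau> (Suc i)} \<and> f (Y z) = 0" if i: "i < Suc k" for i
  proof -
    have le: "\<tau> i \<le> \<tau> (Suc i)" using \<tau>(1)[OF i] by simp
    have c: "continuous_on {\<tau> i..\<tau> (Suc i)} (\<lambda>y. f (Y y))"
      using \<tau>(2)[of i] \<tau>(2)[of "Suc i"] i by (intro continuous_on_subset[OF contY]) auto
    have "\<exists>z. \<tau> i \<le> z \<and> z \<le> \<tau> (Suc i) \<and> f (Y z) = 0"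
    proof (cases "f (Y (\<tau> i)) \<le> 0")
      case True
      then have "0 \<le> f (Y (\<tau> (Suc i)))" using fY[OF i] by (auto simp: mult_less_0_iff)
      then show ?thesis using IVT'[OF True _ le c] by blast
    next
      case False
      then have "f (Y (\<tau> (Suc i))) \<le> 0" using fY[OF i] by (auto simp: mult_less_0_iff)
      then show ?thesis using IVT2'[OF _ _ le c, of 0] False by auto
    qed
    then obtain z where z: "\<tau> i \<le> z" "z \<le> \<tau> (Suc i)" "f (Y z) = 0" by blast
    moreover have "z \<noteq> \<tau> i" "z \<noteq> \<tau> (Suc i)" using fY[OF i] z by auto
    ultimately show ?thesis by (intro exI[of _ z]) auto
  qed
  then obtain z where z: "\<And>i. i < Suc k \<Longrightarrow> z i \<in> {\<tau> i<..<\<tau> (Suc i)}" "\<And>i. i < Suc k \<Longrightarrow> f (Y (z i)) = 0"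
    by metis
  have zT: "z i \<in> {0..T}" if "i < Suc k" for i
    using z(1)[OF that] \<tau>(2)[of i] \<tau>(2)[of "Suc i"] that by auto
  have z_less: "z i < z (Suc i)" if "Suc i < Suc k" for i
    using z(1)[of i] z(1)[of "Suc i"] that by auto
  have z_mono: "z i \<le> z j" if "i \<le> j" "j < Suc k" for i j
    using that
  proof (induction j rule: dec_induct)
    case (step j)
    then show ?case using z_less[of j] by auto
  qed simp
  \<comment> \<open>The minimum and the maximum cover \<sigma> = -1, where \<open>Y\<close> reverses
    the order of the zeros.\<close>
  define \<alpha> where "\<alpha> i = min (Y (z i)) (Y (z (Suc i)))" for i
  define \<beta> where "\<beta> i = max (Y (z i)) (Y (z (Suc i)))" for i
  have inY: "Y y \<in> {\<alpha> i<..<\<beta> i} \<longleftrightarrow> z i < y \<and> y < z (Suc i)" if "i < k" for i y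
    using \<sigma> \<mu> z_less[of i] that
    by (auto simp: \<alpha>_def \<beta>_def Y_def min_less_iff_disj less_max_iff_disj divide_less_cancel)
  have surj: "\<exists>y. x = Y y" for x
    using \<sigma> \<mu> by (intro exI[of _ "\<sigma> * (x - x\<^sub>0) * \<mu>"]) (auto simp: Y_def)
  have "0 \<le> \<alpha> i \<and> \<alpha> i \<le> \<beta> i \<and> \<beta> i \<le> l \<and> f (\<alpha> i) = 0 \<and> f (\<beta> i) = 0 \<and> (\<exists>x\<in>{\<alpha> i<..<\<beta> i}. f x \<noteq> 0)"
    if i: "i < k" for i
  proof -
    have "Y (z i) \<in> {0..l}" "Y (z (Suc i)) \<in> {0..l}" using zT[of i] zT[of "Suc i"] i by (auto intro!: Yl simp del: atLeastAtMost_iff)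
    moreover have "f (Y (z i)) = 0" "f (Y (z (Suc i))) = 0" using z(2)[of i] z(2)[of "Suc i"] i by auto
    moreover have "Y (\<tau> (Suc i)) \<in> {\<alpha> i<..<\<beta> i}"
      using z(1)[of i] z(1)[of "Suc i"] i by (subst inY) auto
    moreover have "f (Y (\<tau> (Suc i))) \<noteq> 0" using fY[of i] i by auto
    ultimately show ?thesis by (auto simp: \<alpha>_def \<beta>_def min_def max_def)
  qed
  moreover have disj: "{\<alpha> i<..<\<beta> i} \<inter> {\<alpha> j<..<\<beta> j} = {}" if "i < j" "j < k" for i j
  proof -
    have "False" if "x \<in> {\<alpha> i<..<\<beta> i}" "x \<in> {\<alpha> j<..<\<beta> j}" for x
    proof -
      obtain y where y: "x = Y y" using surj by blast
      have "y < z (Suc i)" "z j < y" using that inY[of i y] inY[of j y] \<open>i < j\<close> \<open>j < k\<close> by (auto simp: y)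
      moreover have "z (Suc i) \<le> z j" using \<open>i < j\<close> \<open>j < k\<close> by (intro z_mono) auto
      ultimately show False by linarith
    qed
    then show ?thesis by blast
  qed
  have "{\<alpha> i<..<\<beta> i} \<inter> {\<alpha> j<..<\<beta> j} = {}" if "i < k" "j < k" "i \<noteq> j" for i j
    using disj[of i j] disj[of j i] that by (cases "i < j") auto
  ultimately show ?thesis unfolding nodal_intervals_def by blast
qed

end

lemma large_solutions_oscillate:
  fixes l p r R E :: real
  assumes "0 < l" "2 < p" "0 < r" "0 < R" "0 \<le> E"
  shows "\<exists>M. \<forall>f g w \<rho>. edge_solution l p r R E f g w \<rho> \<longrightarrow> (\<exists>x\<in>{0..l}. M \<le> \<bar>f x\<bar>) \<longrightarrow>
    (\<exists>\<alpha> \<beta>. edge_solution.nodal_intervals l f k \<alpha> \<beta>)"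
proof -
  \<comment> \<open>The starting height is 1 because the solution is divided by its maximum.
    \<open>Suc k\<close> turns are requested since k intervals take k + 2 alternation
    points.\<close>
  obtain \<epsilon> T where \<epsilon>: "0 < \<epsilon>" and T: "0 \<le> T"
    and alt: "\<And>L v d t\<^sub>0. oscillating p r R \<epsilon> L v d \<Longrightarrow> 0 \<le> t\<^sub>0 \<Longrightarrow> t\<^sub>0 + T \<le> L \<Longrightarrow> 1 \<le> v t\<^sub>0 \<Longrightarrow> d t\<^sub>0 \<le> 0 \<Longrightarrow>
      \<exists>\<tau>. \<tau> 0 = t\<^sub>0 \<and> (\<forall>i<Suc k. \<tau> i < \<tau> (Suc i)) \<and>
         (\<forall>i\<le>Suc k. \<tau> i \<in> {t\<^sub>0..t\<^sub>0 + T} \<and> 0 < (-1) ^ i * v (\<tau> i))"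
    using alternations[OF assms(2-4) zero_less_one order_refl, of "Suc k"] by blast
  \<comment> \<open>A threshold for m^(p-2) = \<mu>^2: the term E / \<epsilon> brings the rescaled
    linear term below \<epsilon>, the square gives T / \<mu> \<le> l / 2, and 1 keeps
    \<open>M\<close> positive.\<close>
  define Q where "Q = 1 + E / \<epsilon> + (2 * T / l)\<^sup>2"
  have Q: "1 \<le> Q" "E / \<epsilon> \<le> Q" "(2 * T / l)\<^sup>2 \<le> Q" using assms \<epsilon> by (auto simp: Q_def)
  define M where "M = Q powr (1 / (p - 2))"
  have M: "0 < M" "M powr (p - 2) = Q" using Q assms by (auto simp: M_def powr_powr)
  have "\<exists>\<alpha> \<beta>. edge_solution.nodal_intervals l f k \<alpha> \<beta>"
    if sol: "edge_solution l p r R E f g w \<rho>" and big: "\<exists>x\<in>{0..l}. M \<le> \<bar>f x\<bar>" for f g w \<rho>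
  proof -
    interpret edge_solution l p r R E f g w \<rho> by (rule sol)
    obtain x\<^sub>0 where x0: "x\<^sub>0 \<in> {0..l}" "\<And>x. x \<in> {0..l} \<Longrightarrow> \<bar>f x\<bar> \<le> \<bar>f x\<^sub>0\<bar>"
      using continuous_attains_sup[of "{0..l}" "\<lambda>x. \<bar>f x\<bar>"] l cont continuous_on_rabs by fastforce
    define m where "m = \<bar>f x\<^sub>0\<bar>"
    have m: "M \<le> m" "0 < m" using big x0 M unfolding m_def by force+
    have mQ: "Q \<le> m powr (p - 2)" using M m p by (metis less_imp_le powr_mono2 diff_ge_0_iff_ge)
    define \<mu> where "\<mu> = m powr ((p - 2) / 2)"
    have \<mu>: "0 < \<mu>" "\<mu>\<^sup>2 = m powr (p - 2)" using m by (auto simp: \<mu>_def power2_eq_square powr_add[symmetric])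
    have "(2 * T / l)\<^sup>2 \<le> \<mu>\<^sup>2" using Q mQ \<mu> by linarith
    then have "2 * T / l \<le> \<mu>" by (rule power2_le_imp_le) (use \<mu> in simp)
    then have T\<mu>: "T / \<mu> \<le> l / 2" using \<mu> l by (simp add: field_simps)
    define s where "s = sgn (f x\<^sub>0)"
    have s: "s = 1 \<or> s = -1" "s * f x\<^sub>0 = m" using m by (auto simp: s_def m_def sgn_real_def)
    \<comment> \<open>Heading for the farther end leaves room of at least l / 2, enough for the
      whole rescaled time \<open>T\<close>.\<close>
    define \<sigma> :: real where "\<sigma> = (if x\<^sub>0 \<le> l / 2 then 1 else -1)"
    have \<sigma>: "\<sigma> = 1 \<or> \<sigma> = -1" by (simp add: \<sigma>_def)
    have X: "x\<^sub>0 + \<sigma> * y / \<mu> \<in> {0..l}" if "y \<in> {0..T}" for y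
    proof -
      have "0 \<le> y / \<mu>" "y / \<mu> \<le> T / \<mu>" using that \<mu> by (auto intro: divide_right_mono)
      moreover define q where "q = y / \<mu>"
      ultimately have q: "0 \<le> q" "q \<le> l / 2" using T\<mu> by linarith+
      have "x\<^sub>0 + \<sigma> * y / \<mu> = x\<^sub>0 + \<sigma> * q" by (simp add: q_def)
      then show ?thesis using q x0(1) by (auto simp: \<sigma>_def)
    qed
    have m_max: "\<bar>f x\<bar> \<le> m" if "x \<in> {0..l}" for x using x0(2)[OF that] by (simp add: m_def)
    have osc: "oscillating p r R (E / m powr (p - 2)) T (\<lambda>y. s * f (x\<^sub>0 + \<sigma> * y / \<mu>) / m)
        (\<lambda>y. s * \<sigma> * D (x\<^sub>0 + \<sigma> * y / \<mu>) / (m * \<mu>))"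
      by (rule rescaled_oscillating[OF m(2) m_max s(1) \<sigma> \<mu>_def X])
    have "E / m powr (p - 2) \<le> \<epsilon>"
    proof -
      have "E \<le> \<epsilon> * Q" using Q(2) \<epsilon> by (simp add: field_simps)
      also have "\<dots> \<le> \<epsilon> * m powr (p - 2)" using mQ \<epsilon> by simp
      finally show ?thesis using m by (simp add: field_simps)
    qed
    note osc' = oscillating_mono[OF osc this]
    have "s * \<sigma> * D x\<^sub>0 \<le> 0"
    proof (rule derivative_at_max[OF x0(1)])
      show "s * f x \<le> s * f x\<^sub>0" if "x \<in> {0..l}" for x
        using m_max[OF that] s by auto
    qed (use l x0(1) in \<open>auto simp: \<sigma>_def\<close>)
    then have "s * \<sigma> * D (x\<^sub>0 + \<sigma> * 0 / \<mu>) / (m * \<mu>) \<le> 0"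
      using m \<mu> by (simp add: divide_nonpos_pos)
    then obtain \<tau> where \<tau>: "\<forall>i<Suc k. \<tau> i < \<tau> (Suc i)"
      "\<forall>i\<le>Suc k. \<tau> i \<in> {0..0 + T} \<and> 0 < (-1) ^ i * (s * f (x\<^sub>0 + \<sigma> * \<tau> i / \<mu>) / m)"
      using alt[OF osc', of 0] s m by auto
    show ?thesis
      by (rule nodal_intervals_of_alternation[where \<tau>=\<tau> and T=T, OF \<sigma> \<mu>(1) m(2) s(1) X])
        (use \<tau> in auto)
  qed
  then show ?thesis by blast
qed

section \<open>Directions of negative second variation\<close>

lemma step_function_at:
  fixes \<alpha> \<beta> :: "nat \<Rightarrow> real"
  assumes disj: "\<forall>i<k. \<forall>j<k. i \<noteq> j \<longrightarrow> {\<alpha> i<..<\<beta> i} \<inter> {\<alpha> j<..<\<beta> j} = {}"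
    and i: "i < k" and x: "x \<in> {\<alpha> i<..<\<beta> i}"
  shows "(\<Sum>j<k. c j * indicator {\<alpha> j<..<\<beta> j} x) = (c i :: real)"
proof -
  have "(\<Sum>j<k. c j * indicator {\<alpha> j<..<\<beta> j} x) = (\<Sum>j<k. if i = j then c i else 0)"
  proof (rule sum.cong)
    fix j assume "j \<in> {..<k}"
    then have "i \<noteq> j \<Longrightarrow> x \<notin> {\<alpha> j<..<\<beta> j}" using disj i x by blast
    then show "c j * indicator {\<alpha> j<..<\<beta> j} x = (if i = j then c i else 0)"
      using x by (cases "i = j") (auto simp del: greaterThanLessThan_iff)
  qed simp
  then show ?thesis using i by (simp add: sum.delta)
qed

lemma continuous_nonneg_LINT_pos:
  fixes q :: "real \<Rightarrow> real"
  assumes q: "continuous_on {0..l} q" "\<And>x. x \<in> {0..l} \<Longrightarrow> 0 \<le> q x" and x: "x \<in> {0..l}" "q x \<noteq> 0" and l: "0 < l"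
  shows "0 < (LINT x|lebesgue_on {0..l}. q x)"
proof -
  have eq: "(LINT x|lebesgue_on {0..l}. q x) = integral {0..l} q"
    by (intro lebesgue_integral_eq_integral L2_interval_integrable continuous_L2_interval q) simp
  have "integral {0..l} q \<noteq> 0"
    using integral_eq_0_iff[OF q(1) l q(2)] x by auto
  moreover have "0 \<le> integral {0..l} q"
    using q by (intro integral_nonneg integrable_continuous_real) auto
  ultimately show ?thesis using eq by linarith
qed

context edge_solution
begin

section \<open>Multiples of the solution on nodal intervals\<close>

context
  fixes k :: nat and \<alpha> \<beta> :: "nat \<Rightarrow> real"
  assumes nodal: "nodal_intervals k \<alpha> \<beta>"
begin

definition coeff :: "(nat \<Rightarrow> real) \<Rightarrow> real \<Rightarrow> real" where
  "coeff c x = (\<Sum>i<k. c i * indicator {\<alpha> i<..<\<beta> i} x)"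

definition nodal_fun :: "(nat \<Rightarrow> real) \<Rightarrow> real \<Rightarrow> real" where
  "nodal_fun c x = coeff c x * f x"

definition nodal_deriv :: "(nat \<Rightarrow> real) \<Rightarrow> real \<Rightarrow> real" where
  "nodal_deriv c x = coeff c x * D x"

definition nodal_set :: "real set" where
  "nodal_set = \<alpha> ` {..<k} \<union> \<beta> ` {..<k}"

lemma nodal_disjoint: "\<forall>i<k. \<forall>j<k. i \<noteq> j \<longrightarrow> {\<alpha> i<..<\<beta> i} \<inter> {\<alpha> j<..<\<beta> j} = {}"
  using nodal by (auto simp: nodal_intervals_def)

lemma nodal_interval:
  assumes "i < k"
  shows "0 \<le> \<alpha> i" "\<alpha> i \<le> \<beta> i" "\<beta> i \<le> l" "f (\<alpha> i) = 0" "f (\<beta> i) = 0"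
    "\<exists>x\<in>{\<alpha> i<..<\<beta> i}. f x \<noteq> 0"
  using nodal assms by (auto simp: nodal_intervals_def)

lemma coeff_at: "i < k \<Longrightarrow> x \<in> {\<alpha> i<..<\<beta> i} \<Longrightarrow> coeff c x = c i"
  unfolding coeff_def by (rule step_function_at[OF nodal_disjoint])

lemma coeff_outside: "x \<notin> (\<Union>i<k. {\<alpha> i<..<\<beta> i}) \<Longrightarrow> coeff c x = 0"
  unfolding coeff_def by (intro sum.neutral) auto

text \<open>Disjointness removes the mixed terms. Thus the step function squared times the solution
  is again a \<open>nodal_fun\<close>, hence an admissible test function.\<close>

lemma coeff_square: "coeff (\<lambda>i. (c i)\<^sup>2) x = (coeff c x)\<^sup>2"
proof (cases "x \<in> (\<Union>i<k. {\<alpha> i<..<\<beta> i})")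
  case True
  then obtain i where i: "i < k" "x \<in> {\<alpha> i<..<\<beta> i}" by auto
  show ?thesis unfolding coeff_at[OF i] ..
next
  case False
  show ?thesis unfolding coeff_outside[OF False] by simp
qed

lemma coeff_ends: "coeff c 0 = 0" "coeff c l = 0"
  using nodal_interval by (intro coeff_outside; force)+

lemma nodal_fun_ends: "nodal_fun c 0 = 0" "nodal_fun c l = 0"
  by (simp_all add: nodal_fun_def coeff_ends)

text \<open>Cutting \<open>f\<close> off outside the interval is the same as composing it with the
  clamp to [\<alpha> i, \<beta> i], because \<open>f\<close> vanishes at both ends.\<close>

lemma nodal_piece_continuous:
  assumes i: "i < k"
  shows "continuous_on {0..l} (\<lambda>x. indicator {\<alpha> i<..<\<beta> i} x * f x)"
proof -
  note n = nodal_interval[OF i]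
  have "continuous_on {0..l} (\<lambda>x. f (max (\<alpha> i) (min (\<beta> i) x)))"
    by (rule continuous_on_compose2[OF cont]) (use n in \<open>auto intro!: continuous_intros\<close>)
  moreover have "f (max (\<alpha> i) (min (\<beta> i) x)) = indicator {\<alpha> i<..<\<beta> i} x * f x" for x
  proof -
    consider "x \<le> \<alpha> i" | "\<alpha> i < x" "x < \<beta> i" | "\<beta> i \<le> x" by linarith
    then show ?thesis
    proof cases
      case 1
      then have "max (\<alpha> i) (min (\<beta> i) x) = \<alpha> i" using n by linarith
      then show ?thesis using n 1 by simp
    next
      case 2
      then have "max (\<alpha> i) (min (\<beta> i) x) = x" by linarith
      then show ?thesis using 2 by simp
    next
      case 3
      then have "max (\<alpha> i) (min (\<beta> i) x) = \<beta> i" using n by linarith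
      then show ?thesis using n 3 by simp
    qed
  qed
  ultimately show ?thesis by simp
qed

lemma nodal_fun_continuous: "continuous_on {0..l} (nodal_fun c)"
proof -
  have "nodal_fun c = (\<lambda>x. \<Sum>i<k. c i * (indicator {\<alpha> i<..<\<beta> i} x * f x))"
    by (rule ext) (simp only: nodal_fun_def coeff_def sum_distrib_right mult.assoc)
  moreover have "continuous_on {0..l} (\<lambda>x. \<Sum>i<k. c i * (indicator {\<alpha> i<..<\<beta> i} x * f x))"
    by (intro continuous_on_sum continuous_on_mult continuous_on_const nodal_piece_continuous) auto
  ultimately show ?thesis by simp
qed

lemma finite_nodal_set: "finite nodal_set"
  by (simp add: nodal_set_def)

lemma nodal_fun_has_derivative:
  assumes x: "x \<in> {0<..<l} - nodal_set"
  shows "(nodal_fun c has_real_derivative nodal_deriv c x) (at x)"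
proof -
  have f: "(f has_real_derivative D x) (at x)" using x by (intro f_has_derivative_interior) auto
  show ?thesis
  proof (cases "x \<in> (\<Union>i<k. {\<alpha> i<..<\<beta> i})")
    case True
    then obtain i where i: "i < k" "x \<in> {\<alpha> i<..<\<beta> i}" by auto
    have "((\<lambda>x. c i * f x) has_real_derivative nodal_deriv c x) (at x)"
      using DERIV_cmult[OF f, of "c i"] unfolding nodal_deriv_def coeff_at[OF i] .
    then show ?thesis
      by (rule has_field_derivative_transform_within_open[OF _ open_greaterThanLessThan i(2)])
        (simp add: nodal_fun_def coeff_at[OF i(1)])
  next
    case False
    define C where "C = (\<Union>i<k. {\<alpha> i..\<beta> i})"
    have "closed C" unfolding C_def by (intro closed_UN) auto
    moreover have "x \<notin> C" using False x by (force simp: C_def nodal_set_def)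
    ultimately have C: "open (- C)" "x \<in> - C" by auto
    have "((\<lambda>x. 0) has_real_derivative nodal_deriv c x) (at x)"
      unfolding nodal_deriv_def coeff_outside[OF False] by simp
    then show ?thesis
    proof (rule has_field_derivative_transform_within_open[OF _ C])
      fix y assume "y \<in> - C"
      moreover have "(\<Union>i<k. {\<alpha> i<..<\<beta> i}) \<subseteq> C" unfolding C_def by (intro UN_mono) auto
      ultimately have "y \<notin> (\<Union>i<k. {\<alpha> i<..<\<beta> i})" by blast
      then have "coeff c y = 0" by (rule coeff_outside)
      then show "0 = nodal_fun c y" by (simp add: nodal_fun_def)
    qed
  qed
qed

lemma nodal_deriv_L2: "nodal_deriv c \<in> L2_interval l"
  unfolding nodal_deriv_def[abs_def]
proof (rule L2_interval_bounded_mult[OF D_L2])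
  have "{\<alpha> i<..<\<beta> i} \<in> sets (lebesgue_on {0..l})" if "i < k" for i
    using nodal_interval[OF that] by (auto simp: sets_restrict_space_iff)
  then show "coeff c \<in> borel_measurable (lebesgue_on {0..l})"
    unfolding coeff_def[abs_def]
    by (intro borel_measurable_sum borel_measurable_times borel_measurable_const borel_measurable_indicator) auto
  have "\<bar>coeff c x\<bar> \<le> (\<Sum>i<k. \<bar>c i\<bar>)" for x
  proof -
    have "\<bar>coeff c x\<bar> \<le> (\<Sum>i<k. \<bar>c i * indicator {\<alpha> i<..<\<beta> i} x\<bar>)"
      unfolding coeff_def by (rule sum_abs)
    also have "\<dots> \<le> (\<Sum>i<k. \<bar>c i\<bar>)"
      by (intro sum_mono) (auto simp: indicator_def)
    finally show ?thesis .
  qed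
  then show "AE x in lebesgue_on {0..l}. \<bar>coeff c x\<bar> \<le> (\<Sum>i<k. \<bar>c i\<bar>)" by simp
qed

text \<open>
  Testing the equation with \<open>c\<^sup>2 u\<close>, where \<open>c\<close> is constant between consecutive zeros of \<open>u\<close>, turns
  the second variation at \<open>c u\<close> into \<open>- (p - 2) \<integral> \<rho> |u|\<^sup>p c\<^sup>2\<close>.
\<close>

lemma nodal_fun_negative:
  assumes i: "i < k" and ci: "c i \<noteq> 0"
  shows "(LINT x|lebesgue_on {0..l}. (nodal_deriv c x)\<^sup>2 + w x * (nodal_fun c x)\<^sup>2 -
      (p - 1) * \<rho> x * \<bar>f x\<bar> powr (p - 2) * (nodal_fun c x)\<^sup>2) < 0"
proof -
  let ?a = "nodal_fun (\<lambda>i. (c i)\<^sup>2)"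
  let ?A = "nodal_deriv (\<lambda>i. (c i)\<^sup>2)"
  have fa: "f x * ?a x = (nodal_fun c x)\<^sup>2" for x
    unfolding nodal_fun_def coeff_square by (simp add: power2_eq_square)
  have Da: "D x * ?A x = (nodal_deriv c x)\<^sup>2" for x
    unfolding nodal_deriv_def coeff_square by (simp add: power2_eq_square)
  define q where "q x = \<bar>f x\<bar> powr (p - 2) * (nodal_fun c x)\<^sup>2" for x
  have q_cont: "continuous_on {0..l} q"
    unfolding q_def by (intro continuous_intros powr_cont nodal_fun_continuous)
  have i1: "integrable (lebesgue_on {0..l}) (\<lambda>x. (nodal_deriv c x)\<^sup>2)"
    using nodal_deriv_L2 by (simp add: L2_interval_def)
  have i2: "integrable (lebesgue_on {0..l}) (\<lambda>x. w x * (nodal_fun c x)\<^sup>2)"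
    using L2_interval_integrable[OF w_f_L2[OF nodal_fun_continuous, of "\<lambda>i. (c i)\<^sup>2"]]
    by (simp add: mult.assoc fa)
  have i3: "integrable (lebesgue_on {0..l}) (\<lambda>x. \<rho> x * q x)"
    using L2_interval_integrable[OF \<rho>_f_L2[of "\<lambda>x. (nodal_fun c x)\<^sup>2"]] nodal_fun_continuous
    by (simp add: mult.assoc q_def continuous_on_power)
  have "(LINT x|lebesgue_on {0..l}. g x * ?A x + w x * f x * ?a x) =
      (LINT x|lebesgue_on {0..l}. \<rho> x * \<bar>f x\<bar> powr (p - 2) * f x * ?a x)"
    by (rule weak_eq[OF finite_nodal_set nodal_fun_continuous nodal_fun_ends nodal_fun_has_derivative nodal_deriv_L2])
  also have "(LINT x|lebesgue_on {0..l}. g x * ?A x + w x * f x * ?a x) =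
      (LINT x|lebesgue_on {0..l}. (nodal_deriv c x)\<^sup>2 + w x * (nodal_fun c x)\<^sup>2)"
  proof (rule integral_cong_AE)
    show "(\<lambda>x. g x * ?A x + w x * f x * ?a x) \<in> borel_measurable (lebesgue_on {0..l})"
      using borel_measurable_integrable[OF L2_interval_mult_integrable[OF g nodal_deriv_L2[of "\<lambda>i. (c i)\<^sup>2"]]]
        borel_measurable_integrable[OF i2]
      by (simp add: mult.assoc fa)
    show "(\<lambda>x. (nodal_deriv c x)\<^sup>2 + w x * (nodal_fun c x)\<^sup>2) \<in> borel_measurable (lebesgue_on {0..l})"
      using borel_measurable_integrable[OF i1] borel_measurable_integrable[OF i2] by simp
    show "AE x in lebesgue_on {0..l}. g x * ?A x + w x * f x * ?a x = (nodal_deriv c x)\<^sup>2 + w x * (nodal_fun c x)\<^sup>2"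
      using g_eq_D by eventually_elim (simp add: Da fa mult.assoc)
  qed
  also have "(\<lambda>x. \<rho> x * \<bar>f x\<bar> powr (p - 2) * f x * ?a x) = (\<lambda>x. \<rho> x * q x)"
    by (simp add: q_def mult.assoc fa)
  finally have eq: "(LINT x|lebesgue_on {0..l}. (nodal_deriv c x)\<^sup>2 + w x * (nodal_fun c x)\<^sup>2) =
      (LINT x|lebesgue_on {0..l}. \<rho> x * q x)" .
  have "(\<lambda>x. (nodal_deriv c x)\<^sup>2 + w x * (nodal_fun c x)\<^sup>2 -
      (p - 1) * \<rho> x * \<bar>f x\<bar> powr (p - 2) * (nodal_fun c x)\<^sup>2) =
      (\<lambda>x. ((nodal_deriv c x)\<^sup>2 + w x * (nodal_fun c x)\<^sup>2) - (p - 1) * (\<rho> x * q x))"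
    by (simp add: q_def mult.assoc)
  then have "(LINT x|lebesgue_on {0..l}. (nodal_deriv c x)\<^sup>2 + w x * (nodal_fun c x)\<^sup>2 -
      (p - 1) * \<rho> x * \<bar>f x\<bar> powr (p - 2) * (nodal_fun c x)\<^sup>2) =
      (LINT x|lebesgue_on {0..l}. ((nodal_deriv c x)\<^sup>2 + w x * (nodal_fun c x)\<^sup>2) - (p - 1) * (\<rho> x * q x))"
    by simp
  also have "\<dots> = (LINT x|lebesgue_on {0..l}. (nodal_deriv c x)\<^sup>2 + w x * (nodal_fun c x)\<^sup>2) -
      (LINT x|lebesgue_on {0..l}. (p - 1) * (\<rho> x * q x))"
    by (intro Bochner_Integration.integral_diff Bochner_Integration.integrable_add integrable_mult_right i1 i2 i3)
  \<comment> \<open>The tested equation replaces the first integral by that of \<rho> q, leaving the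
    factor 1 - (p - 1).\<close>
  also have "\<dots> = - (p - 2) * (LINT x|lebesgue_on {0..l}. \<rho> x * q x)"
  proof -
    define J where "J = (LINT x|lebesgue_on {0..l}. \<rho> x * q x)"
    show ?thesis unfolding eq integral_mult_right_zero J_def[symmetric] by (simp add: algebra_simps)
  qed
  finally have Q: "(LINT x|lebesgue_on {0..l}. (nodal_deriv c x)\<^sup>2 + w x * (nodal_fun c x)\<^sup>2 -
      (p - 1) * \<rho> x * \<bar>f x\<bar> powr (p - 2) * (nodal_fun c x)\<^sup>2) = - (p - 2) * (LINT x|lebesgue_on {0..l}. \<rho> x * q x)" .
  obtain x where x: "x \<in> {\<alpha> i<..<\<beta> i}" "f x \<noteq> 0" using nodal_interval(6)[OF i] by blast
  \<comment> \<open>Strict positivity comes from the continuous function \<open>q\<close>; the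
    measurable \<rho> enters afterwards through its lower bound \<open>r\<close>.\<close>
  have "0 < (LINT x|lebesgue_on {0..l}. q x)"
  proof (rule continuous_nonneg_LINT_pos[OF q_cont _ _ _ l])
    show "x \<in> {0..l}" using x nodal_interval[OF i] by auto
    show "q x \<noteq> 0" using x ci by (simp add: q_def nodal_fun_def coeff_at[OF i x(1)])
  qed (simp add: q_def)
  then have "0 < r * (LINT x|lebesgue_on {0..l}. q x)" using r by simp
  also have "\<dots> = (LINT x|lebesgue_on {0..l}. r * q x)" by simp
  also have "\<dots> \<le> (LINT x|lebesgue_on {0..l}. \<rho> x * q x)"
  proof (rule integral_mono)
    show "integrable (lebesgue_on {0..l}) (\<lambda>x. r * q x)"
      by (intro integrable_mult_right L2_interval_integrable continuous_L2_interval q_cont)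
    show "r * q x \<le> \<rho> x * q x" for x
      using \<rho>_lower[of x] by (intro mult_right_mono) (simp_all add: q_def)
  qed (rule i3)
  finally have "0 < (LINT x|lebesgue_on {0..l}. \<rho> x * q x)" .
  then show ?thesis unfolding Q using p by (simp add: mult_neg_pos)
qed

end

end

section \<open>Upper bound for the Morse index\<close>

text \<open>The evaluations at \<open>P\<close> separate the elements of \<open>X\<close>, and the
  kernel of one evaluation has codimension at most one. A spanning set is constructed, rather than
  dimensions compared, because finite dimension of \<open>X\<close> is itself at stake in
  \<open>edim\<close>.\<close>

lemma span_of_evaluations:
  assumes "finite P" "fun_space.subspace X" "\<And>\<phi>. \<phi> \<in> X \<Longrightarrow> (\<And>q. q \<in> P \<Longrightarrow> \<phi> q = 0) \<Longrightarrow> \<phi> = 0"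
  shows "\<exists>B. finite B \<and> card B \<le> card P \<and> fun_space.span B = X"
  using assms
proof (induction P arbitrary: X rule: finite_induct)
  case empty
  then have "X = {0}" using fun_space.subspace_0 by fastforce
  then show ?case by (intro exI[of _ "{}"]) simp
next
  case (insert q P)
  define Y where "Y = {\<phi> \<in> X. \<phi> q = 0}"
  have Y: "fun_space.subspace Y"
    using insert.prems(1) unfolding fun_space.subspace_def Y_def by (auto simp: fun_scale_def)
  obtain B where B: "finite B" "card B \<le> card P" "fun_space.span B = Y"
    using insert.IH[OF Y] insert.prems(2) by (fastforce simp: Y_def)
  show ?case
  proof (cases "Y = X")
    case True
    then show ?thesis using B insert.hyps by (intro exI[of _ B]) auto
  next
    case False
    then obtain \<psi> where \<psi>: "\<psi> \<in> X" "\<psi> q \<noteq> 0" unfolding Y_def by blast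
    have "fun_space.span (insert \<psi> B) = X"
    proof
      have "B \<subseteq> X" using B(3) fun_space.span_superset[of B] by (auto simp: Y_def)
      then show "fun_space.span (insert \<psi> B) \<subseteq> X"
        using \<psi> insert.prems(1) by (intro fun_space.span_minimal) auto
      show "X \<subseteq> fun_space.span (insert \<psi> B)"
      proof
        fix \<phi> assume \<phi>: "\<phi> \<in> X"
        \<comment> \<open>Projection along \<psi> onto the kernel of the evaluation at
          \<open>q\<close>.\<close>
        have "\<phi> - fun_scale (\<phi> q / \<psi> q) \<psi> \<in> X"
          by (intro fun_space.subspace_diff fun_space.subspace_scale insert.prems(1) \<phi> \<psi>)
        then have "\<phi> - fun_scale (\<phi> q / \<psi> q) \<psi> \<in> Y"
          using \<psi>(2) by (simp add: Y_def fun_scale_def)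
        then have "\<phi> - fun_scale (\<phi> q / \<psi> q) \<psi> \<in> fun_space.span (insert \<psi> B)"
          using B(3) fun_space.span_mono[of B "insert \<psi> B"] by auto
        moreover have "fun_scale (\<phi> q / \<psi> q) \<psi> \<in> fun_space.span (insert \<psi> B)"
          by (intro fun_space.span_scale fun_space.span_base) simp
        ultimately have "\<phi> - fun_scale (\<phi> q / \<psi> q) \<psi> + fun_scale (\<phi> q / \<psi> q) \<psi> \<in> fun_space.span (insert \<psi> B)"
          by (rule fun_space.span_add)
        then show "\<phi> \<in> fun_space.span (insert \<psi> B)" by simp
      qed
    qed
    moreover have "card (insert \<psi> B) \<le> card (insert q P)"
      using B insert.hyps card_insert_le_m1 by (simp add: card_insert_if)
    ultimately show ?thesis using B by (intro exI[of _ "insert \<psi> B"]) auto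
  qed
qed

lemma edim_le_evaluations:
  assumes "finite P" "fun_space.subspace X" "\<And>\<phi>. \<phi> \<in> X \<Longrightarrow> (\<And>q. q \<in> P \<Longrightarrow> \<phi> q = 0) \<Longrightarrow> \<phi> = 0"
  shows "edim X \<le> enat (card P)"
proof -
  obtain B where B: "finite B" "card B \<le> card P" "fun_space.span B = X"
    using span_of_evaluations[OF assms] by blast
  have "fun_space.dim X \<le> card B"
    using B by (intro fun_space.dim_le_card) auto
  moreover have "edim X = enat (fun_space.dim X)"
    unfolding edim_def using B by auto
  ultimately show ?thesis using B by simp
qed

lemma edim_span_independent:
  assumes "finite B" "fun_space.independent B"
  shows "edim (fun_space.span B) = enat (card B)"
proof -
  have "\<exists>B'. finite B' \<and> fun_space.span B' = fun_space.span B" using assms(1) by blast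
  then show ?thesis
    unfolding edim_def fun_space.dim_span_eq_card_independent[OF assms(2)] by simp
qed

text \<open>Cauchy-Schwarz for f x as the integral of \<open>g\<close> from the zero
  \<open>a\<close>. It is obtained by expanding the nonnegative integral of (g - c)^2 with
  \<open>c\<close> the mean of \<open>g\<close> on {a..x}.\<close>

lemma square_le_integral_square:
  assumes f: "continuous_on {0..l} f" and g: "g \<in> L2_interval l" and fg: "has_weak_deriv l f g"
    and a: "0 \<le> a" "a \<le> x" "x \<le> l" "f a = 0"
  shows "(f x)\<^sup>2 \<le> (x - a) * integral {0..l} (\<lambda>x. (g x)\<^sup>2)"
proof (cases "a = x")
  case False
  then have ax: "0 < x - a" using a by simp
  define c where "c = f x / (x - a)"
  have g2: "(\<lambda>x. (g x)\<^sup>2) integrable_on {0..l}"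
    using g by (intro integrable_on_lebesgue_on) (auto simp: L2_interval_def)
  then have g2': "(\<lambda>x. (g x)\<^sup>2) integrable_on {a..x}" using a by (auto intro: integrable_on_subinterval)
  have "(g has_integral f x) {a..x}" using weak_deriv_FTC[OF f g fg a(1-3)] a(4) by simp
  then have g1: "((\<lambda>y. (2 * c) * g y) has_integral (2 * c) * f x) {a..x}"
    by (rule has_integral_mult_right)
  have "((\<lambda>y. ((g y)\<^sup>2 - (2 * c) * g y) + c\<^sup>2) has_integral
      (integral {a..x} (\<lambda>x. (g x)\<^sup>2) - (2 * c) * f x) + c\<^sup>2 * (x - a)) {a..x}"
    using has_integral_const_real[of "c\<^sup>2" a x] a
    by (intro has_integral_add has_integral_diff g1 integrable_integral g2') (simp add: mult.commute)
  moreover have "(\<lambda>y. ((g y)\<^sup>2 - (2 * c) * g y) + c\<^sup>2) = (\<lambda>y. (g y - c)\<^sup>2)"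
    by (simp add: power2_diff algebra_simps)
  ultimately have "0 \<le> (integral {a..x} (\<lambda>x. (g x)\<^sup>2) - (2 * c) * f x) + c\<^sup>2 * (x - a)"
    by (metis (no_types, lifting) has_integral_nonneg zero_le_power2)
  moreover have "(2 * c) * f x - c\<^sup>2 * (x - a) = (f x)\<^sup>2 / (x - a)"
  proof -
    define \<delta> where "\<delta> = x - a"
    have "\<delta> \<noteq> 0" using ax by (simp add: \<delta>_def)
    then show ?thesis unfolding c_def \<delta>_def[symmetric] by (simp add: power2_eq_square)
  qed
  ultimately have "(f x)\<^sup>2 / (x - a) \<le> integral {a..x} (\<lambda>x. (g x)\<^sup>2)" by linarith
  also have "\<dots> \<le> integral {0..l} (\<lambda>x. (g x)\<^sup>2)"
    using a by (intro integral_subset_le g2 g2') auto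
  finally show ?thesis using ax by (simp add: field_simps)
qed (use a in simp)

text \<open>A Poincare inequality: each point lies at most l / n to the right of a grid zero, so f^2
  \<le> (l / n) I everywhere and the integral of f^2 is at most l^2 I / n.\<close>

lemma integral_square_le:
  assumes f: "continuous_on {0..l} f" and g: "g \<in> L2_interval l" and fg: "has_weak_deriv l f g"
    and l: "0 < l" and n: "0 < n" and zeros: "\<And>j. j \<le> n \<Longrightarrow> f (real j * l / real n) = 0"
    and M: "0 \<le> M" "M * l\<^sup>2 \<le> real n"
  shows "M * (LINT x|lebesgue_on {0..l}. (f x)\<^sup>2) \<le> (LINT x|lebesgue_on {0..l}. (g x)\<^sup>2)"
proof -
  define I where "I = (LINT x|lebesgue_on {0..l}. (g x)\<^sup>2)"
  have I: "I = integral {0..l} (\<lambda>x. (g x)\<^sup>2)" unfolding I_def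
    using g by (intro lebesgue_integral_eq_integral) (auto simp: L2_interval_def)
  have I0: "0 \<le> I" unfolding I_def by (rule Bochner_Integration.integral_nonneg) simp
  have bound: "(f x)\<^sup>2 \<le> l / real n * I" if x: "x \<in> {0..l}" for x
  proof -
    \<comment> \<open>The last grid point not beyond \<open>x\<close>.\<close>
    define j where "j = nat \<lfloor>x * real n / l\<rfloor>"
    have "0 \<le> x * real n / l" using x l by simp
    then have j: "real j \<le> x * real n / l" "x * real n / l < real j + 1"
      unfolding j_def by linarith+
    have "x * real n \<le> l * real n" using x by (intro mult_right_mono) auto
    then have "x * real n / l \<le> real n" using l by (simp add: divide_le_eq mult.commute)
    then have "real j \<le> real n" using j by linarith
    then have jn: "j \<le> n" by simp
    have 1: "real j * l / real n \<le> x" using j l n by (simp add: field_simps)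
    have "x < (real j + 1) * l / real n" using j l n by (simp add: field_simps)
    then have 2: "x - real j * l / real n \<le> l / real n" by (simp add: distrib_right add_divide_distrib)
    have "(f x)\<^sup>2 \<le> (x - real j * l / real n) * I"
      unfolding I using x l 1 zeros[OF jn] by (intro square_le_integral_square[OF f g fg]) auto
    also have "\<dots> \<le> l / real n * I" using 2 I0 by (rule mult_right_mono)
    finally show ?thesis .
  qed
  have "(LINT x|lebesgue_on {0..l}. (f x)\<^sup>2) = integral {0..l} (\<lambda>x. (f x)\<^sup>2)"
    by (intro lebesgue_integral_eq_integral L2_interval_integrable continuous_L2_interval continuous_intros f) simp
  also have "\<dots> \<le> integral {0..l} (\<lambda>_. l / real n * I)"
    by (intro integral_le integrable_continuous_real continuous_intros f bound)
  also have "\<dots> = l\<^sup>2 / real n * I" using l by (simp add: power2_eq_square)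
  finally have "M * (LINT x|lebesgue_on {0..l}. (f x)\<^sup>2) \<le> M * (l\<^sup>2 / real n * I)"
    using M(1) by (rule mult_left_mono)
  also have "\<dots> = (M * l\<^sup>2) / real n * I" by simp
  also have "\<dots> \<le> 1 * I" using M n I0 by (intro mult_right_mono) (simp_all add: divide_le_eq)
  finally show ?thesis by (simp add: I_def)
qed

lemma has_weak_deriv_cong:
  assumes "\<And>x. x \<in> {0..l} \<Longrightarrow> f x = f' x" "has_weak_deriv l f g"
  shows "has_weak_deriv l f' g"
proof -
  have "(LINT x|lebesgue_on {0..l}. f' x * deriv \<phi> x) = (LINT x|lebesgue_on {0..l}. f x * deriv \<phi> x)" for \<phi>
    by (intro Bochner_Integration.integral_cong) (use assms in auto)
  then show ?thesis using assms(2) by (simp add: has_weak_deriv_def)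
qed

section \<open>The second variation on the graph\<close>

context compact_metric_graph
begin

lemma H1_edge:
  assumes "u \<in> H1 G len" "e \<in> arcs G"
  shows "continuous_on {0..len e} (on_edge G len u e)"
    and "edge_deriv G len u e \<in> L2_interval (len e)"
    and "has_weak_deriv (len e) (on_edge G len u e) (edge_deriv G len u e)"
proof -
  show "continuous_on {0..len e} (on_edge G len u e)"
    using assms by (auto simp: H1_def continuous_map_graph_iff)
  have "\<exists>g. g \<in> L2_interval (len e) \<and> has_weak_deriv (len e) (on_edge G len u e) g"
    using assms by (auto simp: H1_def H1_interval_def)
  from someI_ex[OF this] show "edge_deriv G len u e \<in> L2_interval (len e)"
    "has_weak_deriv (len e) (on_edge G len u e) (edge_deriv G len u e)"
    by (simp_all add: edge_deriv_def weak_deriv_def)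
qed

text \<open>On each edge the coefficient of \<phi>^2 is at least - M almost everywhere, where
  \<open>M\<close> is the constant in the condition on \<open>n\<close>; the grid is fine enough for
  the Poincare inequality to absorb this loss into the gradient term.\<close>

lemma second_variation_nonneg:
  assumes \<phi>: "\<phi> \<in> H1 G len" and u: "u \<in> H1 G len" and p: "2 < p"
    and W: "\<And>e. e \<in> arcs G \<Longrightarrow> on_edge G len W e \<in> borel_measurable (lebesgue_on {0..len e})"
    and \<rho>: "\<And>e. e \<in> arcs G \<Longrightarrow> on_edge G len \<rho> e \<in> borel_measurable (lebesgue_on {0..len e})"
    and W_bound: "\<And>e. e \<in> arcs G \<Longrightarrow> AE x in lebesgue_on {0..len e}. \<bar>on_edge G len W e x\<bar> \<le> B"
    and \<rho>_bound: "\<And>e. e \<in> arcs G \<Longrightarrow> AE x in lebesgue_on {0..len e}. \<bar>on_edge G len \<rho> e x\<bar> \<le> R"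
    and lam: "\<bar>lam\<bar> \<le> \<Lambda>"
    and A: "\<And>e x. e \<in> arcs G \<Longrightarrow> x \<in> {0..len e} \<Longrightarrow> \<bar>on_edge G len u e x\<bar> \<le> A"
    and n: "0 < n" "\<And>e. e \<in> arcs G \<Longrightarrow> (B + \<Lambda> + (p - 1) * (R * A powr (p - 2))) * (len e)\<^sup>2 \<le> real n"
    and M0: "0 \<le> B + \<Lambda> + (p - 1) * (R * A powr (p - 2))"
    and zeros: "\<And>e j. e \<in> arcs G \<Longrightarrow> j \<le> n \<Longrightarrow> on_edge G len \<phi> e (real j * len e / real n) = 0"
  shows "0 \<le> second_variation G len W \<rho> p lam u \<phi>"
  unfolding second_variation_def graph_integral_def
proof (rule sum_nonneg)
  fix e assume e: "e \<in> arcs G"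
  define l f g v where "l = len e" and "f = on_edge G len \<phi> e" and "g = edge_deriv G len \<phi> e"
    and "v = on_edge G len u e"
  define M where "M = B + \<Lambda> + (p - 1) * (R * A powr (p - 2))"
  define c where "c x = (on_edge G len W e x + lam) - (p - 1) * (on_edge G len \<rho> e x * \<bar>v x\<bar> powr (p - 2))" for x
  note \<phi>e = H1_edge[OF \<phi> e, folded l_def f_def g_def]
  have l: "0 < l" using len_pos[OF e] by (simp add: l_def)
  have v_cont: "continuous_on {0..l} v" using H1_edge(1)[OF u e] by (simp add: l_def v_def)
  have "continuous_on {0..l} (\<lambda>x. \<bar>v x\<bar> powr (p - 2))"
    using p by (intro continuous_on_powr' continuous_intros v_cont) auto
  then have "(\<lambda>x. \<bar>v x\<bar> powr (p - 2)) \<in> borel_measurable (lebesgue_on {0..l})"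
    by (rule continuous_imp_measurable_on_sets_lebesgue) simp
  then have c_meas: "c \<in> borel_measurable (lebesgue_on {0..l})"
    unfolding c_def[abs_def] l_def using W[OF e] \<rho>[OF e]
    by (intro borel_measurable_diff borel_measurable_add borel_measurable_times borel_measurable_const)
  have c_bound: "AE x in lebesgue_on {0..l}. \<bar>c x\<bar> \<le> M"
    using W_bound[OF e, folded l_def] \<rho>_bound[OF e, folded l_def] AE_space
  proof eventually_elim
    case (elim x)
    have "\<bar>v x\<bar> powr (p - 2) \<le> A powr (p - 2)"
      using A[OF e, of x] elim p by (intro powr_mono2) (auto simp: v_def l_def)
    then have "\<bar>on_edge G len \<rho> e x * \<bar>v x\<bar> powr (p - 2)\<bar> \<le> R * A powr (p - 2)"
      unfolding abs_mult using elim by (intro mult_mono) auto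
    then have "(p - 1) * \<bar>on_edge G len \<rho> e x * \<bar>v x\<bar> powr (p - 2)\<bar> \<le> (p - 1) * (R * A powr (p - 2))"
      using p by (intro mult_left_mono) auto
    moreover have "(p - 1) * \<bar>on_edge G len \<rho> e x * \<bar>v x\<bar> powr (p - 2)\<bar> =
        \<bar>(p - 1) * (on_edge G len \<rho> e x * \<bar>v x\<bar> powr (p - 2))\<bar>"
      using p by (simp add: abs_mult)
    ultimately show ?case using elim(1) lam unfolding c_def M_def by linarith
  qed
  have f2: "(\<lambda>x. (f x)\<^sup>2) \<in> L2_interval l"
    by (intro continuous_L2_interval continuous_intros \<phi>e)
  have i1: "integrable (lebesgue_on {0..l}) (\<lambda>x. (g x)\<^sup>2)"
    using \<phi>e(2) by (simp add: L2_interval_def)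
  have i2: "integrable (lebesgue_on {0..l}) (\<lambda>x. c x * (f x)\<^sup>2)"
    by (rule L2_interval_integrable[OF L2_interval_bounded_mult[OF f2 c_meas c_bound]])
  have i3: "integrable (lebesgue_on {0..l}) (\<lambda>x. (f x)\<^sup>2)"
    by (rule L2_interval_integrable[OF f2])
  have "0 \<le> (LINT x|lebesgue_on {0..l}. (g x)\<^sup>2) - M * (LINT x|lebesgue_on {0..l}. (f x)\<^sup>2)"
    using integral_square_le[OF \<phi>e l n(1), of M] zeros[OF e] n(2)[OF e] M0
    by (simp add: f_def l_def M_def)
  also have "\<dots> = (LINT x|lebesgue_on {0..l}. (g x)\<^sup>2 - M * (f x)\<^sup>2)"
    using i1 i3 by simp
  also have "\<dots> \<le> (LINT x|lebesgue_on {0..l}. (g x)\<^sup>2 + c x * (f x)\<^sup>2)"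
  proof (rule integral_mono_AE)
    show "integrable (lebesgue_on {0..l}) (\<lambda>x. (g x)\<^sup>2 - M * (f x)\<^sup>2)" using i1 i3 by simp
    show "integrable (lebesgue_on {0..l}) (\<lambda>x. (g x)\<^sup>2 + c x * (f x)\<^sup>2)" using i1 i2 by simp
    show "AE x in lebesgue_on {0..l}. (g x)\<^sup>2 - M * (f x)\<^sup>2 \<le> (g x)\<^sup>2 + c x * (f x)\<^sup>2"
      using c_bound
    proof eventually_elim
      case (elim x)
      then have "- M \<le> c x" by linarith
      from mult_right_mono[OF this, of "(f x)\<^sup>2"] show ?case by simp
    qed
  qed
  also have "(\<lambda>x. (g x)\<^sup>2 + c x * (f x)\<^sup>2) = (\<lambda>x. (edge_deriv G len \<phi> e x)\<^sup>2 +
       (on_edge G len W e x + lam) * (on_edge G len \<phi> e x)\<^sup>2 -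
       (p - 1) * on_edge G len \<rho> e x * \<bar>on_edge G len u e x\<bar> powr (p - 2) *
       (on_edge G len \<phi> e x)\<^sup>2)"
    by (simp add: c_def f_def g_def v_def algebra_simps)
  finally show "0 \<le> (LINT x|lebesgue_on {0..len e}. (edge_deriv G len \<phi> e x)\<^sup>2 +
       (on_edge G len W e x + lam) * (on_edge G len \<phi> e x)\<^sup>2 -
       (p - 1) * on_edge G len \<rho> e x * \<bar>on_edge G len u e x\<bar> powr (p - 2) *
       (on_edge G len \<phi> e x)\<^sup>2)" by (simp add: l_def)
qed

text \<open>The order of the quantifiers matters: the grid \<open>P\<close> depends on
  \<open>A\<close>, \<Lambda> and the fixed data, and is chosen before \<lambda> and u. The same
  statement applied to a single solution shows that its index is finite.\<close>

lemma morse_index_bounded: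
  assumes p: "2 < p"
    and W: "\<And>e. e \<in> arcs G \<Longrightarrow> on_edge G len W e \<in> borel_measurable (lebesgue_on {0..len e})"
    and \<rho>: "\<And>e. e \<in> arcs G \<Longrightarrow> on_edge G len \<rho> e \<in> borel_measurable (lebesgue_on {0..len e})"
    and W_bound: "\<And>e. e \<in> arcs G \<Longrightarrow> AE x in lebesgue_on {0..len e}. \<bar>on_edge G len W e x\<bar> \<le> B"
    and \<rho>_bound: "\<And>e. e \<in> arcs G \<Longrightarrow> AE x in lebesgue_on {0..len e}. \<bar>on_edge G len \<rho> e x\<bar> \<le> R"
    and "0 \<le> B" "0 \<le> R"
  shows "\<exists>N::nat. \<forall>lam u. \<bar>lam\<bar> \<le> \<Lambda> \<longrightarrow> u \<in> H1 G len \<longrightarrow>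
    (\<forall>e\<in>arcs G. \<forall>x\<in>{0..len e}. \<bar>on_edge G len u e x\<bar> \<le> A) \<longrightarrow> morse_index G len W \<rho> p lam u \<le> enat N"
proof -
  define M where "M = B + \<Lambda> + (p - 1) * (R * A powr (p - 2))"
  \<comment> \<open>The sum dominates every single squared length, so one \<open>n\<close> serves
    all edges.\<close>
  define s where "s = (\<Sum>e\<in>arcs G. (len e)\<^sup>2)"
  obtain n0 :: nat where n0: "M * s \<le> real n0" using real_arch_simple by blast
  define n where "n = Suc n0"
  define P where "P = (\<lambda>(e, j). edge_point G len e (real j * len e / real n)) ` (arcs G \<times> {..n})"
  have P: "finite P" unfolding P_def using finite_edges by simp
  have "morse_index G len W \<rho> p lam u \<le> enat (card P)"
    if lam: "\<bar>lam\<bar> \<le> \<Lambda>" and u: "u \<in> H1 G len"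
      and A: "\<forall>e\<in>arcs G. \<forall>x\<in>{0..len e}. \<bar>on_edge G len u e x\<bar> \<le> A" for lam u
    unfolding morse_index_def
  proof (rule Sup_least, clarify)
    fix X assume X: "fun_space.subspace X" "X \<subseteq> H1 G len"
      "\<forall>\<phi>\<in>X - {0}. second_variation G len W \<rho> p lam u \<phi> < 0"
    \<comment> \<open>No sign of \<Lambda> is given here; it follows from |\<lambda>| \<le>
      \<Lambda>, hence only once some \<lambda> is at hand.\<close>
    have M0: "0 \<le> M" using assms(6,7) p lam unfolding M_def by (intro add_nonneg_nonneg mult_nonneg_nonneg) auto
    show "edim X \<le> enat (card P)"
    proof (rule edim_le_evaluations[OF P X(1)])
      fix \<phi> assume \<phi>: "\<phi> \<in> X" "\<And>q. q \<in> P \<Longrightarrow> \<phi> q = 0"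
      have "0 \<le> second_variation G len W \<rho> p lam u \<phi>"
      proof (rule second_variation_nonneg[OF _ u p W \<rho> W_bound \<rho>_bound lam])
        show "\<phi> \<in> H1 G len" using \<phi> X by blast
        show "0 < n" by (simp add: n_def)
        show "0 \<le> B + \<Lambda> + (p - 1) * (R * A powr (p - 2))" using M0 by (simp add: M_def)
        show "(B + \<Lambda> + (p - 1) * (R * A powr (p - 2))) * (len e)\<^sup>2 \<le> real n" if "e \<in> arcs G" for e
        proof -
          have "(len e)\<^sup>2 \<le> s" unfolding s_def using that finite_edges by (intro member_le_sum) auto
          then have "M * (len e)\<^sup>2 \<le> M * s" using M0 by (rule mult_left_mono)
          then show ?thesis using n0 by (simp add: n_def M_def)
        qed
        show "on_edge G len \<phi> e (real j * len e / real n) = 0" if "e \<in> arcs G" "j \<le> n" for e j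
          unfolding on_edge_def using that by (intro \<phi>(2)) (auto simp: P_def)
      qed (use A in auto)
      then show "\<phi> = 0" using X(3) \<phi>(1) by (metis DiffI not_le singletonD)
    qed
  qed
  then show ?thesis by blast
qed

end

section \<open>Lower bound for the Morse index\<close>

text \<open>Extension by zero, meant for functions that vanish at both ends of the edge. The guard
  on x makes the lift vanish at terms \<open>Interior e x\<close> outside the graph, as
  \<open>H1\<close> demands.\<close>

definition lift_edge :: "('e \<Rightarrow> real) \<Rightarrow> 'e \<Rightarrow> (real \<Rightarrow> real) \<Rightarrow> ('v, 'e) point \<Rightarrow> real" where
  "lift_edge len e a q = (case q of Vertex v \<Rightarrow> 0
     | Interior e' x \<Rightarrow> if e' = e \<and> 0 < x \<and> x < len e then a x else 0)"

lemma sum_fun_apply: "(\<Sum>i\<in>A. F i) a = (\<Sum>i\<in>A. (F i a :: real))"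
  by (induction A rule: infinite_finite_induct) auto

context compact_metric_graph
begin

lemma on_edge_lift:
  assumes "a 0 = 0" "a (len e) = 0" "e' \<in> arcs G" "x \<in> {0..len e'}"
  shows "on_edge G len (lift_edge len e a) e' x = (if e' = e then a x else 0)"
  using assms by (auto simp: on_edge_def edge_point_def lift_edge_def)

lemma lift_in_H1:
  assumes e: "e \<in> arcs G" and a: "continuous_on {0..len e} a" "a 0 = 0" "a (len e) = 0"
    and S: "finite S" "\<And>x. x \<in> {0<..<len e} - S \<Longrightarrow> (a has_real_derivative a' x) (at x)"
    and a': "a' \<in> L2_interval (len e)"
  shows "lift_edge len e a \<in> H1 G len"
    and "AE x in lebesgue_on {0..len e}. edge_deriv G len (lift_edge len e a) e x = a' x"
    and "\<And>e'. e' \<in> arcs G \<Longrightarrow> e' \<noteq> e \<Longrightarrow>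
      AE x in lebesgue_on {0..len e'}. edge_deriv G len (lift_edge len e a) e' x = 0"
proof -
  note on = on_edge_lift[of a e, OF a(2,3)]
  let ?\<phi> = "lift_edge len e a"
  have w: "has_weak_deriv (len e) (on_edge G len ?\<phi> e) a'"
    by (rule has_weak_deriv_cong[OF _ has_weak_deriv_piecewise[OF len_pos[OF e] a(1) S a']])
      (simp add: on e)
  have zero_L2: "(\<lambda>_. 0) \<in> L2_interval (len e')" for e'
    by (intro continuous_L2_interval continuous_intros)
  have w0: "has_weak_deriv (len e') (on_edge G len ?\<phi> e') (\<lambda>_. 0)" if e': "e' \<in> arcs G" "e' \<noteq> e" for e'
  proof (rule has_weak_deriv_cong)
    show "has_weak_deriv (len e') (\<lambda>_. 0) (\<lambda>_. 0)" by (simp add: has_weak_deriv_def)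
    show "0 = on_edge G len ?\<phi> e' x" if "x \<in> {0..len e'}" for x
      using on[OF e'(1) that] e'(2) by simp
  qed
  have cont: "continuous_on {0..len e'} (on_edge G len ?\<phi> e')" if e': "e' \<in> arcs G" for e'
  proof (cases "e' = e")
    case True
    then show ?thesis using a(1) by (subst continuous_on_cong[OF refl, where g=a]) (simp_all add: on e)
  next
    case False
    then show ?thesis by (subst continuous_on_cong[OF refl, where g="\<lambda>_. 0"]) (simp_all add: on e')
  qed
  show H1: "?\<phi> \<in> H1 G len"
    unfolding H1_def mem_Collect_eq continuous_map_graph_iff
  proof (intro conjI ballI allI impI)
    show "continuous_on {0..len e'} (on_edge G len ?\<phi> e')" if "e' \<in> arcs G" for e' by (rule cont[OF that])
    show "on_edge G len ?\<phi> e' \<in> H1_interval (len e')" if "e' \<in> arcs G" for e'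
      using continuous_L2_interval[OF cont[OF that]] w a' w0[OF that] zero_L2[of e']
      by (cases "e' = e") (auto simp: H1_interval_def)
    show "?\<phi> q = 0" if "q \<notin> points G len" for q
      using that e by (auto simp: lift_edge_def points_def split: point.split)
  qed
  show "AE x in lebesgue_on {0..len e}. edge_deriv G len ?\<phi> e x = a' x"
    by (rule weak_deriv_unique[OF H1_edge[OF H1 e] a' w])
  show "AE x in lebesgue_on {0..len e'}. edge_deriv G len ?\<phi> e' x = 0" if "e' \<in> arcs G" "e' \<noteq> e" for e'
    by (rule weak_deriv_unique[OF H1_edge[OF H1 that(1)] zero_L2 w0[OF that]])
qed

lemma graph_integral_single:
  assumes e: "e \<in> arcs G"
    and 0: "\<And>e'. e' \<in> arcs G \<Longrightarrow> e' \<noteq> e \<Longrightarrow> AE x in lebesgue_on {0..len e'}. F e' x = 0"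
  shows "graph_integral G len F = (LINT x|lebesgue_on {0..len e}. F e x)"
proof -
  have "graph_integral G len F = (\<Sum>e'\<in>arcs G. if e' = e then LINT x|lebesgue_on {0..len e}. F e x else 0)"
    unfolding graph_integral_def
  proof (rule sum.cong)
    fix e' assume e': "e' \<in> arcs G"
    show "(LINT x|lebesgue_on {0..len e'}. F e' x) = (if e' = e then LINT x|lebesgue_on {0..len e}. F e x else 0)"
      using integral_eq_zero_AE[OF 0[OF e']] by auto
  qed simp
  then show ?thesis using finite_edges e by (simp add: sum.delta)
qed

lemma edge_test_equation:
  assumes sol: "is_solution G len W \<rho> p lam u" and e: "e \<in> arcs G" and p: "2 < p"
    and W: "on_edge G len W e \<in> borel_measurable (lebesgue_on {0..len e})"
    and \<rho>: "on_edge G len \<rho> e \<in> borel_measurable (lebesgue_on {0..len e})"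
    and w: "w \<in> borel_measurable (lebesgue_on {0..len e})" "AE x in lebesgue_on {0..len e}. w x = on_edge G len W e x + lam"
    and \<rho>': "\<rho>' \<in> borel_measurable (lebesgue_on {0..len e})" "AE x in lebesgue_on {0..len e}. \<rho>' x = on_edge G len \<rho> e x"
    and a: "finite S" "continuous_on {0..len e} a" "a 0 = 0" "a (len e) = 0"
     "\<And>x. x \<in> {0<..<len e} - S \<Longrightarrow> (a has_real_derivative a' x) (at x)" "a' \<in> L2_interval (len e)"
  shows "(LINT x|lebesgue_on {0..len e}. edge_deriv G len u e x * a' x + w x * on_edge G len u e x * a x) =
    (LINT x|lebesgue_on {0..len e}. \<rho>' x * \<bar>on_edge G len u e x\<bar> powr (p - 2) * on_edge G len u e x * a x)"
proof -
  let ?\<phi> = "lift_edge len e a" and ?M = "lebesgue_on {0..len e}"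
  have lift: "?\<phi> \<in> H1 G len" "AE x in ?M. edge_deriv G len ?\<phi> e x = a' x"
    "\<And>e'. e' \<in> arcs G \<Longrightarrow> e' \<noteq> e \<Longrightarrow> AE x in lebesgue_on {0..len e'}. edge_deriv G len ?\<phi> e' x = 0"
    by (rule lift_in_H1[OF e a(2-4,1,5,6)]; assumption)+
  note on = on_edge_lift[of a e, OF a(3,4)]
  have u: "u \<in> H1 G len" using sol by (simp add: is_solution_def)
  note ue = H1_edge[OF u e] and \<phi>e = H1_edge[OF lift(1) e]
  have meas: "on_edge G len u e \<in> borel_measurable ?M" "edge_deriv G len u e \<in> borel_measurable ?M"
    "on_edge G len ?\<phi> e \<in> borel_measurable ?M" "edge_deriv G len ?\<phi> e \<in> borel_measurable ?M"
    "a \<in> borel_measurable ?M" "a' \<in> borel_measurable ?M"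
    using continuous_L2_interval[OF ue(1)] ue(2) continuous_L2_interval[OF \<phi>e(1)] \<phi>e(2)
      continuous_L2_interval[OF a(2)] a(6)
    by (simp_all add: L2_interval_def)
  have pw: "(\<lambda>x. \<bar>on_edge G len u e x\<bar> powr (p - 2)) \<in> borel_measurable ?M"
  proof (rule continuous_imp_measurable_on_sets_lebesgue)
    show "continuous_on {0..len e} (\<lambda>x. \<bar>on_edge G len u e x\<bar> powr (p - 2))"
      using p by (intro continuous_on_powr' continuous_intros ue(1)) auto
  qed simp
  have eq: "graph_integral G len (\<lambda>e x.
          edge_deriv G len u e x * edge_deriv G len ?\<phi> e x +
          (on_edge G len W e x + lam) * on_edge G len u e x * on_edge G len ?\<phi> e x) =
        graph_integral G len (\<lambda>e x.
          on_edge G len \<rho> e x * \<bar>on_edge G len u e x\<bar> powr (p - 2) *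
          on_edge G len u e x * on_edge G len ?\<phi> e x)"
    using sol lift(1) by (simp add: is_solution_def)
  have on0: "AE x in lebesgue_on {0..len e'}. on_edge G len ?\<phi> e' x = 0" if "e' \<in> arcs G" "e' \<noteq> e" for e'
    using on[OF that(1)] that(2) by (intro AE_I2) simp
  have one: "AE x in ?M. on_edge G len ?\<phi> e x = a x"
    using on[OF e] by (intro AE_I2) simp
  have "(LINT x|?M. edge_deriv G len u e x * a' x + w x * on_edge G len u e x * a x) =
      (LINT x|?M. edge_deriv G len u e x * edge_deriv G len ?\<phi> e x +
          (on_edge G len W e x + lam) * on_edge G len u e x * on_edge G len ?\<phi> e x)"
  proof (rule integral_cong_AE)
    show "(\<lambda>x. edge_deriv G len u e x * a' x + w x * on_edge G len u e x * a x) \<in> borel_measurable ?M"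
      by (intro borel_measurable_add borel_measurable_times meas w)
    show "(\<lambda>x. edge_deriv G len u e x * edge_deriv G len ?\<phi> e x +
          (on_edge G len W e x + lam) * on_edge G len u e x * on_edge G len ?\<phi> e x) \<in> borel_measurable ?M"
      by (intro borel_measurable_add borel_measurable_times borel_measurable_const meas W)
    show "AE x in ?M. edge_deriv G len u e x * a' x + w x * on_edge G len u e x * a x =
        edge_deriv G len u e x * edge_deriv G len ?\<phi> e x +
          (on_edge G len W e x + lam) * on_edge G len u e x * on_edge G len ?\<phi> e x"
      using lift(2) w(2) one by eventually_elim simp
  qed
  also have "\<dots> = graph_integral G len (\<lambda>e x.
          edge_deriv G len u e x * edge_deriv G len ?\<phi> e x +
          (on_edge G len W e x + lam) * on_edge G len u e x * on_edge G len ?\<phi> e x)"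
  proof (rule graph_integral_single[OF e, symmetric])
    fix e' assume e': "e' \<in> arcs G" "e' \<noteq> e"
    show "AE x in lebesgue_on {0..len e'}. edge_deriv G len u e' x * edge_deriv G len ?\<phi> e' x +
          (on_edge G len W e' x + lam) * on_edge G len u e' x * on_edge G len ?\<phi> e' x = 0"
      using lift(3)[OF e'] on0[OF e'] by eventually_elim simp
  qed
  also have "\<dots> = (LINT x|?M. on_edge G len \<rho> e x * \<bar>on_edge G len u e x\<bar> powr (p - 2) *
          on_edge G len u e x * on_edge G len ?\<phi> e x)"
    unfolding eq
  proof (rule graph_integral_single[OF e])
    fix e' assume e': "e' \<in> arcs G" "e' \<noteq> e"
    show "AE x in lebesgue_on {0..len e'}. on_edge G len \<rho> e' x * \<bar>on_edge G len u e' x\<bar> powr (p - 2) *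
          on_edge G len u e' x * on_edge G len ?\<phi> e' x = 0"
      using on0[OF e'] by eventually_elim simp
  qed
  also have "\<dots> = (LINT x|?M. \<rho>' x * \<bar>on_edge G len u e x\<bar> powr (p - 2) * on_edge G len u e x * a x)"
  proof (rule integral_cong_AE)
    show "(\<lambda>x. on_edge G len \<rho> e x * \<bar>on_edge G len u e x\<bar> powr (p - 2) *
          on_edge G len u e x * on_edge G len ?\<phi> e x) \<in> borel_measurable ?M"
      by (intro borel_measurable_times meas pw \<rho>)
    show "(\<lambda>x. \<rho>' x * \<bar>on_edge G len u e x\<bar> powr (p - 2) * on_edge G len u e x * a x) \<in> borel_measurable ?M"
      by (intro borel_measurable_times meas pw \<rho>')
    show "AE x in ?M. on_edge G len \<rho> e x * \<bar>on_edge G len u e x\<bar> powr (p - 2) *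
          on_edge G len u e x * on_edge G len ?\<phi> e x =
        \<rho>' x * \<bar>on_edge G len u e x\<bar> powr (p - 2) * on_edge G len u e x * a x"
      using \<rho>'(2) one by eventually_elim simp
  qed
  finally show ?thesis .
qed

text \<open>
  Truncation makes the essential bounds on \<open>W + \<lambda>\<close> and \<open>\<rho>\<close> hold everywhere.
\<close>

lemma edge_solution_truncated:
  assumes sol: "is_solution G len W \<rho> p lam u" and e: "e \<in> arcs G" and p: "2 < p"
    and W: "on_edge G len W e \<in> borel_measurable (lebesgue_on {0..len e})"
      "AE x in lebesgue_on {0..len e}. \<bar>on_edge G len W e x\<bar> \<le> B"
    and \<rho>: "on_edge G len \<rho> e \<in> borel_measurable (lebesgue_on {0..len e})"
      "AE x in lebesgue_on {0..len e}. r \<le> on_edge G len \<rho> e x"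
      "AE x in lebesgue_on {0..len e}. on_edge G len \<rho> e x \<le> R"
    and lam: "\<bar>lam\<bar> \<le> \<Lambda>" and r: "0 < r" "r \<le> R" and B: "0 \<le> B"
  obtains w \<rho>' where "edge_solution (len e) p r R (B + \<Lambda>) (on_edge G len u e) (edge_deriv G len u e) w \<rho>'"
    and "AE x in lebesgue_on {0..len e}. w x = on_edge G len W e x + lam"
    and "AE x in lebesgue_on {0..len e}. \<rho>' x = on_edge G len \<rho> e x"
proof -
  define E where "E = B + \<Lambda>"
  have E: "0 \<le> E" using B lam by (simp add: E_def)
  define w where "w x = max (- E) (min E (on_edge G len W e x + lam))" for x
  define \<rho>' where "\<rho>' x = max r (min R (on_edge G len \<rho> e x))" for x
  have w: "AE x in lebesgue_on {0..len e}. w x = on_edge G len W e x + lam"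
    using W(2)
  proof eventually_elim
    case (elim x)
    then have "\<bar>on_edge G len W e x + lam\<bar> \<le> E" using lam by (simp add: E_def)
    then show ?case by (auto simp: w_def)
  qed
  have \<rho>': "AE x in lebesgue_on {0..len e}. \<rho>' x = on_edge G len \<rho> e x"
    using \<rho>(2,3) by eventually_elim (simp add: \<rho>'_def)
  have wm: "w \<in> borel_measurable (lebesgue_on {0..len e})"
    unfolding w_def[abs_def] using W(1)
    by (intro borel_measurable_max borel_measurable_min borel_measurable_add borel_measurable_const)
  have \<rho>m: "\<rho>' \<in> borel_measurable (lebesgue_on {0..len e})"
    unfolding \<rho>'_def[abs_def] using \<rho>(1)
    by (intro borel_measurable_max borel_measurable_min borel_measurable_const)
  have u: "u \<in> H1 G len" using sol by (simp add: is_solution_def)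
  have "edge_solution (len e) p r R (B + \<Lambda>) (on_edge G len u e) (edge_deriv G len u e) w \<rho>'"
  proof (rule edge_solution.intro)
    show "\<bar>w x\<bar> \<le> B + \<Lambda>" for x using E by (auto simp: w_def E_def abs_le_iff)
    show "r \<le> \<rho>' x" for x by (simp add: \<rho>'_def)
    show "\<rho>' x \<le> R" for x using r by (simp add: \<rho>'_def)
    fix a a' S
    assume "finite S" "continuous_on {0..len e} a" "a 0 = 0" "a (len e) = 0"
     "\<And>x. x \<in> {0<..<len e} - S \<Longrightarrow> (a has_real_derivative a' x) (at x)" "a' \<in> L2_interval (len e)"
    from edge_test_equation[OF sol e p W(1) \<rho>(1) wm w \<rho>m \<rho>' this]
    show "(LINT x|lebesgue_on {0..len e}. edge_deriv G len u e x * a' x + w x * on_edge G len u e x * a x) =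
      (LINT x|lebesgue_on {0..len e}. \<rho>' x * \<bar>on_edge G len u e x\<bar> powr (p - 2) * on_edge G len u e x * a x)" .
  qed (use len_pos[OF e] p r H1_edge[OF u e] wm \<rho>m in auto)
  with w \<rho>' show thesis using that by blast
qed

lemma second_variation_lift:
  assumes u: "u \<in> H1 G len" and e: "e \<in> arcs G" and p: "2 < p"
    and W: "on_edge G len W e \<in> borel_measurable (lebesgue_on {0..len e})"
    and \<rho>: "on_edge G len \<rho> e \<in> borel_measurable (lebesgue_on {0..len e})"
    and w: "w \<in> borel_measurable (lebesgue_on {0..len e})" "AE x in lebesgue_on {0..len e}. w x = on_edge G len W e x + lam"
    and \<rho>': "\<rho>' \<in> borel_measurable (lebesgue_on {0..len e})" "AE x in lebesgue_on {0..len e}. \<rho>' x = on_edge G len \<rho> e x"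
    and a: "finite S" "continuous_on {0..len e} a" "a 0 = 0" "a (len e) = 0"
     "\<And>x. x \<in> {0<..<len e} - S \<Longrightarrow> (a has_real_derivative a' x) (at x)" "a' \<in> L2_interval (len e)"
  shows "second_variation G len W \<rho> p lam u (lift_edge len e a) =
    (LINT x|lebesgue_on {0..len e}. (a' x)\<^sup>2 + w x * (a x)\<^sup>2 -
      (p - 1) * \<rho>' x * \<bar>on_edge G len u e x\<bar> powr (p - 2) * (a x)\<^sup>2)"
proof -
  let ?\<phi> = "lift_edge len e a" and ?M = "lebesgue_on {0..len e}"
  have lift: "?\<phi> \<in> H1 G len" "AE x in ?M. edge_deriv G len ?\<phi> e x = a' x"
    "\<And>e'. e' \<in> arcs G \<Longrightarrow> e' \<noteq> e \<Longrightarrow> AE x in lebesgue_on {0..len e'}. edge_deriv G len ?\<phi> e' x = 0"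
    by (rule lift_in_H1[OF e a(2-4,1,5,6)]; assumption)+
  note on = on_edge_lift[of a e, OF a(3,4)]
  note ue = H1_edge[OF u e] and \<phi>e = H1_edge[OF lift(1) e]
  have meas: "on_edge G len ?\<phi> e \<in> borel_measurable ?M" "edge_deriv G len ?\<phi> e \<in> borel_measurable ?M"
    "a \<in> borel_measurable ?M" "a' \<in> borel_measurable ?M"
    using continuous_L2_interval[OF \<phi>e(1)] \<phi>e(2) continuous_L2_interval[OF a(2)] a(6)
    by (simp_all add: L2_interval_def)
  have pw: "(\<lambda>x. \<bar>on_edge G len u e x\<bar> powr (p - 2)) \<in> borel_measurable ?M"
  proof (rule continuous_imp_measurable_on_sets_lebesgue)
    show "continuous_on {0..len e} (\<lambda>x. \<bar>on_edge G len u e x\<bar> powr (p - 2))"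
      using p by (intro continuous_on_powr' continuous_intros ue(1)) auto
  qed simp
  have on0: "AE x in lebesgue_on {0..len e'}. on_edge G len ?\<phi> e' x = 0" if "e' \<in> arcs G" "e' \<noteq> e" for e'
    using on[OF that(1)] that(2) by (intro AE_I2) simp
  have one: "AE x in ?M. on_edge G len ?\<phi> e x = a x"
    using on[OF e] by (intro AE_I2) simp
  have "second_variation G len W \<rho> p lam u ?\<phi> = (LINT x|?M. (edge_deriv G len ?\<phi> e x)\<^sup>2 +
       (on_edge G len W e x + lam) * (on_edge G len ?\<phi> e x)\<^sup>2 -
       (p - 1) * on_edge G len \<rho> e x * \<bar>on_edge G len u e x\<bar> powr (p - 2) * (on_edge G len ?\<phi> e x)\<^sup>2)"
    unfolding second_variation_def
  proof (rule graph_integral_single[OF e])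
    fix e' assume e': "e' \<in> arcs G" "e' \<noteq> e"
    show "AE x in lebesgue_on {0..len e'}. (edge_deriv G len ?\<phi> e' x)\<^sup>2 +
       (on_edge G len W e' x + lam) * (on_edge G len ?\<phi> e' x)\<^sup>2 -
       (p - 1) * on_edge G len \<rho> e' x * \<bar>on_edge G len u e' x\<bar> powr (p - 2) * (on_edge G len ?\<phi> e' x)\<^sup>2 = 0"
      using lift(3)[OF e'] on0[OF e'] by eventually_elim simp
  qed
  also have "\<dots> = (LINT x|?M. (a' x)\<^sup>2 + w x * (a x)\<^sup>2 -
      (p - 1) * \<rho>' x * \<bar>on_edge G len u e x\<bar> powr (p - 2) * (a x)\<^sup>2)"
  proof (rule integral_cong_AE)
    show "(\<lambda>x. (edge_deriv G len ?\<phi> e x)\<^sup>2 + (on_edge G len W e x + lam) * (on_edge G len ?\<phi> e x)\<^sup>2 -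
       (p - 1) * on_edge G len \<rho> e x * \<bar>on_edge G len u e x\<bar> powr (p - 2) * (on_edge G len ?\<phi> e x)\<^sup>2)
       \<in> borel_measurable ?M"
      by (intro borel_measurable_diff borel_measurable_add borel_measurable_times borel_measurable_power
          borel_measurable_const meas pw W \<rho>)
    show "(\<lambda>x. (a' x)\<^sup>2 + w x * (a x)\<^sup>2 -
      (p - 1) * \<rho>' x * \<bar>on_edge G len u e x\<bar> powr (p - 2) * (a x)\<^sup>2) \<in> borel_measurable ?M"
      by (intro borel_measurable_diff borel_measurable_add borel_measurable_times borel_measurable_power
          borel_measurable_const meas pw w \<rho>')
    show "AE x in ?M. (edge_deriv G len ?\<phi> e x)\<^sup>2 + (on_edge G len W e x + lam) * (on_edge G len ?\<phi> e x)\<^sup>2 -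
       (p - 1) * on_edge G len \<rho> e x * \<bar>on_edge G len u e x\<bar> powr (p - 2) * (on_edge G len ?\<phi> e x)\<^sup>2 =
       (a' x)\<^sup>2 + w x * (a x)\<^sup>2 - (p - 1) * \<rho>' x * \<bar>on_edge G len u e x\<bar> powr (p - 2) * (a x)\<^sup>2"
      using lift(2) w(2) \<rho>'(2) one by eventually_elim simp
  qed
  finally show ?thesis .
qed

text \<open>The lifted pieces \<open>b i\<close> have disjoint supports and are therefore
  independent. Every element of their span is the lift of some \<open>F c\<close>, and its second
  variation is negative unless all coefficients vanish.\<close>

lemma morse_index_ge_nodal:
  assumes u: "u \<in> H1 G len" and e: "e \<in> arcs G"
    and W: "on_edge G len W e \<in> borel_measurable (lebesgue_on {0..len e})"
    and \<rho>: "on_edge G len \<rho> e \<in> borel_measurable (lebesgue_on {0..len e})"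
    and sol: "edge_solution (len e) p r R E (on_edge G len u e) (edge_deriv G len u e) w \<rho>'"
    and w: "AE x in lebesgue_on {0..len e}. w x = on_edge G len W e x + lam"
    and \<rho>': "AE x in lebesgue_on {0..len e}. \<rho>' x = on_edge G len \<rho> e x"
    and nodal: "edge_solution.nodal_intervals (len e) (on_edge G len u e) k \<alpha> \<beta>"
  shows "enat k \<le> morse_index G len W \<rho> p lam u"
proof -
  interpret S: edge_solution "len e" p r R E "on_edge G len u e" "edge_deriv G len u e" w \<rho>'
    by (rule sol)
  define F where "F = S.nodal_fun k \<alpha> \<beta>"
  define b where "b i = (lift_edge len e (\<lambda>x. indicator {\<alpha> i<..<\<beta> i} x * on_edge G len u e x) :: ('v, 'e) point \<Rightarrow> real)" for i
  have nf: "F c x = (\<Sum>i<k. c i * (indicator {\<alpha> i<..<\<beta> i} x * on_edge G len u e x))" for c x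
    by (simp only: F_def S.nodal_fun_def[OF nodal] S.coeff_def[OF nodal] sum_distrib_right mult.assoc)
  have comb: "lift_edge len e (F c) = (\<Sum>i<k. fun_scale (c i) (b i))" for c
  proof
    fix q :: "('v, 'e) point"
    show "lift_edge len e (F c) q = (\<Sum>i<k. fun_scale (c i) (b i)) q"
      unfolding sum_fun_apply
    proof (cases q)
      case (Interior e' x)
      show "lift_edge len e (F c) q = (\<Sum>i<k. fun_scale (c i) (b i) q)"
      proof (cases "e' = e \<and> 0 < x \<and> x < len e")
        case True
        then show ?thesis unfolding lift_edge_def b_def fun_scale_def nf Interior by simp
      next
        case False
        then show ?thesis unfolding lift_edge_def b_def fun_scale_def nf Interior
          by (simp only: point.case if_False mult_zero_right sum.neutral_const)
      qed
    qed (simp add: lift_edge_def b_def fun_scale_def)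
  qed
  have "\<forall>i. \<exists>x. i < k \<longrightarrow> x \<in> {\<alpha> i<..<\<beta> i} \<and> on_edge G len u e x \<noteq> 0"
    using S.nodal_interval(6)[OF nodal] by blast
  then obtain z where z: "\<And>i. i < k \<Longrightarrow> z i \<in> {\<alpha> i<..<\<beta> i}" "\<And>i. i < k \<Longrightarrow> on_edge G len u e (z i) \<noteq> 0"
    by metis
  have at_z: "lift_edge len e (F c) (Interior e (z i) :: ('v, 'e) point) = c i * on_edge G len u e (z i)" if i: "i < k" for c i
    using z(1)[OF i] S.nodal_interval(1,3)[OF nodal i]
    by (simp add: lift_edge_def F_def S.nodal_fun_def[OF nodal] S.coeff_at[OF nodal i])
  have lift0: "lift_edge len e (F c) = (0 :: ('v, 'e) point \<Rightarrow> real)" if "\<And>i. i < k \<Longrightarrow> c i = 0" for c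
    unfolding comb using that by (intro sum.neutral) (auto simp: fun_scale_def)
  have inj: "inj_on b {..<k}"
  proof (rule inj_onI, rule ccontr)
    fix i j assume ij: "i \<in> {..<k}" "j \<in> {..<k}" "b i = b j" "i \<noteq> j"
    have "z i \<notin> {\<alpha> j<..<\<beta> j}"
      using S.nodal_disjoint[OF nodal] z(1)[of i] ij by blast
    then have "b j (Interior e (z i)) = 0" by (simp add: b_def lift_edge_def)
    moreover have "b i (Interior e (z i)) = on_edge G len u e (z i)"
      using z(1)[of i] S.nodal_interval(1,3)[OF nodal, of i] ij(1) by (simp add: b_def lift_edge_def)
    ultimately show False using ij z(2)[of i] by simp
  qed
  define B where "B = b ` {..<k}"
  have sumB: "(\<Sum>v\<in>B. fun_scale (c v) v) = lift_edge len e (F (\<lambda>i. c (b i)))" for c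
    unfolding comb B_def by (simp add: sum.reindex[OF inj])
  have indep: "fun_space.independent B"
  proof
    assume "fun_space.dependent B"
    then obtain c where c: "\<exists>v\<in>B. c v \<noteq> 0" "(\<Sum>v\<in>B. fun_scale (c v) v) = 0"
      using fun_space.dependent_finite[of B] by (auto simp: B_def)
    then obtain i where i: "i < k" "c (b i) \<noteq> 0" by (auto simp: B_def)
    then have "lift_edge len e (F (\<lambda>i. c (b i))) (Interior e (z i) :: ('v, 'e) point) \<noteq> 0"
      using at_z[OF i(1)] z(2)[OF i(1)] by simp
    then show False using c(2) by (simp add: sumB)
  qed
  have nodal_lift: "lift_edge len e (F c) \<in> H1 G len" for c
    unfolding F_def
    by (rule lift_in_H1(1)[OF e S.nodal_fun_continuous[OF nodal] S.nodal_fun_ends[OF nodal]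
          S.finite_nodal_set[OF nodal] S.nodal_fun_has_derivative[OF nodal] S.nodal_deriv_L2[OF nodal]])
  have span: "\<exists>c. \<phi> = lift_edge len e (F c)" if "\<phi> \<in> fun_space.span B" for \<phi>
  proof -
    have "\<phi> \<in> range (\<lambda>c. \<Sum>v\<in>B. fun_scale (c v) v)"
      using that fun_space.span_finite[of B] by (simp add: B_def)
    then show ?thesis unfolding sumB by blast
  qed
  have "edim (fun_space.span B) \<le> morse_index G len W \<rho> p lam u"
    unfolding morse_index_def
  proof (intro Sup_upper CollectI exI[of _ "fun_space.span B"] conjI ballI)
    show "fun_space.subspace (fun_space.span B)" by (rule fun_space.subspace_span)
    show "fun_space.span B \<subseteq> H1 G len" using span nodal_lift by blast
    fix \<phi> assume \<phi>: "\<phi> \<in> fun_space.span B - {0}"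
    then obtain c where c: "\<phi> = lift_edge len e (F c)" using span by blast
    have "\<exists>i<k. c i \<noteq> 0"
    proof (rule ccontr)
      assume "\<not> ?thesis"
      then have "\<phi> = 0" unfolding c by (intro lift0) blast
      then show False using \<phi> by simp
    qed
    then obtain i where i: "i < k" "c i \<noteq> 0" by blast
    have "second_variation G len W \<rho> p lam u \<phi> =
      (LINT x|lebesgue_on {0..len e}. (S.nodal_deriv k \<alpha> \<beta> c x)\<^sup>2 + w x * (S.nodal_fun k \<alpha> \<beta> c x)\<^sup>2 -
        (p - 1) * \<rho>' x * \<bar>on_edge G len u e x\<bar> powr (p - 2) * (S.nodal_fun k \<alpha> \<beta> c x)\<^sup>2)"
      unfolding c F_def
      by (rule second_variation_lift[OF u e S.p W \<rho> S.w_meas w S.\<rho>_meas \<rho>' S.finite_nodal_set[OF nodal]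
          S.nodal_fun_continuous[OF nodal] S.nodal_fun_ends[OF nodal]
          S.nodal_fun_has_derivative[OF nodal] S.nodal_deriv_L2[OF nodal]])
    also have "\<dots> < 0" by (rule S.nodal_fun_negative[OF nodal, of i c, OF i])
    finally show "second_variation G len W \<rho> p lam u \<phi> < 0" .
  qed simp
  moreover have "edim (fun_space.span B) = enat k"
    using edim_span_independent[OF _ indep] card_image[OF inj] by (simp add: B_def)
  ultimately show ?thesis by simp
qed

end

section \<open>Comparison of the suprema\<close>

context compact_metric_graph
begin

lemma Linf_E:
  assumes "F \<in> Linf G len"
  obtains B where "0 \<le> B" "\<And>e. e \<in> arcs G \<Longrightarrow> on_edge G len F e \<in> borel_measurable (lebesgue_on {0..len e})"
    "\<And>e. e \<in> arcs G \<Longrightarrow> AE x in lebesgue_on {0..len e}. \<bar>on_edge G len F e x\<bar> \<le> B"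
proof -
  define B where "B = enn2real (Linf_norm G len F)"
  have B: "ennreal B = Linf_norm G len F" using assms by (simp add: B_def Linf_def)
  show thesis
  proof (rule that[of B])
    show "0 \<le> B" by (simp add: B_def)
    fix e assume e: "e \<in> arcs G"
    show "on_edge G len F e \<in> borel_measurable (lebesgue_on {0..len e})"
      using assms e by (simp add: Linf_def)
    have "esssup (lebesgue_on {0..len e}) (\<lambda>x. ennreal \<bar>on_edge G len F e x\<bar>) \<le> ennreal B"
      unfolding B Linf_norm_def using e by (rule SUP_upper)
    then show "AE x in lebesgue_on {0..len e}. \<bar>on_edge G len F e x\<bar> \<le> B"
      using esssup_AE[of "\<lambda>x. ennreal \<bar>on_edge G len F e x\<bar>" "lebesgue_on {0..len e}"]
    proof (elim eventually_mono)
      fix x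
      assume "esssup (lebesgue_on {0..len e}) (\<lambda>x. ennreal \<bar>on_edge G len F e x\<bar>) \<le> ennreal B"
        "ennreal \<bar>on_edge G len F e x\<bar> \<le> esssup (lebesgue_on {0..len e}) (\<lambda>x. ennreal \<bar>on_edge G len F e x\<bar>)"
      then have "ennreal \<bar>on_edge G len F e x\<bar> \<le> ennreal B" by (rule order_trans[rotated])
      then show "\<bar>on_edge G len F e x\<bar> \<le> B" by (simp add: ennreal_le_iff B_def)
    qed
  qed
qed

text \<open>The value of \<open>ess_inf\<close> is an \<open>ereal\<close>, infinite when there are
  no edges; a real number strictly between 0 and it is taken instead.\<close>

lemma ess_inf_pos_E:
  assumes "ess_inf G len F > 0"
  obtains r where "0 < r" "\<And>e. e \<in> arcs G \<Longrightarrow> AE x in lebesgue_on {0..len e}. r \<le> on_edge G len F e x"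
proof -
  obtain r where r: "0 < ereal r" "ereal r < ess_inf G len F"
    using ereal_dense2[OF assms] by auto
  show thesis
  proof (rule that[of r])
    show "0 < r" using r by simp
    fix e assume e: "e \<in> arcs G"
    let ?S = "esssup (lebesgue_on {0..len e}) (\<lambda>x. - ereal (on_edge G len F e x))"
    have "ess_inf G len F \<le> - ?S" unfolding ess_inf_def using e by (rule INF_lower)
    with r have S: "ereal r < - ?S" by simp
    show "AE x in lebesgue_on {0..len e}. r \<le> on_edge G len F e x"
      using esssup_AE[of "\<lambda>x. - ereal (on_edge G len F e x)" "lebesgue_on {0..len e}"]
    proof eventually_elim
      case (elim x)
      then have "- ?S \<le> ereal (on_edge G len F e x)" by (simp add: ereal_uminus_le_reorder)
      with S have "ereal r < ereal (on_edge G len F e x)" by (rule less_le_trans)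
      then show ?case by simp
    qed
  qed
qed

text \<open>Continuity upgrades the essential bound to every point: the excess over \<open>A\<close>
  is continuous and zero almost everywhere, so its integral could not be positive.\<close>

lemma Linf_norm_bound:
  assumes u: "u \<in> H1 G len" and A: "Linf_norm G len u \<le> ennreal A" "0 \<le> A" and e: "e \<in> arcs G" and x: "x \<in> {0..len e}"
  shows "\<bar>on_edge G len u e x\<bar> \<le> A"
proof (rule ccontr)
  assume neg: "\<not> ?thesis"
  define q where "q x = max 0 (\<bar>on_edge G len u e x\<bar> - A)" for x
  have "continuous_on {0..len e} q"
    unfolding q_def by (intro continuous_intros H1_edge(1)[OF u e])
  then have "0 < (LINT x|lebesgue_on {0..len e}. q x)"
    by (rule continuous_nonneg_LINT_pos[OF _ _ x _ len_pos[OF e]]) (use neg in \<open>auto simp: q_def\<close>)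
  moreover have "AE x in lebesgue_on {0..len e}. q x = 0"
    using esssup_AE[of "\<lambda>x. ennreal \<bar>on_edge G len u e x\<bar>" "lebesgue_on {0..len e}"]
  proof eventually_elim
    case (elim x)
    also have "esssup (lebesgue_on {0..len e}) (\<lambda>x. ennreal \<bar>on_edge G len u e x\<bar>) \<le> ennreal A"
      using A(1) e unfolding Linf_norm_def SUP_le_iff by blast
    finally show ?case using A(2) by (simp add: q_def ennreal_le_iff)
  qed
  then have "(LINT x|lebesgue_on {0..len e}. q x) = 0" by (rule integral_eq_zero_AE)
  ultimately show False by simp
qed

lemma Linf_norm_le:
  assumes u: "u \<in> H1 G len" and A: "\<And>e x. e \<in> arcs G \<Longrightarrow> x \<in> {0..len e} \<Longrightarrow> \<bar>on_edge G len u e x\<bar> \<le> A"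
  shows "Linf_norm G len u \<le> ennreal A"
  unfolding Linf_norm_def
proof (rule SUP_least)
  fix e assume e: "e \<in> arcs G"
  have "on_edge G len u e \<in> borel_measurable (lebesgue_on {0..len e})"
    by (intro continuous_imp_measurable_on_sets_lebesgue H1_edge(1)[OF u e]) simp
  then show "esssup (lebesgue_on {0..len e}) (\<lambda>x. ennreal \<bar>on_edge G len u e x\<bar>) \<le> ennreal A"
    by (intro esssup_I AE_I2) (use A[OF e] in \<open>auto intro!: ennreal_leI\<close>)
qed

lemma H1_bounded:
  assumes u: "u \<in> H1 G len"
  obtains A where "\<And>e x. e \<in> arcs G \<Longrightarrow> x \<in> {0..len e} \<Longrightarrow> \<bar>on_edge G len u e x\<bar> \<le> A"
proof -
  have "\<exists>A. \<forall>x\<in>{0..len e}. \<bar>on_edge G len u e x\<bar> \<le> A" if "e \<in> arcs G" for e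
  proof -
    have "bounded (on_edge G len u e ` {0..len e})"
      using H1_edge(1)[OF u that] by (intro compact_imp_bounded compact_continuous_image) auto
    then show ?thesis unfolding bounded_iff by auto
  qed
  then obtain A where A: "\<And>e x. e \<in> arcs G \<Longrightarrow> x \<in> {0..len e} \<Longrightarrow> \<bar>on_edge G len u e x\<bar> \<le> A e"
    by metis
  have "A e \<le> (\<Sum>e\<in>arcs G. \<bar>A e\<bar>)" if "e \<in> arcs G" for e
    using member_le_sum[of e "arcs G" "\<lambda>e. \<bar>A e\<bar>"] finite_edges that by force
  then show thesis using A that by (meson order_trans)
qed

end

lemma C1_norm_ge: "x \<in> {0..l} \<Longrightarrow> ennreal \<bar>f x\<bar> \<le> C1_norm l f"
  unfolding C1_norm_def by (auto intro!: add_increasing2 SUP_upper2[of x])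

lemma C1_norm_le:
  assumes l: "0 < l" and D: "continuous_on {0..l} D" "\<And>x. x \<in> {0..l} \<Longrightarrow> (f has_real_derivative D x) (at x within {0..l})"
    and A: "\<And>x. x \<in> {0..l} \<Longrightarrow> \<bar>f x\<bar> \<le> A" and B: "\<And>x. x \<in> {0..l} \<Longrightarrow> \<bar>D x\<bar> \<le> B"
  shows "C1_norm l f \<le> ennreal A + ennreal B"
proof -
  have D': "(f has_vector_derivative D x) (at x within {0..l})" if "x \<in> {0..l}" for x
    using D(2)[OF that] by (simp add: has_real_derivative_iff_has_vector_derivative)
  then have "vector_derivative f (at x within {0..l}) = D x" if "x \<in> {0..l}" for x
    using that by (intro vector_derivative_within_closed_interval[OF l _ D'])
  moreover have "\<exists>f'. continuous_on {0..l} f' \<and> (\<forall>x\<in>{0..l}. (f has_vector_derivative f' x) (at x within {0..l}))"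
    using D(1) D' by blast
  ultimately show ?thesis
    unfolding C1_norm_def using A B by (auto intro!: add_mono SUP_least ennreal_leI)
qed

theorem corollary4p16:
  fixes G :: "('v, 'e) pre_digraph" and len :: "'e \<Rightarrow> real"
    and p \<Lambda> :: real
    and W \<rho> :: "('v, 'e) point \<Rightarrow> real"
    and \<U> :: "(real \<times> (('v, 'e) point \<Rightarrow> real)) set"
  assumes "compact_metric_graph G len"
    and "p > 2"
    and "W \<in> Linf G len"
    and "\<rho> \<in> Linf G len" and "ess_inf G len \<rho> > 0"
    and "\<Lambda> > 0"
    and "\<U> \<subseteq> {-\<Lambda>..\<Lambda>} \<times> H1 G len"
    and "\<And>lam u. (lam, u) \<in> \<U> \<Longrightarrow> is_solution G len W \<rho> p lam u"
  shows "(\<forall>(lam, u)\<in>\<U>. morse_index G len W \<rho> p lam u < \<infinity>) \<and>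
    ((SUP (lam, u)\<in>\<U>. Linf_norm G len u) < \<infinity> \<longleftrightarrow>
     (SUP (lam, u)\<in>\<U>. SUP e\<in>arcs G. C1_norm (len e) (on_edge G len u e)) < \<infinity>) \<and>
    ((SUP (lam, u)\<in>\<U>. SUP e\<in>arcs G. C1_norm (len e) (on_edge G len u e)) < \<infinity> \<longleftrightarrow>
     (SUP (lam, u)\<in>\<U>. morse_index G len W \<rho> p lam u) < \<infinity>)"
proof -
  interpret compact_metric_graph G len by fact
  note p = \<open>p > 2\<close>
  obtain B where B: "0 \<le> B" "\<And>e. e \<in> arcs G \<Longrightarrow> on_edge G len W e \<in> borel_measurable (lebesgue_on {0..len e})"
    "\<And>e. e \<in> arcs G \<Longrightarrow> AE x in lebesgue_on {0..len e}. \<bar>on_edge G len W e x\<bar> \<le> B"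
    using Linf_E[OF assms(3)] by blast
  obtain R0 where R0: "0 \<le> R0" "\<And>e. e \<in> arcs G \<Longrightarrow> on_edge G len \<rho> e \<in> borel_measurable (lebesgue_on {0..len e})"
    "\<And>e. e \<in> arcs G \<Longrightarrow> AE x in lebesgue_on {0..len e}. \<bar>on_edge G len \<rho> e x\<bar> \<le> R0"
    using Linf_E[OF assms(4)] by blast
  obtain r where r: "0 < r" "\<And>e. e \<in> arcs G \<Longrightarrow> AE x in lebesgue_on {0..len e}. r \<le> on_edge G len \<rho> e x"
    using ess_inf_pos_E[OF assms(5)] by blast
  define R where "R = max r R0"
  have R: "r \<le> R" "R0 \<le> R" "0 < R" using r by (auto simp: R_def)
  have \<rho>_upper: "AE x in lebesgue_on {0..len e}. on_edge G len \<rho> e x \<le> R" if "e \<in> arcs G" for e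
    using R0(3)[OF that] by eventually_elim (use R in linarith)
  define E where "E = B + \<Lambda>"
  have E: "0 \<le> E" using B assms(6) by (simp add: E_def)
  have U: "\<bar>lam\<bar> \<le> \<Lambda>" "u \<in> H1 G len" if "(lam, u) \<in> \<U>" for lam u
    using that assms(7) by (auto simp: abs_le_iff)
  have edge: "\<exists>w \<rho>'. edge_solution (len e) p r R E (on_edge G len u e) (edge_deriv G len u e) w \<rho>' \<and>
      (AE x in lebesgue_on {0..len e}. w x = on_edge G len W e x + lam) \<and>
      (AE x in lebesgue_on {0..len e}. \<rho>' x = on_edge G len \<rho> e x)"
    if "(lam, u) \<in> \<U>" "e \<in> arcs G" for lam u e
    using edge_solution_truncated[OF assms(8)[OF that(1)] that(2) p B(2)[OF that(2)] B(3)[OF that(2)] R0(2)[OF that(2)]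
        r(2)[OF that(2)] \<rho>_upper[OF that(2)] U(1)[OF that(1)] r(1) R(1) B(1)]
    unfolding E_def by blast
  note bounded = morse_index_bounded[OF p B(2) R0(2) B(3) R0(3) B(1) R0(1)]
  \<comment> \<open>The pivot of the proof: each of the three suprema is shown to be finite exactly
    when such an \<open>A\<close> exists.\<close>
  define bnd where "bnd A \<longleftrightarrow> (\<forall>(lam, u)\<in>\<U>. \<forall>e\<in>arcs G. \<forall>x\<in>{0..len e}. \<bar>on_edge G len u e x\<bar> \<le> A)" for A
  have finite: "morse_index G len W \<rho> p lam u < \<infinity>" if lu: "(lam, u) \<in> \<U>" for lam u
  proof -
    obtain A where "\<And>e x. e \<in> arcs G \<Longrightarrow> x \<in> {0..len e} \<Longrightarrow> \<bar>on_edge G len u e x\<bar> \<le> A"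
      using H1_bounded[OF U(2)[OF lu]] by blast
    then obtain N where "morse_index G len W \<rho> p lam u \<le> enat N"
      using bounded[of \<Lambda> A] U[OF lu] by blast
    then show ?thesis by (rule le_less_trans) simp
  qed
  have Linf_iff: "(SUP (lam, u)\<in>\<U>. Linf_norm G len u) < \<infinity> \<longleftrightarrow> (\<exists>A. bnd A)"
  proof
    assume fin: "(SUP (lam, u)\<in>\<U>. Linf_norm G len u) < \<infinity>"
    define A where "A = enn2real (SUP (lam, u)\<in>\<U>. Linf_norm G len u)"
    have A: "ennreal A = (SUP (lam, u)\<in>\<U>. Linf_norm G len u)" using fin by (simp add: A_def)
    have "Linf_norm G len u \<le> ennreal A" if "(lam, u) \<in> \<U>" for lam u
      unfolding A by (rule SUP_upper2[OF that]) simp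
    then have "bnd A" unfolding bnd_def using Linf_norm_bound[OF U(2)] by (fastforce simp: A_def)
    then show "\<exists>A. bnd A" ..
  next
    assume "\<exists>A. bnd A"
    then obtain A where A: "bnd A" ..
    have "(SUP (lam, u)\<in>\<U>. Linf_norm G len u) \<le> ennreal A"
      by (rule SUP_least) (use A U in \<open>auto simp: bnd_def intro!: Linf_norm_le\<close>)
    then show "(SUP (lam, u)\<in>\<U>. Linf_norm G len u) < \<infinity>" by (rule le_less_trans) simp
  qed
  let ?C1 = "SUP (lam, u)\<in>\<U>. SUP e\<in>arcs G. C1_norm (len e) (on_edge G len u e)"
  have C1_iff: "?C1 < \<infinity> \<longleftrightarrow> (\<exists>A. bnd A)"
  proof
    assume fin: "?C1 < \<infinity>"
    define A where "A = enn2real ?C1"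
    have A: "ennreal A = ?C1" using fin by (simp add: A_def)
    have "bnd A" unfolding bnd_def
    proof clarify
      fix lam u e x assume u: "(lam, u) \<in> \<U>" and e: "e \<in> arcs G" and x: "x \<in> {0..len e}"
      have "ennreal \<bar>on_edge G len u e x\<bar> \<le> C1_norm (len e) (on_edge G len u e)" by (rule C1_norm_ge[OF x])
      also have "\<dots> \<le> (SUP e\<in>arcs G. C1_norm (len e) (on_edge G len u e))" by (rule SUP_upper[OF e])
      also have "\<dots> \<le> ennreal A" unfolding A by (rule SUP_upper2[OF u]) simp
      finally show "\<bar>on_edge G len u e x\<bar> \<le> A" by (simp add: A_def ennreal_le_iff)
    qed
    then show "\<exists>A. bnd A" ..
  next
    assume "\<exists>A. bnd A"
    then obtain A0 where A0: "bnd A0" ..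
    \<comment> \<open>If \<open>\<U>\<close> or the edge set is empty, \<open>bnd\<close> holds for
      negative numbers too; the maximum restores the sign.\<close>
    define A where "A = max 0 A0"
    have A: "0 \<le> A" "\<And>lam u e x. (lam, u) \<in> \<U> \<Longrightarrow> e \<in> arcs G \<Longrightarrow> x \<in> {0..len e} \<Longrightarrow> \<bar>on_edge G len u e x\<bar> \<le> A"
    proof -
      show "0 \<le> A" by (simp add: A_def)
      fix lam u e x assume "(lam, u) \<in> \<U>" "e \<in> arcs G" "x \<in> {0..len e}"
      then have "\<bar>on_edge G len u e x\<bar> \<le> A0" using A0 unfolding bnd_def by blast
      then show "\<bar>on_edge G len u e x\<bar> \<le> A" by (simp add: A_def)
    qed
    define K where "K e = 2 * A / len e + len e * (R * A powr (p - 1) + E * A)" for e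
    have K0: "0 \<le> K e" if "e \<in> arcs G" for e
      using A(1) R E len_pos[OF that] unfolding K_def
      by (intro add_nonneg_nonneg mult_nonneg_nonneg divide_nonneg_pos) auto
    have "?C1 \<le> ennreal A + ennreal (sum K (arcs G))"
    proof (intro SUP_least, clarify, intro SUP_least)
      fix lam u e assume u: "(lam, u) \<in> \<U>" and e: "e \<in> arcs G"
      obtain w \<rho>' where "edge_solution (len e) p r R E (on_edge G len u e) (edge_deriv G len u e) w \<rho>'"
        using edge[OF u e] by blast
      then interpret S: edge_solution "len e" p r R E "on_edge G len u e" "edge_deriv G len u e" w \<rho>' .
      have "K e \<le> sum K (arcs G)" using K0 e finite_edges by (intro member_le_sum) auto
      then have "\<bar>S.D x\<bar> \<le> sum K (arcs G)" if "x \<in> {0..len e}" for x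
        using S.D_bound[OF A(2)[OF u e] that] unfolding K_def by linarith
      then show "C1_norm (len e) (on_edge G len u e) \<le> ennreal A + ennreal (sum K (arcs G))"
        by (intro C1_norm_le[OF S.l S.D_continuous S.f_has_derivative A(2)[OF u e]])
    qed
    then show "?C1 < \<infinity>" by (rule le_less_trans) simp
  qed
  have morse_iff: "(SUP (lam, u)\<in>\<U>. morse_index G len W \<rho> p lam u) < \<infinity> \<longleftrightarrow> (\<exists>A. bnd A)"
  proof
    assume "(SUP (lam, u)\<in>\<U>. morse_index G len W \<rho> p lam u) < \<infinity>"
    then obtain N where N: "(SUP (lam, u)\<in>\<U>. morse_index G len W \<rho> p lam u) = enat N" by auto
    \<comment> \<open>With \<open>Suc N\<close> nodal intervals on a single edge the index would
      exceed \<open>N\<close>, so every |u| stays below the threshold of its edge; the sum of the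
      absolute thresholds bounds all edges together.\<close>
    have "\<exists>M. \<forall>f g w \<rho>. edge_solution (len e) p r R E f g w \<rho> \<longrightarrow> (\<exists>x\<in>{0..len e}. M \<le> \<bar>f x\<bar>) \<longrightarrow>
        (\<exists>\<alpha> \<beta>. edge_solution.nodal_intervals (len e) f (Suc N) \<alpha> \<beta>)" if "e \<in> arcs G" for e
      by (rule large_solutions_oscillate[OF len_pos[OF that] p r(1) R(3) E])
    then obtain M where M: "\<And>e f g w \<rho>. e \<in> arcs G \<Longrightarrow> edge_solution (len e) p r R E f g w \<rho> \<Longrightarrow>
        \<exists>x\<in>{0..len e}. M e \<le> \<bar>f x\<bar> \<Longrightarrow> \<exists>\<alpha> \<beta>. edge_solution.nodal_intervals (len e) f (Suc N) \<alpha> \<beta>"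
      by metis
    have "bnd (\<Sum>e\<in>arcs G. \<bar>M e\<bar>)" unfolding bnd_def
    proof (clarify, rule ccontr)
      fix lam u e x assume u: "(lam, u) \<in> \<U>" and e: "e \<in> arcs G" and x: "x \<in> {0..len e}"
        and big: "\<not> \<bar>on_edge G len u e x\<bar> \<le> (\<Sum>e\<in>arcs G. \<bar>M e\<bar>)"
      obtain w \<rho>' where sol: "edge_solution (len e) p r R E (on_edge G len u e) (edge_deriv G len u e) w \<rho>'"
        and w: "AE x in lebesgue_on {0..len e}. w x = on_edge G len W e x + lam"
        and \<rho>': "AE x in lebesgue_on {0..len e}. \<rho>' x = on_edge G len \<rho> e x"
        using edge[OF u e] by blast
      have "\<bar>M e\<bar> \<le> (\<Sum>e\<in>arcs G. \<bar>M e\<bar>)" using e finite_edges by (intro member_le_sum) auto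
      then have "M e \<le> \<bar>on_edge G len u e x\<bar>" using big by linarith
      then obtain \<alpha> \<beta> where "edge_solution.nodal_intervals (len e) (on_edge G len u e) (Suc N) \<alpha> \<beta>"
        using M[OF e sol] x by blast
      from morse_index_ge_nodal[OF U(2)[OF u] e B(2)[OF e] R0(2)[OF e] sol w \<rho>' this]
      have "enat (Suc N) \<le> morse_index G len W \<rho> p lam u" .
      also have "\<dots> \<le> enat N" unfolding N[symmetric] by (rule SUP_upper2[OF u]) simp
      finally show False by simp
    qed
    then show "\<exists>A. bnd A" ..
  next
    assume "\<exists>A. bnd A"
    then obtain A where A: "bnd A" ..
    obtain N where N: "\<forall>lam u. \<bar>lam\<bar> \<le> \<Lambda> \<longrightarrow> u \<in> H1 G len \<longrightarrow>
      (\<forall>e\<in>arcs G. \<forall>x\<in>{0..len e}. \<bar>on_edge G len u e x\<bar> \<le> A) \<longrightarrow> morse_index G len W \<rho> p lam u \<le> enat N"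
      using bounded[of \<Lambda> A] by blast
    have "(SUP (lam, u)\<in>\<U>. morse_index G len W \<rho> p lam u) \<le> enat N"
    proof (intro SUP_least, clarify)
      fix lam u assume u: "(lam, u) \<in> \<U>"
      then have "\<forall>e\<in>arcs G. \<forall>x\<in>{0..len e}. \<bar>on_edge G len u e x\<bar> \<le> A"
        using A unfolding bnd_def by blast
      then show "morse_index G len W \<rho> p lam u \<le> enat N" using N U[OF u] by blast
    qed
    then show "(SUP (lam, u)\<in>\<U>. morse_index G len W \<rho> p lam u) < \<infinity>" by (rule le_less_trans) simp
  qed
  show ?thesis using finite Linf_iff C1_iff morse_iff by blast
qed

end
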